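(* Let $\kappa$ be a regular uncountable cardinal, $\chi<\kappa$ an infinite regular cardinal such that $\kappa$ is $({<}\chi)$-closed, and $\varsigma<\kappa$ an ordinal. If $\mathrm P^\bullet(\kappa,\kappa,{}_\chi{\sqsubseteq},\kappa,\{E^\kappa_{\ge\chi}\},2)$ holds, then there exists a normal, prolific, $\varsigma$-splitting, $\chi$-complete, $\chi$-free streamlined $\kappa$-Souslin tree.
   Context: $\kappa$ is $({<}\chi)$-closed if $\lambda^{<\chi}<\kappa$ for all $\lambda<\kappa$. $E^\kappa_{\ge\chi}:=\{\alpha<\kappa\mid\mathrm{cf}(\alpha)\ge\chi\}$. $H_\kappa$: sets of hereditary cardinality $<\kappa$. A streamlined tree is a set $T\subseteq{}^{<\kappa}H_\kappa$ closed under restrictions, ordered by $\subsetneq$; $T_\alpha:=T\cap{}^\alpha H_\kappa$. It is a streamlined $\kappa$-Souslin tree if $(T,\subsetneq)$ has height $\kappa$, levels of size $<\kappa$, and no branch or antichain of size $\kappa$. $T$ is normal if for $\alpha<\beta$ with $T_\beta\neq\emptyset$ every $s\in T_\alpha$ extends to some element of $T_\beta$; prolific if for all $\alpha<\kappa$, $t\in T_\alpha$, $\{t^\frown\langle i\rangle\mid i<\max\{\omega,\alpha\}\}\subseteq T_{\alpha+1}$; $\varsigma$-splitting if every node has at least $\varsigma$ immediate successors; $\chi$-complete if unions of $\subsetneq$-increasing sequences from $T$ of length $<\chi$ lie in $T$. For a function $x:\alpha\to{}^\tau H_\kappa$ and $i<\tau$, $(x)_i:=\langle x(\varepsilon)(i)\mid\varepsilon<\alpha\rangle$.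 For a nonempty sequence $\vec s=\langle s_i\mid i<\tau\rangle$ of elements of $T$, the derived tree $T(\vec s)$ is the set of all functions $x:\alpha\to{}^\tau H_\kappa$ ($\alpha$ an ordinal) such that $(x)_i\cup s_i\in T$ for all $i<\tau$. $T$ is $\chi$-free if it is $\kappa$-Souslin and for every $\delta<\kappa$ and every nonempty injective sequence $\vec s$ of length $<\chi$ of elements of $T_\delta$, $(T(\vec s),\subsetneq)$ is again a $\kappa$-Souslin tree. Notation: $\mathrm{acc}(C):=\{\alpha\in C\mid\sup(C\cap\alpha)=\alpha>0\}$; $C(j)$ is the $j$-th element of $C$; $\mathrm{succ}_n(C):=\{C(j+1)\mid j<n,\ j+1<\mathrm{otp}(C)\}$; $\mathrm{acc}(\kappa)$: nonzero limit ordinals below $\kappa$. $\mathcal F(\kappa)$: functions $C$ whose domain $\partial C$ is a nonempty club subset of $\sup(\partial C)$ not containing its supremum, with values in $H_\kappa$; $\alpha_C:=\sup(\partial C)$. $C\,{}_\chi{\sqsubseteq}\,D$ iff ($C=D\restriction\alpha_C$ or $\mathrm{cf}(\alpha_C)<\chi$). For $B\subseteq\kappa$, $\Omega\subseteq H_\kappa$, $p\in H_{\kappa^+}$, $C\in\mathcal F(\kappa)$: $B(\Omega,p,C)$ is the set of $\beta\in B\cap\partial C$ for which some $\mathcal M\prec H_{\kappa^+}$ has $p\in\mathcal M$, $\mathcal M\cap\kappa=\beta$, $\mathcal M\cap\Omega=C(\beta)$. $\mathrm P^\bullet(\kappa,\mu,\mathcal R,\theta,\mathcal S,\nu)$ asserts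 the existence of $\langle\mathcal C_\alpha\mid\alpha<\kappa\rangle$ and a partition $\langle B_\iota\mid\iota<\kappa\rangle$ of $\kappa$ such that for every $\alpha\in\mathrm{acc}(\kappa)$: $\mathcal C_\alpha\subseteq\{C\in\mathcal F(\kappa)\mid\alpha_C=\alpha\}$, $0<|\mathcal C_\alpha|<\mu$, and for all $C\in\mathcal C_\alpha$, $\bar\alpha\in\mathrm{acc}(\partial C)$ there is $D\in\mathcal C_{\bar\alpha}$ with $D\,\mathcal R\,C$; and for every $\langle(\Omega_i,p_i,\iota_i)\mid i<\theta\rangle$ of elements of $\mathcal P(H_\kappa)\times H_{\kappa^+}\times\kappa$, every $S\in\mathcal S$ and every $n<\omega$, there are stationarily many $\alpha\in S$ with $|\mathcal C_\alpha|<\nu$ such that for all $C\in\mathcal C_\alpha$, $i<\min\{\alpha,\theta\}$: $\sup\{\gamma\in\partial C\mid\mathrm{succ}_n(\partial C\setminus\gamma)\subseteq B_{\iota_i}(\Omega_i,p_i,C)\}=\alpha$. *)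

theory Defs
  imports "HOL-Library.Countable_Set" "HOL-Library.Disjoint_Sets"
begin

unbundle cardinal_syntax

text \<open>
  The universe of sets. The type \<open>'k hset\<close> consists of all well-founded sets of hereditary
  cardinality at most that of the type \<open>'k\<close>: it is obtained from well-founded trees whose nodes
  have at most \<open>'k\<close>-many children by identifying trees that represent the same set. The lemmas
  \<open>elts_inject\<close>, \<open>elts_vset\<close>, \<open>card_elts\<close> and \<open>hset_induct\<close> characterise it up to isomorphism.
  For a cardinal \<open>\<kappa>\<close> of this universe it contains all of \<open>H\<close> of \<open>\<kappa>\<close> and \<open>H\<close> of \<open>\<kappa>\<^sup>+\<close>. Ordinals are
  von Neumann ordinals. Subsets of the universe are ordinary sets; set-theoretic functions are
  partial maps, inclusion of functions being \<open>\<subseteq>\<^sub>m\<close> and unions being taken on graphs.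
\<close>

datatype 'k pre = Pre "'k \<Rightarrow> 'k pre option"

primrec kids :: "'k pre \<Rightarrow> 'k pre set" where
  "kids (Pre f) = {t. \<exists>i. f i = Some t}"

lemma pre_kids_induct:
  assumes "\<And>x. (\<And>y. y \<in> kids x \<Longrightarrow> P y) \<Longrightarrow> P x"
  shows "P x"
proof (induction x)
  case (Pre f)
  have "P y" if "y \<in> kids (Pre f)" for y
  proof -
    from that obtain i where "f i = Some y" by auto
    then show ?thesis using Pre[of "f i" y] by (metis rangeI option.set_intros)
  qed
  then show ?case by (rule assms)
qed

inductive pre_eq :: "'k pre \<Rightarrow> 'k pre \<Rightarrow> bool" where
  "\<lbrakk>\<forall>a\<in>kids x. \<exists>b\<in>kids y. pre_eq a b; \<forall>b\<in>kids y. \<exists>a\<in>kids x. pre_eq a b\<rbrakk> \<Longrightarrow> pre_eq x y"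

lemma pre_eq_iff:
  "pre_eq x y \<longleftrightarrow>
    (\<forall>a\<in>kids x. \<exists>b\<in>kids y. pre_eq a b) \<and> (\<forall>b\<in>kids y. \<exists>a\<in>kids x. pre_eq a b)"
  by (subst pre_eq.simps) simp

lemma pre_eq_refl: "pre_eq x x"
  by (induction x rule: pre_kids_induct) (subst pre_eq_iff, blast)

lemma pre_eq_sym: "pre_eq x y \<Longrightarrow> pre_eq y x"
proof (induction rule: pre_eq.induct)
  case (1 x y)
  then show ?case by (subst pre_eq_iff) blast
qed

lemma pre_eq_trans: "pre_eq x y \<Longrightarrow> pre_eq y z \<Longrightarrow> pre_eq x z"
proof (induction x arbitrary: y z rule: pre_kids_induct)
  case (1 x)
  note xy = 1(2)[unfolded pre_eq_iff[of x y]] and yz = 1(3)[unfolded pre_eq_iff[of y z]]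
  show ?case
    by (subst pre_eq_iff) (meson xy yz 1(1))
qed

quotient_type 'k hset = "'k pre" / pre_eq
  by (intro equivpI reflpI sympI transpI) (blast intro: pre_eq_refl pre_eq_sym pre_eq_trans)+

definition elts :: "'k hset \<Rightarrow> 'k hset set" where
  "elts x = abs_hset ` kids (rep_hset x)"

definition vset :: "'k hset set \<Rightarrow> 'k hset" where
  "vset X = (THE x. elts x = X)"

lemma abs_hset_eq_iff: "abs_hset s = abs_hset t \<longleftrightarrow> pre_eq s t"
  using Quotient3_rel[OF Quotient3_hset] pre_eq_refl by blast

lemma abs_rep_hset: "abs_hset (rep_hset x) = x"
  by (rule Quotient3_abs_rep[OF Quotient3_hset])

lemma elts_abs: "elts (abs_hset t) = abs_hset ` kids t"
proof -
  have "pre_eq (rep_hset (abs_hset t)) t"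
    using abs_hset_eq_iff abs_rep_hset by blast
  then show ?thesis
    unfolding elts_def image_def pre_eq_iff[of "rep_hset (abs_hset t)"]
    by (auto, (metis abs_hset_eq_iff)+)
qed

lemma elts_inject: "elts x = elts y \<longleftrightarrow> x = y"
proof
  assume eq: "elts x = elts y"
  have "pre_eq (rep_hset x) (rep_hset y)"
  proof (subst pre_eq_iff, intro conjI ballI)
    fix a assume "a \<in> kids (rep_hset x)"
    then have "abs_hset a \<in> elts y" using eq unfolding elts_def by blast
    then show "\<exists>b\<in>kids (rep_hset y). pre_eq a b"
      unfolding elts_def by (auto simp: abs_hset_eq_iff)
  next
    fix b assume "b \<in> kids (rep_hset y)"
    then have "abs_hset b \<in> elts x" using eq unfolding elts_def by blast
    then obtain a where "a \<in> kids (rep_hset x)" "pre_eq b a"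
      unfolding elts_def by (auto simp: abs_hset_eq_iff)
    then show "\<exists>a\<in>kids (rep_hset x). pre_eq a b"
      using pre_eq_sym by blast
  qed
  then show "x = y" by (metis abs_hset_eq_iff abs_rep_hset)
qed simp

lemma card_kids: "|kids (t :: 'k pre)| \<le>o |UNIV :: 'k set|"
proof (cases t)
  case (Pre f)
  have "kids t \<subseteq> (\<lambda>i. the (f i)) ` UNIV"
    using Pre by (auto simp: image_iff) (metis option.sel)
  then show ?thesis
    using card_of_image card_of_mono1 ordLeq_transitive by blast
qed

lemma card_elts: "|elts (x :: 'k hset)| \<le>o |UNIV :: 'k set|"
  unfolding elts_def using card_of_image card_kids ordLeq_transitive by blast

lemma elts_vset:
  fixes X :: "'k hset set"
  assumes "|X| \<le>o |UNIV :: 'k set|"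
  shows "elts (vset X) = X"
proof -
  obtain g :: "'k hset \<Rightarrow> 'k" where g: "inj_on g X"
    using assms card_of_ordLeq[of X "UNIV :: 'k set"] by auto
  define f where
    "f i = (if i \<in> g ` X then Some (rep_hset (inv_into X g i)) else None)" for i
  have "kids (Pre f) = rep_hset ` X"
    using g by (auto simp: f_def inv_into_f_f image_iff split: if_splits) (metis inv_into_f_f)
  then have X: "elts (abs_hset (Pre f)) = X"
    by (simp add: elts_abs image_image abs_rep_hset)
  then show ?thesis
    unfolding vset_def by (rule theI) (metis X elts_inject)
qed

lemma hset_induct:
  assumes "\<And>x. (\<And>y. y \<in> elts x \<Longrightarrow> P y) \<Longrightarrow> P x"
  shows "P x"
proof -
  have "P (abs_hset t)" for t
    by (induction t rule: pre_kids_induct) (rule assms, auto simp: elts_abs)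
  then show ?thesis by (metis abs_rep_hset)
qed


section \<open>Ordinals and cardinals\<close>

definition Ord :: "'k hset \<Rightarrow> bool" where
  "Ord \<alpha> \<longleftrightarrow> (\<forall>\<beta>\<in>elts \<alpha>. elts \<beta> \<subseteq> elts \<alpha> \<and> (\<forall>\<gamma>\<in>elts \<beta>. elts \<gamma> \<subseteq> elts \<beta>))"

definition ozero :: "'k hset" where
  "ozero = vset {}"

definition osucc :: "'k hset \<Rightarrow> 'k hset" where
  "osucc \<alpha> = vset (insert \<alpha> (elts \<alpha>))"

definition omega :: "'k hset" where
  "omega = vset (range (\<lambda>n. (osucc ^^ n) ozero))"

definition osup :: "'k hset set \<Rightarrow> 'k hset" where
  "osup X = vset (\<Union> (elts ` X))"

definition Cardinal_ord :: "'k hset \<Rightarrow> bool" where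
  "Cardinal_ord \<kappa> \<longleftrightarrow> Ord \<kappa> \<and> (\<forall>\<alpha>\<in>elts \<kappa>. |elts \<alpha>| <o |elts \<kappa>| )"

definition cofinal_length :: "'k hset \<Rightarrow> 'k hset \<Rightarrow> bool" where
  "cofinal_length \<beta> \<alpha> \<longleftrightarrow>
    (\<exists>f. f ` elts \<beta> \<subseteq> elts \<alpha> \<and> (\<forall>\<xi>\<in>elts \<alpha>. \<exists>\<eta>\<in>elts \<beta>. \<xi> = f \<eta> \<or> \<xi> \<in> elts (f \<eta>)))"

definition cofin :: "'k hset \<Rightarrow> 'k hset" where
  "cofin \<alpha> = (THE \<beta>. Ord \<beta> \<and> cofinal_length \<beta> \<alpha> \<and> (\<forall>\<gamma>\<in>elts \<beta>. \<not> cofinal_length \<gamma> \<alpha>))"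

definition regular_card :: "'k hset \<Rightarrow> bool" where
  "regular_card \<kappa> \<longleftrightarrow> Cardinal_ord \<kappa> \<and> infinite (elts \<kappa>) \<and> cofin \<kappa> = \<kappa>"

text \<open>\<open>\<xi>\<close> to the power \<open><\<chi>\<close> is the number of functions from ordinals below \<open>\<chi>\<close> to \<open>\<xi>\<close>.\<close>

definition less_closed :: "'k hset \<Rightarrow> 'k hset \<Rightarrow> bool" where
  "less_closed \<chi> \<kappa> \<longleftrightarrow>
    (\<forall>\<xi>\<in>elts \<kappa>.
      |{f :: 'k hset \<rightharpoonup> 'k hset. \<exists>\<mu>\<in>elts \<chi>. dom f = elts \<mu> \<and> ran f \<subseteq> elts \<xi>}| <o |elts \<kappa>| )"

definition E_ge :: "'k hset \<Rightarrow> 'k hset \<Rightarrow> 'k hset set" where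
  "E_ge \<kappa> \<chi> = {\<alpha> \<in> elts \<kappa>. \<chi> = cofin \<alpha> \<or> \<chi> \<in> elts (cofin \<alpha>)}"

definition otp :: "('a \<Rightarrow> 'a \<Rightarrow> bool) \<Rightarrow> 'a set \<Rightarrow> 'k hset" where
  "otp lt A = (THE \<alpha>. Ord \<alpha> \<and>
    (\<exists>f. bij_betw f (elts \<alpha>) A \<and>
      (\<forall>\<xi>\<in>elts \<alpha>. \<forall>\<eta>\<in>elts \<alpha>. \<xi> \<in> elts \<eta> \<longleftrightarrow> lt (f \<xi>) (f \<eta>))))"

definition ord_otp :: "'k hset set \<Rightarrow> 'k hset" where
  "ord_otp = otp (\<lambda>\<xi> \<eta>. \<xi> \<in> elts \<eta>)"

definition nth_elem :: "'k hset set \<Rightarrow> 'k hset \<Rightarrow> 'k hset" where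
  "nth_elem D j = (THE \<gamma>. \<gamma> \<in> D \<and> ord_otp (D \<inter> elts \<gamma>) = j)"

definition succ_set :: "'k hset \<Rightarrow> 'k hset set \<Rightarrow> 'k hset set" where
  "succ_set n D = {nth_elem D (osucc j) | j. j \<in> elts n \<and> osucc j \<in> elts (ord_otp D)}"

definition acc_pts :: "'k hset set \<Rightarrow> 'k hset set" where
  "acc_pts D = {\<alpha> \<in> D. osup (D \<inter> elts \<alpha>) = \<alpha> \<and> \<alpha> \<noteq> ozero}"

definition club_in :: "'k hset set \<Rightarrow> 'k hset \<Rightarrow> bool" where
  "club_in D \<delta> \<longleftrightarrow> Ord \<delta> \<and> D \<subseteq> elts \<delta> \<and> osup D = \<delta> \<and>
    (\<forall>\<beta>\<in>elts \<delta>. \<beta> \<noteq> ozero \<and> osup (D \<inter> elts \<beta>) = \<beta> \<longrightarrow> \<beta> \<in> D)"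

definition stationary_in :: "'k hset set \<Rightarrow> 'k hset \<Rightarrow> bool" where
  "stationary_in S \<kappa> \<longleftrightarrow> S \<subseteq> elts \<kappa> \<and> (\<forall>D. club_in D \<kappa> \<longrightarrow> S \<inter> D \<noteq> {})"


section \<open>Hereditary cardinality and elementary submodels\<close>

definition tcl :: "'k hset \<Rightarrow> 'k hset set" where
  "tcl x = {y. (y, x) \<in> {(u, v). u \<in> elts v}\<^sup>+}"

definition hered :: "'b rel \<Rightarrow> 'k hset set" where
  "hered r = {x. |tcl x| <o r}"

abbreviation H_card :: "'k hset \<Rightarrow> 'k hset set" where
  "H_card \<kappa> \<equiv> hered |elts \<kappa>|"

abbreviation H_plus :: "'k hset \<Rightarrow> 'k hset set" where
  "H_plus \<kappa> \<equiv> hered (cardSuc |elts \<kappa>| )"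

datatype fm = FMem nat nat | FEq nat nat | FNeg fm | FConj fm fm | FEx nat fm

primrec sat :: "'k hset set \<Rightarrow> (nat \<Rightarrow> 'k hset) \<Rightarrow> fm \<Rightarrow> bool" where
  "sat A e (FMem i j) \<longleftrightarrow> e i \<in> elts (e j)"
| "sat A e (FEq i j) \<longleftrightarrow> e i = e j"
| "sat A e (FNeg \<phi>) \<longleftrightarrow> \<not> sat A e \<phi>"
| "sat A e (FConj \<phi> \<psi>) \<longleftrightarrow> sat A e \<phi> \<and> sat A e \<psi>"
| "sat A e (FEx i \<phi>) \<longleftrightarrow> (\<exists>a\<in>A. sat A (e(i := a)) \<phi>)"

definition elem_submodel :: "'k hset set \<Rightarrow> 'k hset set \<Rightarrow> bool" where
  "elem_submodel M N \<longleftrightarrow> M \<noteq> {} \<and> M \<subseteq> N \<and>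
    (\<forall>\<phi> e. range e \<subseteq> M \<longrightarrow> (sat M e \<phi> \<longleftrightarrow> sat N e \<phi>))"


section \<open>The proxy principle\<close>

type_synonym 'k hfun = "'k hset \<rightharpoonup> 'k hset"

definition sup_dom :: "'k hfun \<Rightarrow> 'k hset" where
  "sup_dom C = osup (dom C)"

definition club_funs :: "'k hset \<Rightarrow> 'k hfun set" where
  "club_funs \<kappa> = {C. dom C \<noteq> {} \<and> club_in (dom C) (osup (dom C)) \<and> osup (dom C) \<notin> dom C \<and>
    ran C \<subseteq> H_card \<kappa>}"

definition sqsub :: "'k hset \<Rightarrow> 'k hfun \<Rightarrow> 'k hfun \<Rightarrow> bool" where
  "sqsub \<chi> C D \<longleftrightarrow> C = D |` elts (sup_dom C) \<or> cofin (sup_dom C) \<in> elts \<chi>"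

definition guess ::
    "'k hset \<Rightarrow> 'k hset set \<Rightarrow> 'k hset set \<Rightarrow> 'k hset \<Rightarrow> 'k hfun \<Rightarrow> 'k hset set" where
  "guess \<kappa> B \<Omega> p C = {\<beta> \<in> B \<inter> dom C.
    \<exists>M. elem_submodel M (H_plus \<kappa>) \<and> p \<in> M \<and> M \<inter> elts \<kappa> = elts \<beta> \<and>
      M \<inter> \<Omega> = elts (the (C \<beta>))}"

text \<open>
  Cells of the partition \<open>B\<close> are not required to be nonempty; whenever \<open>\<theta>\<close> is nonzero, \<open>\<S>\<close> is
  nonempty and \<open>\<kappa>\<close> is regular uncountable this follows from the guessing clause.
\<close>

definition P_bullet ::
    "'k hset \<Rightarrow> 'k hset \<Rightarrow> ('k hfun \<Rightarrow> 'k hfun \<Rightarrow> bool) \<Rightarrow> 'k hset \<Rightarrow> 'k hset set set \<Rightarrow> 'k hset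
      \<Rightarrow> bool" where
  "P_bullet \<kappa> \<mu> R \<theta> \<S> \<nu> \<longleftrightarrow>
    (\<exists>(\<C> :: 'k hset \<Rightarrow> 'k hfun set) (B :: 'k hset \<Rightarrow> 'k hset set).
      disjoint_family_on B (elts \<kappa>) \<and> (\<Union>\<iota>\<in>elts \<kappa>. B \<iota>) = elts \<kappa> \<and>
      (\<forall>\<alpha>\<in>acc_pts (elts \<kappa>).
        \<C> \<alpha> \<subseteq> {C \<in> club_funs \<kappa>. sup_dom C = \<alpha>} \<and> \<C> \<alpha> \<noteq> {} \<and> |\<C> \<alpha>| <o |elts \<mu>| \<and>
        (\<forall>C\<in>\<C> \<alpha>. \<forall>\<alpha>'\<in>acc_pts (dom C). \<exists>D\<in>\<C> \<alpha>'. R D C)) \<and>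
      (\<forall>\<Omega> p \<iota>.
        (\<forall>i\<in>elts \<theta>. \<Omega> i \<subseteq> H_card \<kappa> \<and> p i \<in> H_plus \<kappa> \<and> \<iota> i \<in> elts \<kappa>) \<longrightarrow>
        (\<forall>S\<in>\<S>. \<forall>n\<in>elts omega.
          stationary_in
            {\<alpha> \<in> S. |\<C> \<alpha>| <o |elts \<nu>| \<and>
              (\<forall>C\<in>\<C> \<alpha>. \<forall>i\<in>elts \<alpha> \<inter> elts \<theta>.
                osup {\<gamma> \<in> dom C. succ_set n (dom C - elts \<gamma>) \<subseteq> guess \<kappa> (B (\<iota> i)) (\<Omega> i) (p i) C}
                  = \<alpha>)}
            \<kappa>)))"


section \<open>Trees\<close>

definition preds :: "'a set \<Rightarrow> ('a \<Rightarrow> 'a \<Rightarrow> bool) \<Rightarrow> 'a \<Rightarrow> 'a set" where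
  "preds X lt x = {y \<in> X. lt y x}"

definition is_tree :: "'a set \<Rightarrow> ('a \<Rightarrow> 'a \<Rightarrow> bool) \<Rightarrow> bool" where
  "is_tree X lt \<longleftrightarrow> (\<forall>x\<in>X. \<not> lt x x) \<and>
    (\<forall>x\<in>X. \<forall>y\<in>X. \<forall>z\<in>X. lt x y \<longrightarrow> lt y z \<longrightarrow> lt x z) \<and>
    (\<forall>x\<in>X. wfp_on (preds X lt x) lt \<and>
      (\<forall>y\<in>preds X lt x. \<forall>z\<in>preds X lt x. y = z \<or> lt y z \<or> lt z y))"

definition tree_height :: "'a set \<Rightarrow> ('a \<Rightarrow> 'a \<Rightarrow> bool) \<Rightarrow> 'k hset" where
  "tree_height X lt = osup ((\<lambda>x. osucc (otp lt (preds X lt x))) ` X)"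

definition tree_level :: "'a set \<Rightarrow> ('a \<Rightarrow> 'a \<Rightarrow> bool) \<Rightarrow> 'k hset \<Rightarrow> 'a set" where
  "tree_level X lt \<alpha> = {x \<in> X. otp lt (preds X lt x) = \<alpha>}"

definition is_chain :: "'a set \<Rightarrow> ('a \<Rightarrow> 'a \<Rightarrow> bool) \<Rightarrow> 'a set \<Rightarrow> bool" where
  "is_chain X lt A \<longleftrightarrow> A \<subseteq> X \<and> (\<forall>x\<in>A. \<forall>y\<in>A. x = y \<or> lt x y \<or> lt y x)"

text \<open>A branch is a maximal chain.\<close>

definition is_branch :: "'a set \<Rightarrow> ('a \<Rightarrow> 'a \<Rightarrow> bool) \<Rightarrow> 'a set \<Rightarrow> bool" where
  "is_branch X lt A \<longleftrightarrow> is_chain X lt A \<and> (\<forall>A'. is_chain X lt A' \<and> A \<subseteq> A' \<longrightarrow> A' = A)"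

definition is_antichain :: "'a set \<Rightarrow> ('a \<Rightarrow> 'a \<Rightarrow> bool) \<Rightarrow> 'a set \<Rightarrow> bool" where
  "is_antichain X lt A \<longleftrightarrow> A \<subseteq> X \<and> (\<forall>x\<in>A. \<forall>y\<in>A. \<not> lt x y)"

definition souslin :: "'k hset \<Rightarrow> 'a set \<Rightarrow> ('a \<Rightarrow> 'a \<Rightarrow> bool) \<Rightarrow> bool" where
  "souslin \<kappa> X lt \<longleftrightarrow> is_tree X lt \<and> tree_height X lt = \<kappa> \<and>
    (\<forall>\<alpha>\<in>elts \<kappa>. |tree_level X lt \<alpha>| <o |elts \<kappa>| ) \<and>
    (\<nexists>A. is_branch X lt A \<and> |A| =o |elts \<kappa>| ) \<and>
    (\<nexists>A. is_antichain X lt A \<and> |A| =o |elts \<kappa>| )"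

definition map_less :: "('a \<rightharpoonup> 'b) \<Rightarrow> ('a \<rightharpoonup> 'b) \<Rightarrow> bool" where
  "map_less s t \<longleftrightarrow> s \<subseteq>\<^sub>m t \<and> s \<noteq> t"

definition streamlined :: "'k hset \<Rightarrow> 'k hfun set \<Rightarrow> bool" where
  "streamlined \<kappa> T \<longleftrightarrow>
    T \<subseteq> {t. \<exists>\<alpha>\<in>elts \<kappa>. dom t = elts \<alpha> \<and> ran t \<subseteq> H_card \<kappa>} \<and>
    (\<forall>t\<in>T. \<forall>\<beta>. Ord \<beta> \<longrightarrow> t |` elts \<beta> \<in> T)"

definition stl_level :: "'k hfun set \<Rightarrow> 'k hset \<Rightarrow> 'k hfun set" where
  "stl_level T \<alpha> = {t \<in> T. dom t = elts \<alpha>}"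

definition streamlined_souslin :: "'k hset \<Rightarrow> 'k hfun set \<Rightarrow> bool" where
  "streamlined_souslin \<kappa> T \<longleftrightarrow> streamlined \<kappa> T \<and> souslin \<kappa> T map_less"

definition normal_tree :: "'k hfun set \<Rightarrow> bool" where
  "normal_tree T \<longleftrightarrow>
    (\<forall>\<beta>. Ord \<beta> \<and> stl_level T \<beta> \<noteq> {} \<longrightarrow> (\<forall>\<alpha>\<in>elts \<beta>. \<forall>s\<in>stl_level T \<alpha>. \<exists>t\<in>stl_level T \<beta>. s \<subseteq>\<^sub>m t))"

definition prolific_tree :: "'k hset \<Rightarrow> 'k hfun set \<Rightarrow> bool" where
  "prolific_tree \<kappa> T \<longleftrightarrow>
    (\<forall>\<alpha>\<in>elts \<kappa>. \<forall>t\<in>stl_level T \<alpha>. {t(\<alpha> \<mapsto> i) | i. i \<in> elts omega \<union> elts \<alpha>} \<subseteq> stl_level T (osucc \<alpha>))"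

definition splitting_tree :: "'k hset \<Rightarrow> 'k hfun set \<Rightarrow> bool" where
  "splitting_tree \<sigma> T \<longleftrightarrow>
    (\<forall>t\<in>T. |elts \<sigma>| \<le>o |{s \<in> T. map_less t s \<and> (\<nexists>u. u \<in> T \<and> map_less t u \<and> map_less u s)}| )"

definition chi_complete :: "'k hset \<Rightarrow> 'k hfun set \<Rightarrow> bool" where
  "chi_complete \<chi> T \<longleftrightarrow>
    (\<forall>\<xi>\<in>elts \<chi>. \<forall>f.
      (\<forall>i\<in>elts \<xi>. f i \<in> T) \<and> (\<forall>j\<in>elts \<xi>. \<forall>i\<in>elts j. map_less (f i) (f j)) \<longrightarrow>
      (\<exists>t\<in>T. Map.graph t = (\<Union>i\<in>elts \<xi>. Map.graph (f i))))"

definition coord :: "('k hset \<rightharpoonup> 'k hfun) \<Rightarrow> 'k hset \<Rightarrow> 'k hfun" where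
  "coord x i = (\<lambda>\<epsilon>. Option.bind (x \<epsilon>) (\<lambda>y. y i))"

definition derived_tree ::
    "'k hset \<Rightarrow> 'k hfun set \<Rightarrow> 'k hset \<Rightarrow> ('k hset \<Rightarrow> 'k hfun) \<Rightarrow> ('k hset \<rightharpoonup> 'k hfun) set" where
  "derived_tree \<kappa> T \<tau> s = {x. \<exists>\<alpha>. Ord \<alpha> \<and> dom x = elts \<alpha> \<and>
    (\<forall>y\<in>ran x. dom y = elts \<tau> \<and> ran y \<subseteq> H_card \<kappa>) \<and>
    (\<forall>i\<in>elts \<tau>. \<exists>t\<in>T. Map.graph t = Map.graph (coord x i) \<union> Map.graph (s i))}"

definition chi_free :: "'k hset \<Rightarrow> 'k hset \<Rightarrow> 'k hfun set \<Rightarrow> bool" where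
  "chi_free \<kappa> \<chi> T \<longleftrightarrow> souslin \<kappa> T map_less \<and>
    (\<forall>\<delta>\<in>elts \<kappa>. \<forall>\<tau>\<in>elts \<chi>. \<forall>s.
      \<tau> \<noteq> ozero \<and> inj_on s (elts \<tau>) \<and> s ` elts \<tau> \<subseteq> stl_level T \<delta> \<longrightarrow>
      souslin \<kappa> (derived_tree \<kappa> T \<tau> s) map_less)"

end

theory Submission
  imports Defs
begin

text \<open>
  All nodes take values below \<open>\<kappa>\<close>. Levels of cofinality below \<open>\<chi>\<close> contain all branches, which gives
  \<open>\<chi>\<close>-completeness; at the other limit levels only canonical branches are kept, one for each \<open>C \<in> \<C> \<alpha>\<close>
  and each node \<open>x\<close> on a level in \<open>dom C\<close>, built along \<open>dom C\<close> by a recursion that depends only on initial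
  segments of \<open>C\<close>, so that coherence carries it through limits. Guessing shows that \<open>\<kappa>\<close> codes
  all vectors of fewer than \<open>\<chi>\<close> nodes. At a successor point \<open>\<beta> \<in> B \<iota>\<close> of \<open>dom C\<close>, the branches starting
  at the vector with code \<open>\<iota>\<close> are pushed jointly above a vector whose code lies in \<open>C \<beta>\<close>, if possible. A
  dense subset of a derived tree is thereby met below a single level \<open>\<alpha>\<close>: any vector of level \<open>\<alpha>\<close> comes from
  canonical branches starting below \<open>\<alpha>\<close>, and their vector has a code below \<open>\<alpha>\<close>. Applied to the vectors
  which are above some element of an antichain or below none of them, this bounds the antichain.

  Of the elementary submodels only the following is used: if \<open>M \<inter> \<kappa> = \<beta>\<close> and \<open>M\<close> contains a club subset
  of \<open>\<kappa>\<close>, then \<open>\<beta>\<close> belongs to that club.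
\<close>


section \<open>Ordinals\<close>

text \<open>Two demands pull apart: \<chi>-completeness fills the levels of cofinality below \<chi>
  with all branches, while freeness needs levels whose vectors are under control. Control is
  possible only at cofinality at least \<chi>, where fewer than \<chi> branches start below a common
  level, and \<open>sqsub\<close> gives coherence exactly at those limits that do not admit every
  branch. The bound \<nu> = 2 makes all coordinates of a vector run along the same C; along
  different clubs their moves could not be synchronised. A move is possible only at a
  nonaccumulation point, the value at a limit point being forced as a union. Hence n = 1: the
  guessed \<beta> is the successor of some \<gamma>, and the positions at \<gamma> are what gets
  extended. A node may belong to many starting vectors that ask for different moves, so one \<beta>
  can serve only one vector; this is why the cells are indexed by codes and \<theta> = \<kappa> is
  needed. (<\<chi>)-closedness keeps the full levels, and the number of vectors on each level, below
  \<kappa>.\<close>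

lemma mem_wf: "wf {(x, y :: 'k hset). x \<in> elts y}"
  unfolding wf_def
proof (intro allI impI)
  fix P and x :: "'k hset"
  assume *: "\<forall>x. (\<forall>y. (y, x) \<in> {(x, y :: 'k hset). x \<in> elts y} \<longrightarrow> P y) \<longrightarrow> P x"
  show "P x" by (rule hset_induct) (use * in blast)
qed

lemma mem_not_refl: "x \<notin> elts (x :: 'k hset)"
  using wf_not_refl[OF mem_wf] by blast

lemma mem_not_sym: "x \<in> elts y \<Longrightarrow> (y :: 'k hset) \<notin> elts x"
  using wf_not_sym[OF mem_wf] by blast

text \<open>Separation: a part of \<open>elts z\<close> inherits the bound on its cardinality, so
  \<open>vset\<close> realises it. This replaces size computations for suprema and successors of
  ordinals.\<close>

lemma elts_vset_subset: "X \<subseteq> elts (z :: 'k hset) \<Longrightarrow> elts (vset X) = X"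
  by (rule elts_vset) (use card_of_mono1 card_elts ordLeq_transitive in blast)

lemma elts_ozero [simp]: "elts ozero = {}"
  unfolding ozero_def by (rule elts_vset_subset) auto

lemma elts_empty_iff: "elts x = {} \<longleftrightarrow> x = ozero"
  by (metis elts_inject elts_ozero)

lemma Ord_mem: "Ord \<alpha> \<Longrightarrow> \<beta> \<in> elts \<alpha> \<Longrightarrow> Ord \<beta>"
  unfolding Ord_def by blast

lemma Ord_mem_subset: "Ord \<alpha> \<Longrightarrow> \<beta> \<in> elts \<alpha> \<Longrightarrow> elts \<beta> \<subseteq> elts \<alpha>"
  unfolding Ord_def by blast

lemma Ord_mem_trans: "Ord \<alpha> \<Longrightarrow> \<beta> \<in> elts \<alpha> \<Longrightarrow> \<gamma> \<in> elts \<beta> \<Longrightarrow> \<gamma> \<in> elts \<alpha>"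
  unfolding Ord_def by blast

lemma OrdI:
  assumes "\<And>\<beta>. \<beta> \<in> elts \<alpha> \<Longrightarrow> Ord \<beta>" "\<And>\<beta>. \<beta> \<in> elts \<alpha> \<Longrightarrow> elts \<beta> \<subseteq> elts \<alpha>"
  shows "Ord \<alpha>"
  using assms unfolding Ord_def by blast

lemma Ord_linear:
  "Ord \<alpha> \<Longrightarrow> Ord \<beta> \<Longrightarrow> \<alpha> \<in> elts \<beta> \<or> \<alpha> = \<beta> \<or> \<beta> \<in> elts \<alpha>"
proof (induction \<alpha> arbitrary: \<beta> rule: hset_induct)
  case (1 \<alpha>)
  note IH\<alpha> = 1(1) and Ord\<alpha> = 1(2)
  from 1(3) show ?case
  proof (induction \<beta> rule: hset_induct)
    case (1 \<beta>)
    show ?case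
    proof (rule ccontr)
      assume neg: "\<not> ?case"
      have "elts \<alpha> = elts \<beta>"
      proof (intro equalityI subsetI)
        fix \<xi> assume \<xi>: "\<xi> \<in> elts \<alpha>"
        then have "\<xi> \<in> elts \<beta> \<or> \<xi> = \<beta> \<or> \<beta> \<in> elts \<xi>"
          using IH\<alpha> Ord_mem[OF Ord\<alpha>] 1(2) by blast
        then show "\<xi> \<in> elts \<beta>" using neg \<xi> Ord_mem_trans[OF Ord\<alpha>] by blast
      next
        fix \<xi> assume \<xi>: "\<xi> \<in> elts \<beta>"
        then have "\<alpha> \<in> elts \<xi> \<or> \<alpha> = \<xi> \<or> \<xi> \<in> elts \<alpha>"
          using 1 Ord_mem by blast
        then show "\<xi> \<in> elts \<alpha>" using neg \<xi> Ord_mem_trans[OF 1(2)] by blast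
      qed
      then show False using neg by (simp add: elts_inject)
    qed
  qed
qed

lemma Ord_subset_iff:
  assumes "Ord \<alpha>" "Ord \<beta>" shows "elts \<alpha> \<subseteq> elts \<beta> \<longleftrightarrow> \<alpha> \<in> elts \<beta> \<or> \<alpha> = \<beta>"
  using assms Ord_linear[OF assms] Ord_mem_subset mem_not_refl by blast

lemma Ord_not_mem_iff:
  assumes "Ord \<alpha>" "Ord \<beta>" shows "\<alpha> \<notin> elts \<beta> \<longleftrightarrow> elts \<beta> \<subseteq> elts \<alpha>"
  using Ord_linear[OF assms] Ord_subset_iff[OF assms(2,1)] mem_not_refl mem_not_sym by blast

lemma Ord_ozero: "Ord ozero"
  by (rule OrdI) auto

lemma Ord_least:
  assumes "P (\<alpha> :: 'k hset)" "Ord \<alpha>"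
  obtains \<beta> where "Ord \<beta>" "P \<beta>" "\<And>\<gamma>. \<gamma> \<in> elts \<beta> \<Longrightarrow> \<not> P \<gamma>"
proof -
  obtain \<beta> where \<beta>: "\<beta> \<in> {\<beta>. P \<beta> \<and> Ord \<beta>}"
    and min: "\<And>\<gamma>. (\<gamma>, \<beta>) \<in> {(x, y). x \<in> elts y} \<Longrightarrow> \<gamma> \<notin> {\<beta>. P \<beta> \<and> Ord \<beta>}"
    using wfE_min[OF mem_wf, of \<alpha> "{\<beta>. P \<beta> \<and> Ord \<beta>}"] assms by blast
  then show ?thesis using that[of \<beta>] Ord_mem by blast
qed

lemma set_of_Ords_least:
  assumes "D \<noteq> {}" "\<And>\<xi>. \<xi> \<in> D \<Longrightarrow> Ord \<xi>"
  shows "\<exists>\<beta>\<in>D. \<forall>\<gamma>\<in>D. elts \<beta> \<subseteq> elts \<gamma>"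
proof -
  obtain \<alpha> where "\<alpha> \<in> D" using assms by blast
  then obtain \<beta> where "Ord \<beta>" "\<beta> \<in> D" "\<And>\<gamma>. \<gamma> \<in> elts \<beta> \<Longrightarrow> \<not> \<gamma> \<in> D"
    using Ord_least[of "\<lambda>x. x \<in> D" \<alpha>] assms by metis
  then show ?thesis using assms Ord_not_mem_iff by blast
qed

lemma elts_osup:
  assumes "Ord \<alpha>" "X \<subseteq> elts \<alpha>" shows "elts (osup X) = (\<Union> (elts ` X))"
  unfolding osup_def by (rule elts_vset_subset[of _ \<alpha>]) (use assms Ord_mem_subset in blast)

lemma Ord_osup: assumes "Ord \<alpha>" "X \<subseteq> elts \<alpha>" shows "Ord (osup X)"
proof (rule OrdI)
  fix \<beta> assume "\<beta> \<in> elts (osup X)"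
  then obtain x where x: "x \<in> X" "\<beta> \<in> elts x" using elts_osup[OF assms] by blast
  then have "Ord x" using assms Ord_mem by blast
  then show "Ord \<beta>" using x Ord_mem by blast
  show "elts \<beta> \<subseteq> elts (osup X)"
    unfolding elts_osup[OF assms] using x Ord_mem_subset[OF \<open>Ord x\<close>] by blast
qed

text \<open>Domination is strict, so a largest element of \<alpha> could not be dominated. Among
  nonzero \<alpha> the equation therefore singles out limits in which X is unbounded.\<close>

lemma osup_eq_iff:
  assumes "Ord \<alpha>" "X \<subseteq> elts \<alpha>"
  shows "osup X = \<alpha> \<longleftrightarrow> (\<forall>\<xi>\<in>elts \<alpha>. \<exists>x\<in>X. \<xi> \<in> elts x)"
  unfolding elts_inject[symmetric] elts_osup[OF assms] using assms Ord_mem_subset by blast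

section \<open>Mostowski collapse of a set of ordinals and order types\<close>

function collapse :: "'k hset set \<Rightarrow> 'k hset \<Rightarrow> 'k hset" where
  "collapse D \<xi> = vset (collapse D ` (D \<inter> elts \<xi>))"
  by auto
termination
  by (relation "inv_image {(x, y). x \<in> elts y} snd") (auto intro: mem_wf wf_inv_image)

declare collapse.simps [simp del]

lemma elts_collapse: "elts (collapse D \<xi>) = collapse D ` (D \<inter> elts \<xi>)"
  unfolding collapse.simps[of D \<xi>]
proof (rule elts_vset)
  have "|collapse D ` (D \<inter> elts \<xi>)| \<le>o |D \<inter> elts \<xi>|" by (rule card_of_image)
  also have "|D \<inter> elts \<xi>| \<le>o |elts \<xi>|" by (rule card_of_mono1) auto
  also note card_elts
  finally show "|collapse D ` (D \<inter> elts \<xi>)| \<le>o |UNIV :: 'a set|" .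
qed

lemma Ord_collapse: "Ord \<xi> \<Longrightarrow> Ord (collapse D \<xi>)"
proof (induction \<xi> rule: hset_induct)
  case (1 \<xi>)
  show ?case
  proof (rule OrdI)
    fix \<beta> assume "\<beta> \<in> elts (collapse D \<xi>)"
    then obtain \<eta> where \<eta>: "\<eta> \<in> D" "\<eta> \<in> elts \<xi>" "\<beta> = collapse D \<eta>"
      by (auto simp: elts_collapse)
    then show "Ord \<beta>" using 1 Ord_mem by blast
    show "elts \<beta> \<subseteq> elts (collapse D \<xi>)"
      using \<eta> Ord_mem_subset[OF 1(2), of \<eta>] by (auto simp: elts_collapse)
  qed
qed

text \<open>Collapsing closes gaps and never raises an ordinal. Hence a subset of \<alpha> has order
  type at most \<alpha>, which later makes order types of subsets of \<kappa> comparable with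
  \<kappa>.\<close>

lemma collapse_le: "Ord \<xi> \<Longrightarrow> elts (collapse D \<xi>) \<subseteq> elts \<xi>"
proof (induction \<xi> rule: hset_induct)
  case (1 \<xi>)
  show ?case
  proof
    fix \<beta> assume "\<beta> \<in> elts (collapse D \<xi>)"
    then obtain \<eta> where \<eta>: "\<eta> \<in> D" "\<eta> \<in> elts \<xi>" "\<beta> = collapse D \<eta>"
      by (auto simp: elts_collapse)
    then have "elts \<beta> \<subseteq> elts \<eta>" "Ord \<eta>" "Ord \<beta>"
      using 1 Ord_mem Ord_collapse by blast+
    then show "\<beta> \<in> elts \<xi>" using \<eta> 1(2) Ord_subset_iff Ord_mem_trans by metis
  qed
qed

lemma collapse_iff:
  assumes "Ord \<xi>" "Ord \<eta>" "\<xi> \<in> D" "\<eta> \<in> D"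
  shows "collapse D \<xi> \<in> elts (collapse D \<eta>) \<longleftrightarrow> \<xi> \<in> elts \<eta>"
proof
  show "\<xi> \<in> elts \<eta> \<Longrightarrow> collapse D \<xi> \<in> elts (collapse D \<eta>)"
    using assms by (auto simp: elts_collapse)
  have "\<eta> \<in> elts \<xi> \<Longrightarrow> collapse D \<eta> \<in> elts (collapse D \<xi>)"
    using assms by (auto simp: elts_collapse)
  then show "collapse D \<xi> \<in> elts (collapse D \<eta>) \<Longrightarrow> \<xi> \<in> elts \<eta>"
    using Ord_linear[OF assms(1,2)] mem_not_refl mem_not_sym by metis
qed

lemma order_type_exists:
  assumes "Ord \<alpha>" "D \<subseteq> elts \<alpha>"
  obtains \<tau> f where "Ord \<tau>" "elts \<tau> \<subseteq> elts \<alpha>" "bij_betw f (elts \<tau>) D"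
    "\<forall>\<xi>\<in>elts \<tau>. \<forall>\<eta>\<in>elts \<tau>. \<xi> \<in> elts \<eta> \<longleftrightarrow> f \<xi> \<in> elts (f \<eta>)"
proof -
  define \<tau> where "\<tau> = collapse D \<alpha>"
  have \<tau>: "elts \<tau> = collapse D ` D"
    using assms by (simp add: \<tau>_def elts_collapse Int_absorb2)
  have OD: "Ord \<xi>" if "\<xi> \<in> D" for \<xi> using assms that Ord_mem by blast
  have inj: "inj_on (collapse D) D"
    using collapse_iff Ord_linear OD mem_not_refl by (metis inj_onI)
  have bij: "bij_betw (collapse D) D (elts \<tau>)" using inj \<tau> by (simp add: bij_betw_def)
  show ?thesis
  proof (rule that[of \<tau> "inv_into D (collapse D)"])
    show "Ord \<tau>" "elts \<tau> \<subseteq> elts \<alpha>"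
      unfolding \<tau>_def using assms(1) by (rule Ord_collapse, rule collapse_le)
    show "bij_betw (inv_into D (collapse D)) (elts \<tau>) D"
      by (rule bij_betw_inv_into[OF bij])
    show "\<forall>\<xi>\<in>elts \<tau>. \<forall>\<eta>\<in>elts \<tau>. \<xi> \<in> elts \<eta> \<longleftrightarrow>
        inv_into D (collapse D) \<xi> \<in> elts (inv_into D (collapse D) \<eta>)"
      unfolding \<tau> using inj collapse_iff OD by (auto simp: inv_into_f_f)
  qed
qed

text \<open>By induction h fixes every \<xi>, because \<open>h \<xi>\<close> consists of exactly the
  values that h takes below \<xi>.\<close>

lemma Ord_iso_eq:
  assumes "Ord \<alpha>" "Ord \<beta>" "bij_betw h (elts \<alpha>) (elts \<beta>)"
    and iso: "\<forall>\<xi>\<in>elts \<alpha>. \<forall>\<eta>\<in>elts \<alpha>. \<xi> \<in> elts \<eta> \<longleftrightarrow> h \<xi> \<in> elts (h \<eta>)"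
  shows "\<alpha> = \<beta>"
proof -
  have "\<xi> \<in> elts \<alpha> \<Longrightarrow> h \<xi> = \<xi>" for \<xi>
  proof (induction \<xi> rule: hset_induct)
    case (1 \<xi>)
    have h\<xi>: "h \<xi> \<in> elts \<beta>" using assms(3) 1(2) by (auto simp: bij_betw_def)
    have "elts (h \<xi>) = h ` elts \<xi>"
    proof (intro equalityI subsetI)
      fix \<zeta> assume \<zeta>: "\<zeta> \<in> elts (h \<xi>)"
      then have "\<zeta> \<in> elts \<beta>" using h\<xi> assms(2) Ord_mem_trans by blast
      then obtain \<eta> where "\<eta> \<in> elts \<alpha>" "\<zeta> = h \<eta>" using assms(3) by (auto simp: bij_betw_def)
      then show "\<zeta> \<in> h ` elts \<xi>" using \<zeta> iso 1(2) by blast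
    next
      fix \<zeta> assume "\<zeta> \<in> h ` elts \<xi>"
      then show "\<zeta> \<in> elts (h \<xi>)" using iso 1(2) Ord_mem_trans[OF assms(1)] by blast
    qed
    also have "\<dots> = elts \<xi>" using 1 Ord_mem_trans[OF assms(1)] by (simp add: image_cong)
    finally show ?case by (simp add: elts_inject)
  qed
  then have "elts \<beta> = elts \<alpha>" using assms(3) by (auto simp: bij_betw_def)
  then show ?thesis by (simp add: elts_inject)
qed

text \<open>The relation \<open>lt\<close> is arbitrary, so one uniqueness argument evaluates order
  types both of sets of ordinals and of predecessor sets in trees.\<close>

lemma otp_eqI:
  fixes \<alpha> :: "'k hset"
  assumes "Ord \<alpha>" "bij_betw f (elts \<alpha>) A"
    and iso: "\<forall>\<xi>\<in>elts \<alpha>. \<forall>\<eta>\<in>elts \<alpha>. \<xi> \<in> elts \<eta> \<longleftrightarrow> lt (f \<xi>) (f \<eta>)"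
  shows "otp lt A = \<alpha>"
  unfolding otp_def
proof (rule the_equality)
  show "Ord \<alpha> \<and> (\<exists>f. bij_betw f (elts \<alpha>) A \<and>
      (\<forall>\<xi>\<in>elts \<alpha>. \<forall>\<eta>\<in>elts \<alpha>. \<xi> \<in> elts \<eta> \<longleftrightarrow> lt (f \<xi>) (f \<eta>)))"
    using assms by blast
next
  fix \<beta> :: "'k hset"
  assume "Ord \<beta> \<and> (\<exists>f. bij_betw f (elts \<beta>) A \<and>
      (\<forall>\<xi>\<in>elts \<beta>. \<forall>\<eta>\<in>elts \<beta>. \<xi> \<in> elts \<eta> \<longleftrightarrow> lt (f \<xi>) (f \<eta>)))"
  then obtain g where \<beta>: "Ord \<beta>" and g: "bij_betw g (elts \<beta>) A"
    "\<forall>\<xi>\<in>elts \<beta>. \<forall>\<eta>\<in>elts \<beta>. \<xi> \<in> elts \<eta> \<longleftrightarrow> lt (g \<xi>) (g \<eta>)" by blast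
  define h where "h = inv_into (elts \<alpha>) f \<circ> g"
  have finv: "f (inv_into (elts \<alpha>) f a) = a" "inv_into (elts \<alpha>) f a \<in> elts \<alpha>" if "a \<in> A" for a
    using that assms(2) by (auto simp: bij_betw_def f_inv_into_f inv_into_into)
  show "\<beta> = \<alpha>"
  proof (rule Ord_iso_eq[OF \<beta> assms(1)])
    show "bij_betw h (elts \<beta>) (elts \<alpha>)"
      unfolding h_def using g(1) bij_betw_inv_into[OF assms(2)] by (rule bij_betw_trans)
    show "\<forall>\<xi>\<in>elts \<beta>. \<forall>\<eta>\<in>elts \<beta>. \<xi> \<in> elts \<eta> \<longleftrightarrow> h \<xi> \<in> elts (h \<eta>)"
    proof (intro ballI)
      fix \<xi> \<eta> assume \<xi>\<eta>: "\<xi> \<in> elts \<beta>" "\<eta> \<in> elts \<beta>"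
      then have A: "g \<xi> \<in> A" "g \<eta> \<in> A" using g(1) by (auto simp: bij_betw_def)
      have "\<xi> \<in> elts \<eta> \<longleftrightarrow> lt (f (h \<xi>)) (f (h \<eta>))"
        using g(2) \<xi>\<eta> A finv(1) by (simp add: h_def)
      also have "\<dots> \<longleftrightarrow> h \<xi> \<in> elts (h \<eta>)" using iso A finv(2) by (simp add: h_def)
      finally show "\<xi> \<in> elts \<eta> \<longleftrightarrow> h \<xi> \<in> elts (h \<eta>)" .
    qed
  qed
qed

section \<open>Cofinality\<close>

lemma cofinal_length_self: "Ord \<alpha> \<Longrightarrow> cofinal_length \<alpha> \<alpha>"
  unfolding cofinal_length_def by (rule exI[of _ id]) auto

lemma cofin_props:
  assumes "Ord \<alpha>"
  shows "Ord (cofin \<alpha>)" "cofinal_length (cofin \<alpha>) \<alpha>"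
    "\<And>\<gamma>. \<gamma> \<in> elts (cofin \<alpha>) \<Longrightarrow> \<not> cofinal_length \<gamma> \<alpha>"
proof -
  obtain \<beta> where \<beta>: "Ord \<beta>" "cofinal_length \<beta> \<alpha>" "\<And>\<gamma>. \<gamma> \<in> elts \<beta> \<Longrightarrow> \<not> cofinal_length \<gamma> \<alpha>"
    using Ord_least[of "\<lambda>\<beta>. cofinal_length \<beta> \<alpha>"] cofinal_length_self[OF assms] assms by metis
  have "cofin \<alpha> = \<beta>"
    unfolding cofin_def using \<beta> Ord_linear by (intro the_equality) blast+
  then show "Ord (cofin \<alpha>)" "cofinal_length (cofin \<alpha>) \<alpha>"
    "\<And>\<gamma>. \<gamma> \<in> elts (cofin \<alpha>) \<Longrightarrow> \<not> cofinal_length \<gamma> \<alpha>"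
    using \<beta> by auto
qed

lemma not_cofinal_length_bounded:
  assumes "Ord \<alpha>" "\<not> cofinal_length \<tau> \<alpha>" "f ` elts \<tau> \<subseteq> elts \<alpha>"
  obtains \<xi> where "\<xi> \<in> elts \<alpha>" "f ` elts \<tau> \<subseteq> elts \<xi>"
proof -
  obtain \<xi> where \<xi>: "\<xi> \<in> elts \<alpha>" "\<forall>\<eta>\<in>elts \<tau>. \<not> (\<xi> = f \<eta> \<or> \<xi> \<in> elts (f \<eta>))"
    using assms(2,3) unfolding cofinal_length_def by blast
  have "f \<eta> \<in> elts \<xi>" if "\<eta> \<in> elts \<tau>" for \<eta>
    using Ord_linear[of \<xi> "f \<eta>"] that \<xi> assms(1,3) Ord_mem by blast
  then show ?thesis using \<xi> that by blast
qed

section \<open>Regular uncountable cardinals\<close>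

lemma tcl_subset:
  assumes "Ord \<alpha>" "elts x \<subseteq> elts \<alpha>" shows "tcl x \<subseteq> elts \<alpha>"
proof
  fix y assume "y \<in> tcl x"
  then have "(y, x) \<in> {(u, v). u \<in> elts v}\<^sup>+" by (simp add: tcl_def)
  then show "y \<in> elts \<alpha>"
    by (induction rule: converse_trancl_induct) (use assms Ord_mem_trans in blast)+
qed

locale regular_cardinal =
  fixes \<kappa> :: "'k hset"
  assumes regular: "regular_card \<kappa>" and uncountable: "uncountable (elts \<kappa>)"
begin

abbreviation small :: "'a set \<Rightarrow> bool" where
  "small X \<equiv> |X| <o |elts \<kappa>|"

lemma Ord_kappa: "Ord \<kappa>" and small_elts: "\<alpha> \<in> elts \<kappa> \<Longrightarrow> small (elts \<alpha>)"
  and infinite_kappa: "infinite (elts \<kappa>)" and cofin_kappa: "cofin \<kappa> = \<kappa>"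
  using regular unfolding regular_card_def Cardinal_ord_def by auto

lemmas Ord_below = Ord_mem[OF Ord_kappa]
  and below_trans = Ord_mem_trans[OF Ord_kappa]
  and below_subset = Ord_mem_subset[OF Ord_kappa]

lemma below_linear: "\<alpha> \<in> elts \<kappa> \<Longrightarrow> \<beta> \<in> elts \<kappa> \<Longrightarrow> \<alpha> \<in> elts \<beta> \<or> \<alpha> = \<beta> \<or> \<beta> \<in> elts \<alpha>"
  using Ord_linear Ord_below by blast

lemma below_subset_iff:
  "\<alpha> \<in> elts \<kappa> \<Longrightarrow> \<beta> \<in> elts \<kappa> \<Longrightarrow> elts \<alpha> \<subseteq> elts \<beta> \<longleftrightarrow> \<alpha> \<in> elts \<beta> \<or> \<alpha> = \<beta>"
  using Ord_subset_iff Ord_below by blast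

lemma below_not_mem_iff:
  "\<alpha> \<in> elts \<kappa> \<Longrightarrow> \<beta> \<in> elts \<kappa> \<Longrightarrow> \<alpha> \<notin> elts \<beta> \<longleftrightarrow> elts \<beta> \<subseteq> elts \<alpha>"
  using Ord_not_mem_iff Ord_below by blast

lemma mem_of_subset_of_mem:
  "Ord \<alpha> \<Longrightarrow> elts \<alpha> \<subseteq> elts \<beta> \<Longrightarrow> \<beta> \<in> elts \<kappa> \<Longrightarrow> \<alpha> \<in> elts \<kappa>"
  using Ord_subset_iff[of \<alpha> \<beta>] Ord_below below_trans by blast

section \<open>Sets of cardinality below \<kappa>\<close>

lemma small_subset: "small Y \<Longrightarrow> X \<subseteq> Y \<Longrightarrow> small X"
  using card_of_mono1 ordLeq_ordLess_trans by blast

lemma small_image: "small X \<Longrightarrow> small (f ` X)"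
  using card_of_image ordLeq_ordLess_trans by blast

lemma small_inj: "small Y \<Longrightarrow> inj_on f X \<Longrightarrow> f ` X \<subseteq> Y \<Longrightarrow> small X"
  using card_of_ordLeqI[of f X Y] ordLeq_ordLess_trans by blast

text \<open>Uncountability of \<kappa> enters here: it puts \<omega> and limits of
  \<omega>-sequences below \<kappa>.\<close>

lemma small_countable:
  assumes "countable X" shows "small X"
proof (rule ccontr)
  assume "\<not> small X"
  then have "|elts \<kappa>| \<le>o |X|"
    using not_ordLess_iff_ordLeq[OF card_of_Well_order card_of_Well_order] by blast
  then obtain f where "inj_on f (elts \<kappa>)" "f ` elts \<kappa> \<subseteq> X"
    using card_of_ordLeq[of "elts \<kappa>" X] by blast
  then show False using assms uncountable countable_subset countable_image_inj_on by metis
qed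

lemma small_Times: "small X \<Longrightarrow> small Y \<Longrightarrow> small (X \<times> Y)"
proof -
  assume X: "small X" and Y: "small Y"
  then have P: "small (X <+> Y)" using card_of_Plus_ordLess_infinite[OF infinite_kappa] by blast
  show ?thesis
  proof (cases "finite (X <+> Y)")
    case True
    then have "finite X" "finite Y" by (auto simp: finite_Plus_iff)
    then show ?thesis by (intro small_countable countable_finite) auto
  next
    case False
    then have "|X \<times> Y| \<le>o |X <+> Y|"
      using card_of_Sigma_ordLeq_infinite[OF False card_of_Plus1, of "\<lambda>_. Y"] card_of_Plus2 by blast
    then show ?thesis using P ordLeq_ordLess_trans by blast
  qed
qed

lemma small_Un: "small X \<Longrightarrow> small Y \<Longrightarrow> small (X \<union> Y)"
  using card_of_Un_ordLess_infinite[OF infinite_kappa] by blast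

text \<open>Regularity in its working form. The order type of X is at most \<kappa>, has the size of
  X and so differs from \<kappa>; a length below \<open>cofin \<kappa>\<close> is not
  cofinal.\<close>

lemma small_bounded:
  assumes "small X" "X \<subseteq> elts \<kappa>"
  obtains \<theta> where "\<theta> \<in> elts \<kappa>" "X \<subseteq> elts \<theta>"
proof -
  obtain \<tau> f where \<tau>: "Ord \<tau>" "elts \<tau> \<subseteq> elts \<kappa>" "bij_betw f (elts \<tau>) X"
    using order_type_exists[OF Ord_kappa assms(2)] by metis
  have "|elts \<tau>| =o |X|" using \<tau>(3) card_of_ordIsoI by blast
  then have "\<tau> \<noteq> \<kappa>" using assms(1) not_ordLess_ordIso ordIso_symmetric by blast
  then have "\<tau> \<in> elts \<kappa>" using Ord_subset_iff[OF \<tau>(1) Ord_kappa] \<tau>(2) by blast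
  then have "\<not> cofinal_length \<tau> \<kappa>" using cofin_props(3)[OF Ord_kappa] cofin_kappa by simp
  moreover have "f ` elts \<tau> = X" using \<tau>(3) by (simp add: bij_betw_def)
  ultimately show ?thesis using not_cofinal_length_bounded[OF Ord_kappa, of \<tau> f] assms(2) that by metis
qed

lemma small_embed:
  assumes "small X"
  obtains \<theta> f where "\<theta> \<in> elts \<kappa>" "inj_on f X" "f ` X \<subseteq> elts \<theta>"
proof -
  have "|X| \<le>o |elts \<kappa>|" using assms ordLess_imp_ordLeq by blast
  then obtain f where f: "inj_on f X" "f ` X \<subseteq> elts \<kappa>" using card_of_ordLeq[of X "elts \<kappa>"] by blast
  then show ?thesis using small_bounded[OF small_image[OF assms]] that by metis
qed

lemma small_UN:
  assumes "small I" "\<And>i. i \<in> I \<Longrightarrow> small (X i)"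
  shows "small (\<Union>i\<in>I. X i)"
proof -
  have "\<exists>\<theta>. \<theta> \<in> elts \<kappa> \<and> |X i| \<le>o |elts \<theta>|" if i: "i \<in> I" for i
  proof -
    obtain \<theta> f where "\<theta> \<in> elts \<kappa>" "inj_on f (X i)" "f ` X i \<subseteq> elts \<theta>"
      using small_embed[OF assms(2)[OF i]] by blast
    then show ?thesis using card_of_ordLeqI[of f "X i" "elts \<theta>"] by blast
  qed
  then obtain \<theta> where \<theta>: "\<And>i. i \<in> I \<Longrightarrow> \<theta> i \<in> elts \<kappa> \<and> |X i| \<le>o |elts (\<theta> i)|" by metis
  \<comment> \<open>Regularity bounds all the sizes by one \<rho>, so the disjoint union embeds in
    \<open>I \<times> elts \<rho>\<close>.\<close>
  obtain \<rho> where \<rho>: "\<rho> \<in> elts \<kappa>" "\<theta> ` I \<subseteq> elts \<rho>"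
    using small_bounded[OF small_image[OF assms(1)], of \<theta>] \<theta> by blast
  have "|X i| \<le>o |elts \<rho>|" if "i \<in> I" for i
  proof -
    have "elts (\<theta> i) \<subseteq> elts \<rho>" using \<rho> that Ord_mem_subset[OF Ord_below[OF \<rho>(1)]] by blast
    then have "|elts (\<theta> i)| \<le>o |elts \<rho>|" by (rule card_of_mono1)
    then show ?thesis using \<theta>[OF that] ordLeq_transitive by blast
  qed
  then have "|SIGMA i : I. X i| \<le>o |I \<times> elts \<rho>|" by (intro card_of_Sigma_mono1 ballI)
  then have "|\<Union>i\<in>I. X i| \<le>o |I \<times> elts \<rho>|" by (rule ordLeq_transitive[OF card_of_UNION_Sigma])
  then show ?thesis
    by (rule ordLeq_ordLess_trans[OF _ small_Times[OF assms(1) small_elts[OF \<rho>(1)]]])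
qed

lemma zero_below: "ozero \<in> elts \<kappa>"
  using Ord_linear[OF Ord_ozero Ord_kappa] infinite_kappa by (auto simp: elts_empty_iff)

lemma elts_osucc: "\<beta> \<in> elts \<kappa> \<Longrightarrow> elts (osucc \<beta>) = insert \<beta> (elts \<beta>)"
  unfolding osucc_def by (rule elts_vset_subset[of _ \<kappa>]) (use below_subset in blast)

lemma osucc_below:
  assumes "\<beta> \<in> elts \<kappa>" shows "osucc \<beta> \<in> elts \<kappa>"
proof -
  have "small (insert \<beta> (elts \<beta>))"
    using small_Un[OF small_countable[of "{\<beta>}"] small_elts[OF assms]] by simp
  then obtain \<theta> where \<theta>: "\<theta> \<in> elts \<kappa>" "insert \<beta> (elts \<beta>) \<subseteq> elts \<theta>"
    using small_bounded[of "insert \<beta> (elts \<beta>)"] assms below_subset by blast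
  moreover have "Ord (osucc \<beta>)"
  proof (rule OrdI)
    fix \<gamma> assume "\<gamma> \<in> elts (osucc \<beta>)"
    then have "\<gamma> = \<beta> \<or> \<gamma> \<in> elts \<beta>" using elts_osucc[OF assms] by blast
    then show "Ord \<gamma>" "elts \<gamma> \<subseteq> elts (osucc \<beta>)"
      unfolding elts_osucc[OF assms]
      using Ord_below[OF assms] Ord_mem Ord_mem_subset[OF Ord_below[OF assms], of \<gamma>] by auto
  qed
  ultimately show ?thesis using mem_of_subset_of_mem[of "osucc \<beta>" \<theta>] assms by (simp add: elts_osucc)
qed

lemma common_bound:
  assumes "\<alpha> \<in> elts \<kappa>" "\<beta> \<in> elts \<kappa>"
  obtains \<theta> where "\<theta> \<in> elts \<kappa>" "\<alpha> \<in> elts \<theta>" "\<beta> \<in> elts \<theta>"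
  using small_bounded[OF small_countable[of "{\<alpha>, \<beta>}"]] assms by auto

lemma elts_omega: "elts omega = range (\<lambda>n. (osucc ^^ n) (ozero :: 'k hset))"
  and omega_subset: "elts omega \<subseteq> elts \<kappa>"
proof -
  have n: "(osucc ^^ n) ozero \<in> elts \<kappa>" for n
    by (induction n) (auto intro: zero_below osucc_below)
  show e: "elts omega = range (\<lambda>n. (osucc ^^ n) (ozero :: 'k hset))"
    unfolding omega_def by (rule elts_vset_subset[of _ \<kappa>]) (use n in blast)
  show "elts omega \<subseteq> elts \<kappa>" using e n by auto
qed

lemma zero_in_omega: "(ozero :: 'k hset) \<in> elts omega"
  unfolding elts_omega by (rule range_eqI[of _ _ 0]) simp

lemma one_in_omega: "(osucc ozero :: 'k hset) \<in> elts omega"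
  unfolding elts_omega by (rule range_eqI[of _ _ 1]) simp

lemma countable_omega: "countable (elts (omega :: 'k hset))"
  unfolding elts_omega by simp

lemma one_below: "osucc ozero \<in> elts \<kappa>" and elts_one: "elts (osucc ozero) = {ozero :: 'k hset}"
  using osucc_below[OF zero_below] elts_osucc[OF zero_below] by auto

lemma one_neq_zero: "osucc ozero \<noteq> (ozero :: 'k hset)"
  using elts_one by auto

section \<open>Club subsets of \<kappa> and limit ordinals\<close>

lemma club_in_kappa_iff:
  "club_in D \<kappa> \<longleftrightarrow> D \<subseteq> elts \<kappa> \<and> (\<forall>\<xi>\<in>elts \<kappa>. \<exists>d\<in>D. \<xi> \<in> elts d) \<and>
    (\<forall>\<beta>\<in>elts \<kappa>. \<beta> \<noteq> ozero \<and> (\<forall>\<xi>\<in>elts \<beta>. \<exists>d\<in>D \<inter> elts \<beta>. \<xi> \<in> elts d) \<longrightarrow> \<beta> \<in> D)"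
proof (cases "D \<subseteq> elts \<kappa>")
  case True
  have "osup (D \<inter> elts \<beta>) = \<beta> \<longleftrightarrow> (\<forall>\<xi>\<in>elts \<beta>. \<exists>d\<in>D \<inter> elts \<beta>. \<xi> \<in> elts d)"
    if "\<beta> \<in> elts \<kappa>" for \<beta>
    by (rule osup_eq_iff[OF Ord_below[OF that]]) blast
  then show ?thesis
    unfolding club_in_def osup_eq_iff[OF Ord_kappa True] using Ord_kappa True by blast
qed (simp add: club_in_def)

text \<open>Closedness holds because the condition speaks about each \<gamma> below \<beta>
  separately; unboundedness comes from going \<omega> times beyond the values of F. The clause on
  \<delta> keeps the points of the club above a given ordinal.\<close>

lemma club_closure_points:
  assumes F: "\<And>\<gamma>. \<gamma> \<in> elts \<kappa> \<Longrightarrow> F \<gamma> \<in> elts \<kappa>" and \<delta>: "\<delta> \<in> elts \<kappa>"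
  shows "club_in {\<beta> \<in> elts \<kappa>. \<delta> \<in> elts \<beta> \<and> (\<forall>\<gamma>\<in>elts \<beta>. F \<gamma> \<in> elts \<beta>)} \<kappa>" (is "club_in ?D \<kappa>")
  unfolding club_in_kappa_iff
proof (intro conjI ballI impI)
  fix \<xi> assume \<xi>: "\<xi> \<in> elts \<kappa>"
  \<comment> \<open>One step of the iteration: F maps the fewer than \<kappa> ordinals below \<eta>
    to a bounded set.\<close>
  have "\<exists>\<theta>. \<theta> \<in> elts \<kappa> \<and> \<eta> \<in> elts \<theta> \<and> F ` elts \<eta> \<subseteq> elts \<theta>" if \<eta>: "\<eta> \<in> elts \<kappa>" for \<eta>
  proof -
    have "F ` elts \<eta> \<subseteq> elts \<kappa>" using F \<eta> below_trans by blast
    then obtain \<theta> where "\<theta> \<in> elts \<kappa>" "F ` elts \<eta> \<subseteq> elts \<theta>"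
      using small_bounded[OF small_image[OF small_elts[OF \<eta>]]] by blast
    then obtain \<rho> where "\<rho> \<in> elts \<kappa>" "\<eta> \<in> elts \<rho>" "\<theta> \<in> elts \<rho>" "F ` elts \<eta> \<subseteq> elts \<theta>"
      using common_bound[OF \<eta>, of \<theta>] by blast
    then show ?thesis using Ord_mem_subset[OF Ord_below] by blast
  qed
  then obtain step where step: "\<And>\<eta>. \<eta> \<in> elts \<kappa> \<Longrightarrow>
      step \<eta> \<in> elts \<kappa> \<and> \<eta> \<in> elts (step \<eta>) \<and> F ` elts \<eta> \<subseteq> elts (step \<eta>)" by metis
  obtain \<theta>\<^sub>0 where \<theta>\<^sub>0: "\<theta>\<^sub>0 \<in> elts \<kappa>" "\<xi> \<in> elts \<theta>\<^sub>0" "\<delta> \<in> elts \<theta>\<^sub>0"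
    using common_bound[OF \<xi> \<delta>] by blast
  define s where "s n = (step ^^ n) \<theta>\<^sub>0" for n
  have s: "s n \<in> elts \<kappa>" for n by (induction n) (auto simp: s_def \<theta>\<^sub>0 step)
  have s_Suc: "s (Suc n) = step (s n)" for n by (simp add: s_def)
  define \<beta> where "\<beta> = osup (range s)"
  have \<beta>: "elts \<beta> = (\<Union>n. elts (s n))" and Ord\<beta>: "Ord \<beta>"
    using elts_osup[OF Ord_kappa, of "range s"] Ord_osup[OF Ord_kappa, of "range s"] s
    by (auto simp: \<beta>_def)
  obtain \<theta> where \<theta>: "\<theta> \<in> elts \<kappa>" "range s \<subseteq> elts \<theta>"
    using s by (metis small_bounded small_countable countableI_type countable_image image_subsetI)
  have "elts \<beta> \<subseteq> elts \<theta>" unfolding \<beta> using \<theta> Ord_mem_subset[OF Ord_below] by blast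
  then have "\<beta> \<in> elts \<kappa>" using mem_of_subset_of_mem Ord\<beta> \<theta> by blast
  moreover have "\<xi> \<in> elts \<beta>" "\<delta> \<in> elts \<beta>"
    using \<theta>\<^sub>0 \<beta> by (auto simp: s_def intro!: exI[of _ 0])
  moreover have "F \<gamma> \<in> elts \<beta>" if \<gamma>: "\<gamma> \<in> elts \<beta>" for \<gamma>
  proof -
    obtain n where "\<gamma> \<in> elts (s n)" using \<gamma> \<beta> by blast
    then have "F \<gamma> \<in> elts (s (Suc n))" unfolding s_Suc using step[OF s[of n]] by blast
    then show ?thesis using \<beta> by blast
  qed
  ultimately show "\<exists>d\<in>?D. \<xi> \<in> elts d" by blast
next
  fix \<beta> assume \<beta>: "\<beta> \<in> elts \<kappa>" "\<beta> \<noteq> ozero \<and> (\<forall>\<xi>\<in>elts \<beta>. \<exists>d\<in>?D \<inter> elts \<beta>. \<xi> \<in> elts d)"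
  then obtain \<xi> where "\<xi> \<in> elts \<beta>" by (metis elts_empty_iff ex_in_conv)
  then have "\<delta> \<in> elts \<beta>" using \<beta> Ord_mem_trans[OF Ord_below[OF \<beta>(1)]] by blast
  moreover have "F \<gamma> \<in> elts \<beta>" if "\<gamma> \<in> elts \<beta>" for \<gamma>
    using \<beta> that Ord_mem_trans[OF Ord_below[OF \<beta>(1)]] by blast
  ultimately show "\<beta> \<in> ?D" using \<beta> by blast
qed auto

lemma acc_kappa_iff:
  "\<alpha> \<in> acc_pts (elts \<kappa>) \<longleftrightarrow>
    \<alpha> \<in> elts \<kappa> \<and> \<alpha> \<noteq> ozero \<and> (\<forall>\<xi>\<in>elts \<alpha>. \<exists>\<eta>\<in>elts \<alpha>. \<xi> \<in> elts \<eta>)"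
proof (cases "\<alpha> \<in> elts \<kappa>")
  case True
  have "elts \<kappa> \<inter> elts \<alpha> = elts \<alpha>" using below_subset[OF True] by blast
  then show ?thesis
    unfolding acc_pts_def using osup_eq_iff[OF Ord_below[OF True] order_refl] True by auto
qed (simp add: acc_pts_def)

lemma below_cases:
  assumes "\<alpha> \<in> elts \<kappa>"
  obtains (zero) "\<alpha> = ozero" | (succ) \<beta> where "\<beta> \<in> elts \<kappa>" "\<alpha> = osucc \<beta>"
    | (limit) "\<alpha> \<in> acc_pts (elts \<kappa>)"
proof (cases "\<alpha> = ozero \<or> \<alpha> \<in> acc_pts (elts \<kappa>)")
  case False
  \<comment> \<open>Failure of the limit condition yields a member of \<alpha> that lies below no
    other one. It is the largest, and \<alpha> is its successor.\<close>
  then obtain \<beta> where \<beta>: "\<beta> \<in> elts \<alpha>" "\<And>\<eta>. \<eta> \<in> elts \<alpha> \<Longrightarrow> \<beta> \<notin> elts \<eta>"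
    using acc_kappa_iff assms by blast
  then have \<beta>\<kappa>: "\<beta> \<in> elts \<kappa>" using below_trans assms by blast
  have "elts \<alpha> = insert \<beta> (elts \<beta>)"
    using \<beta> below_linear[OF \<beta>\<kappa>] below_trans[OF assms] Ord_mem_subset[OF Ord_below[OF assms]] by blast
  then have "\<alpha> = osucc \<beta>" using elts_osucc[OF \<beta>\<kappa>] elts_inject by metis
  then show ?thesis using succ \<beta>\<kappa> by blast
qed (use zero limit in blast)

lemma mem_osucc_self: "\<beta> \<in> elts \<kappa> \<Longrightarrow> \<beta> \<in> elts (osucc \<beta>)"
  by (simp add: elts_osucc)

lemma osucc_not_acc: "\<beta> \<in> elts \<kappa> \<Longrightarrow> osucc \<beta> \<notin> acc_pts (elts \<kappa>)"
proof
  assume \<beta>: "\<beta> \<in> elts \<kappa>" "osucc \<beta> \<in> acc_pts (elts \<kappa>)"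
  then obtain \<eta> where "\<eta> \<in> elts (osucc \<beta>)" "\<beta> \<in> elts \<eta>"
    unfolding acc_kappa_iff using mem_osucc_self by blast
  then show False using elts_osucc[OF \<beta>(1)] by (auto simp: mem_not_refl dest: mem_not_sym)
qed

lemma osucc_neq_ozero: "\<beta> \<in> elts \<kappa> \<Longrightarrow> osucc \<beta> \<noteq> ozero"
  using mem_osucc_self by fastforce

lemma osucc_inj: "\<beta> \<in> elts \<kappa> \<Longrightarrow> \<gamma> \<in> elts \<kappa> \<Longrightarrow> osucc \<beta> = osucc \<gamma> \<Longrightarrow> \<beta> = \<gamma>"
  using elts_osucc mem_not_sym by (metis insertE insertI1)

section \<open>Hereditary size and elementary submodels\<close>

lemma kappa_subset_H: "elts \<kappa> \<subseteq> H_card \<kappa>"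
proof
  fix \<alpha> assume \<alpha>: "\<alpha> \<in> elts \<kappa>"
  have "tcl \<alpha> \<subseteq> elts \<alpha>" using tcl_subset Ord_below[OF \<alpha>] by blast
  then show "\<alpha> \<in> H_card \<kappa>" using small_subset[OF small_elts[OF \<alpha>]] by (simp add: hered_def)
qed

text \<open>Makes a club subset of \<kappa> admissible as the parameter \<open>p\<close> of the
  guessing clause.\<close>

lemma vset_in_H_plus: "D \<subseteq> elts \<kappa> \<Longrightarrow> vset D \<in> H_plus \<kappa>"
proof -
  assume D: "D \<subseteq> elts \<kappa>"
  have "tcl (vset D) \<subseteq> elts \<kappa>" by (rule tcl_subset[OF Ord_kappa]) (simp add: elts_vset_subset[OF D] D)
  then have "|tcl (vset D)| \<le>o |elts \<kappa>|" by (rule card_of_mono1)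
  then show ?thesis
    using cardSuc_greater[OF card_of_Card_order] ordLeq_ordLess_trans by (auto simp: hered_def)
qed

text \<open>Elementarity reflects the unboundedness of D: for \<xi> below \<beta>, some member of D
  above \<xi> is found inside M, hence below \<beta>. So \<beta> is a limit of D.\<close>

lemma elem_submodel_club:
  assumes M: "elem_submodel M N" "vset D \<in> M" "M \<inter> elts \<kappa> = elts \<beta>"
    and N: "elts \<kappa> \<subseteq> N" and D: "club_in D \<kappa>" and \<beta>: "\<beta> \<in> elts \<kappa>" "\<beta> \<noteq> ozero"
  shows "\<beta> \<in> D"
proof -
  have D': "D \<subseteq> elts \<kappa>" "\<forall>\<xi>\<in>elts \<kappa>. \<exists>d\<in>D. \<xi> \<in> elts d"
    using D unfolding club_in_kappa_iff by blast+
  have "\<exists>d\<in>D \<inter> elts \<beta>. \<xi> \<in> elts d" if "\<xi> \<in> elts \<beta>" for \<xi>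
  proof -
    \<comment> \<open>Variable 0 denotes \<xi> and every other variable the set D, which keeps the
      range inside M. The formula has 0 and 1 free and binds 2 to the member of D above
      \<xi>.\<close>
    define e :: "nat \<Rightarrow> 'k hset" where "e = (\<lambda>_. vset D)(0 := \<xi>)"
    let ?\<phi> = "FEx 2 (FConj (FMem 0 2) (FMem 2 1))"
    have \<xi>: "\<xi> \<in> M" "\<xi> \<in> elts \<kappa>" using that M(3) by auto
    then have "range e \<subseteq> M" using M(2) by (auto simp: e_def)
    moreover have "sat N e ?\<phi>"
      using \<xi> D' N by (simp add: e_def elts_vset_subset[OF D'(1)]) blast
    ultimately have "sat M e ?\<phi>" using M(1) unfolding elem_submodel_def by blast
    then show ?thesis using M(3) D'(1) by (auto simp: e_def elts_vset_subset[OF D'(1)])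
  qed
  then show ?thesis using D \<beta> unfolding club_in_kappa_iff by blast
qed

lemma kappa_subset_H_plus: "elts \<kappa> \<subseteq> H_plus \<kappa>"
proof -
  have "H_card \<kappa> \<subseteq> H_plus \<kappa>"
    using cardSuc_greater[OF card_of_Card_order] ordLess_transitive by (fastforce simp: hered_def)
  then show ?thesis using kappa_subset_H by blast
qed

section \<open>Successor points of a club\<close>

definition is_next :: "'k hset set \<Rightarrow> 'k hset \<Rightarrow> 'k hset \<Rightarrow> bool" where
  "is_next D \<gamma> \<beta> \<longleftrightarrow> \<gamma> \<in> D \<and> \<beta> \<in> D \<and> \<gamma> \<in> elts \<beta> \<and> (\<forall>\<zeta>\<in>D. \<gamma> \<in> elts \<zeta> \<longrightarrow> elts \<beta> \<subseteq> elts \<zeta>)"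

lemma one_in_ord_otp:
  assumes "D \<subseteq> elts \<kappa>" "\<xi> \<in> D" "\<eta> \<in> D" "\<xi> \<noteq> \<eta>"
  shows "osucc ozero \<in> elts (ord_otp D)"
proof -
  obtain \<tau> f where \<tau>: "Ord \<tau>" "bij_betw f (elts \<tau>) D" "elts \<tau> \<subseteq> elts \<kappa>"
    "\<forall>\<xi>\<in>elts \<tau>. \<forall>\<eta>\<in>elts \<tau>. \<xi> \<in> elts \<eta> \<longleftrightarrow> f \<xi> \<in> elts (f \<eta>)"
    by (rule order_type_exists[OF Ord_kappa assms(1)]) assumption
  then have o: "ord_otp D = \<tau>" unfolding ord_otp_def by (intro otp_eqI)
  show ?thesis
  proof (rule ccontr)
    assume "\<not> ?thesis"
    then have "elts \<tau> \<subseteq> {ozero}"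
      using Ord_not_mem_iff[OF Ord_below[OF one_below] \<tau>(1)] o elts_one by simp
    moreover have "\<xi> \<in> f ` elts \<tau>" "\<eta> \<in> f ` elts \<tau>" using \<tau>(2) assms by (auto simp: bij_betw_def)
    ultimately show False using assms(4) by blast
  qed
qed

text \<open>Links successor points to the indexed sets of the principle: once everything below
  \<gamma> is removed, \<gamma> has index 0 and its successor \<beta> has index 1, which
  \<open>succ_set\<close> reaches for n = 1.\<close>

lemma next_in_succ_set:
  assumes "D \<subseteq> elts \<kappa>" "is_next D \<gamma> \<beta>"
  shows "\<beta> \<in> succ_set (osucc ozero) (D - elts \<gamma>)"
proof -
  let ?D = "D - elts \<gamma>"
  have n: "\<gamma> \<in> D" "\<beta> \<in> D" "\<gamma> \<in> elts \<beta>" "\<And>\<zeta>. \<zeta> \<in> D \<Longrightarrow> \<gamma> \<in> elts \<zeta> \<Longrightarrow> elts \<beta> \<subseteq> elts \<zeta>"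
    using assms(2) unfolding is_next_def by blast+
  have D: "\<gamma> \<in> ?D" "\<beta> \<in> ?D" using n mem_not_sym[OF n(3)] by (auto simp: mem_not_refl)
  have ge: "\<zeta> = \<gamma> \<or> \<gamma> \<in> elts \<zeta>" if "\<zeta> \<in> ?D" for \<zeta>
    using below_linear[of \<zeta> \<gamma>] that n assms(1) by blast
  have single: "?D \<inter> elts \<beta> = {\<gamma>}"
    using D n ge mem_not_refl by blast
  have "ord_otp {\<gamma>} = osucc ozero"
    unfolding ord_otp_def
    by (rule otp_eqI[where f = "\<lambda>_. \<gamma>"])
      (use Ord_below[OF one_below] in \<open>auto simp: elts_one mem_not_refl bij_betw_def\<close>)
  then have 1: "ord_otp (?D \<inter> elts \<beta>) = osucc ozero" by (simp only: single)
  have "nth_elem ?D (osucc ozero) = \<beta>"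
    unfolding nth_elem_def
  proof (rule the_equality)
    show "\<beta> \<in> ?D \<and> ord_otp (?D \<inter> elts \<beta>) = osucc ozero" using D 1 by blast
  next
    \<comment> \<open>A smaller \<delta> can only be \<gamma>, of index 0; a larger one has both
      \<gamma> and \<beta> below it, so its index exceeds 1.\<close>
    fix \<delta> assume \<delta>: "\<delta> \<in> ?D \<and> ord_otp (?D \<inter> elts \<delta>) = osucc ozero"
    show "\<delta> = \<beta>"
    proof (rule ccontr)
      assume "\<delta> \<noteq> \<beta>"
      then consider "\<delta> \<in> elts \<beta>" | "\<beta> \<in> elts \<delta>"
        using below_linear[of \<delta> \<beta>] \<delta> n assms(1) by blast
      then show False
      proof cases
        case 1
        then have "\<delta> = \<gamma>" using single \<delta> by blast
        then have "?D \<inter> elts \<delta> = {}" by blast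
        moreover have "ord_otp {} = (ozero :: 'k hset)"
          unfolding ord_otp_def by (rule otp_eqI) (auto simp: Ord_ozero bij_betw_def)
        ultimately show False using \<delta> one_neq_zero by simp
      next
        case 2
        then have "\<gamma> \<in> elts \<delta>" using n \<delta> assms(1) Ord_mem_trans[OF Ord_below] by blast
        then have "osucc ozero \<in> elts (ord_otp (?D \<inter> elts \<delta>))"
          using one_in_ord_otp[of "?D \<inter> elts \<delta>" \<gamma> \<beta>] 2 D assms(1) n(3) mem_not_refl by blast
        then show False using \<delta> mem_not_refl by auto
      qed
    qed
  qed
  moreover have "osucc ozero \<in> elts (ord_otp ?D)"
    using one_in_ord_otp[of ?D \<gamma> \<beta>] D n(3) assms(1) mem_not_refl by blast
  ultimately show ?thesis
    unfolding succ_set_def using elts_one by auto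
qed

end

section \<open>Trees of partial maps\<close>

lemma map_le_eq_restrict: "y \<subseteq>\<^sub>m x \<Longrightarrow> dom y = S \<Longrightarrow> y = x |` S"
  by (rule ext) (auto simp: map_le_def restrict_map_def domIff)

lemma restrict_map_le: "x |` S \<subseteq>\<^sub>m x"
  by (auto simp: map_le_def)

lemma map_le_of_common: "x \<subseteq>\<^sub>m z \<Longrightarrow> y \<subseteq>\<^sub>m z \<Longrightarrow> dom x \<subseteq> dom y \<Longrightarrow> x \<subseteq>\<^sub>m y"
  unfolding map_le_def by (metis subsetD)

lemma map_le_dom_eq: "x \<subseteq>\<^sub>m y \<Longrightarrow> dom x = dom y \<Longrightarrow> x = y"
  unfolding map_le_def by (metis domIff ext)

lemma map_less_trans: "map_less x y \<Longrightarrow> map_less y z \<Longrightarrow> map_less x z"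
  unfolding map_less_def by (metis map_le_antisym map_le_trans)

lemma graph_inject: "Map.graph s = Map.graph t \<longleftrightarrow> s = t"
proof
  assume eq: "Map.graph s = Map.graph t"
  have "s i = Some y \<longleftrightarrow> t i = Some y" for i y
    using eq in_graphI in_graphD by metis
  then show "s = t" by (metis ext option.exhaust)
qed simp

context regular_cardinal
begin

text \<open>The shape shared by the tree and its derived trees. The value type is left open because
  nodes of a derived tree take functions as values, and one Souslin criterion is to serve
  both.\<close>

definition level_closed :: "('k hset \<rightharpoonup> 'b) set \<Rightarrow> bool" where
  "level_closed X \<longleftrightarrow> (\<forall>x\<in>X. \<exists>\<alpha>\<in>elts \<kappa>. dom x = elts \<alpha>) \<and> (\<forall>x\<in>X. \<forall>\<beta>\<in>elts \<kappa>. x |` elts \<beta> \<in> X)"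

lemma dom_restrict_below:
  "dom x = elts \<alpha> \<Longrightarrow> \<alpha> \<in> elts \<kappa> \<Longrightarrow> \<beta> \<in> elts \<alpha> \<Longrightarrow> dom (x |` elts \<beta>) = elts \<beta>"
  using Ord_mem_subset[OF Ord_below] by auto

lemma map_less_restrict_iff:
  assumes "dom x = elts \<alpha>" "\<alpha> \<in> elts \<kappa>" "\<xi> \<in> elts \<alpha>" "\<eta> \<in> elts \<alpha>"
  shows "map_less (x |` elts \<xi>) (x |` elts \<eta>) \<longleftrightarrow> \<xi> \<in> elts \<eta>"
proof
  note d = dom_restrict_below[OF assms(1,2)]
  have \<kappa>: "\<xi> \<in> elts \<kappa>" "\<eta> \<in> elts \<kappa>" using assms below_trans by blast+
  {
    assume "map_less (x |` elts \<xi>) (x |` elts \<eta>)"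
    then have "elts \<xi> \<subseteq> elts \<eta>" "\<xi> \<noteq> \<eta>"
      using d assms map_le_implies_dom_le unfolding map_less_def by metis+
    then show "\<xi> \<in> elts \<eta>" using below_subset_iff \<kappa> by blast
  }
  assume \<xi>: "\<xi> \<in> elts \<eta>"
  then have "x |` elts \<xi> \<subseteq>\<^sub>m x |` elts \<eta>"
    using d assms Ord_mem_subset[OF Ord_below[OF \<kappa>(2)] \<xi>]
    by (intro map_le_of_common[OF restrict_map_le restrict_map_le]) auto
  moreover have "x |` elts \<xi> \<noteq> x |` elts \<eta>"
    using d[OF assms(3)] d[OF assms(4)] \<xi> mem_not_refl by metis
  ultimately show "map_less (x |` elts \<xi>) (x |` elts \<eta>)" by (simp add: map_less_def)
qed

lemma preds_map_less:
  assumes "level_closed X" "x \<in> X" "dom x = elts \<alpha>" "\<alpha> \<in> elts \<kappa>"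
  shows "preds X map_less x = (\<lambda>\<beta>. x |` elts \<beta>) ` elts \<alpha>"
proof (intro equalityI subsetI)
  fix y assume "y \<in> preds X map_less x"
  then have y: "y \<in> X" "y \<subseteq>\<^sub>m x" "y \<noteq> x" unfolding preds_def map_less_def by auto
  then obtain \<beta> where \<beta>: "\<beta> \<in> elts \<kappa>" "dom y = elts \<beta>"
    using assms(1) unfolding level_closed_def by blast
  then have "elts \<beta> \<subseteq> elts \<alpha>" "\<beta> \<noteq> \<alpha>"
    using y assms(3) map_le_implies_dom_le[of y x] map_le_dom_eq[of y x] by auto
  then have "\<beta> \<in> elts \<alpha>" using below_subset_iff \<beta> assms(4) by blast
  then show "y \<in> (\<lambda>\<beta>. x |` elts \<beta>) ` elts \<alpha>" using map_le_eq_restrict[OF y(2) \<beta>(2)] by blast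
next
  fix y assume "y \<in> (\<lambda>\<beta>. x |` elts \<beta>) ` elts \<alpha>"
  then obtain \<beta> where \<beta>: "\<beta> \<in> elts \<alpha>" "y = x |` elts \<beta>" by blast
  then have "dom y \<noteq> dom x"
    using dom_restrict_below[OF assms(3,4)] assms(3) mem_not_refl by metis
  moreover have "y \<in> X"
    using \<beta> assms(1,2) below_trans[OF assms(4) \<beta>(1)] unfolding level_closed_def by blast
  moreover have "y \<subseteq>\<^sub>m x" unfolding \<beta>(2) by (rule restrict_map_le)
  ultimately show "y \<in> preds X map_less x" unfolding preds_def map_less_def by auto
qed

text \<open>Sending \<beta> to the restriction of x to \<beta> is an isomorphism of \<alpha> onto
  the predecessors of x. Height in the abstract tree is thus given by the domain.\<close>

lemma otp_preds:
  assumes "level_closed X" "x \<in> X" "dom x = elts \<alpha>" "\<alpha> \<in> elts \<kappa>"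
  shows "otp map_less (preds X map_less x) = \<alpha>"
proof (rule otp_eqI[where f = "\<lambda>\<beta>. x |` elts \<beta>", OF Ord_below[OF assms(4)]])
  have "inj_on (\<lambda>\<beta>. x |` elts \<beta>) (elts \<alpha>)"
  proof (rule inj_onI)
    fix \<xi> \<eta> assume *: "\<xi> \<in> elts \<alpha>" "\<eta> \<in> elts \<alpha>" "x |` elts \<xi> = x |` elts \<eta>"
    have "elts \<xi> = dom (x |` elts \<xi>)" "elts \<eta> = dom (x |` elts \<eta>)"
      using dom_restrict_below[OF assms(3,4)] *(1,2) by blast+
    then show "\<xi> = \<eta>" using *(3) by (simp add: elts_inject[symmetric])
  qed
  then show "bij_betw (\<lambda>\<beta>. x |` elts \<beta>) (elts \<alpha>) (preds X map_less x)"
    using preds_map_less[OF assms] by (simp add: bij_betw_def)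
qed (simp add: map_less_restrict_iff[OF assms(3,4)])

lemma tree_level_eq:
  assumes "level_closed X" "\<alpha> \<in> elts \<kappa>"
  shows "tree_level X map_less \<alpha> = {x \<in> X. dom x = elts \<alpha>}"
proof -
  have "otp map_less (preds X map_less x) = \<alpha> \<longleftrightarrow> dom x = elts \<alpha>" if x: "x \<in> X" for x
  proof -
    obtain \<beta> where \<beta>: "\<beta> \<in> elts \<kappa>" "dom x = elts \<beta>"
      using assms(1) x unfolding level_closed_def by blast
    then show ?thesis using otp_preds[OF assms(1) x \<beta>(2,1)] by (simp add: elts_inject)
  qed
  then show ?thesis unfolding tree_level_def by blast
qed

lemma is_tree_maps:
  fixes X :: "('k hset \<rightharpoonup> 'b) set"
  assumes "level_closed X" shows "is_tree X map_less"
  unfolding is_tree_def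
proof (intro conjI ballI impI)
  fix x assume "x \<in> X"
  show "\<not> map_less x x" by (simp add: map_less_def)
next
  fix x y z assume "map_less x y" "map_less y z"
  then show "map_less x z" by (rule map_less_trans)
next
  fix x assume x: "x \<in> X"
  then obtain \<alpha> where \<alpha>: "\<alpha> \<in> elts \<kappa>" "dom x = elts \<alpha>"
    using assms unfolding level_closed_def by blast
  \<comment> \<open>The length of a node, read off from its domain; it transfers well-foundedness
    from membership to the predecessors of x.\<close>
  define h where "h y = (THE \<beta>. dom y = elts \<beta>)" for y :: "'k hset \<rightharpoonup> 'b"
  have h: "h (x |` elts \<beta>) = \<beta>" if "\<beta> \<in> elts \<alpha>" for \<beta>
    unfolding h_def by (simp add: dom_restrict_below[OF \<alpha>(2,1) that] elts_inject del: dom_restrict)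
  have "wfp_on UNIV (\<lambda>x y :: 'k hset. x \<in> elts y)"
    using mem_wf unfolding wfp_def[symmetric] by (simp add: wfp_def)
  then have "wfp_on (h ` preds X map_less x) (\<lambda>x y :: 'k hset. x \<in> elts y)"
    using wfp_on_subset by blast
  then show "wfp_on (preds X map_less x) map_less"
    by (rule wfp_on_if_convertible_to_wfp_on)
      (use h map_less_restrict_iff[OF \<alpha>(2,1)] in \<open>auto simp: preds_map_less[OF assms x \<alpha>(2,1)]\<close>)
  fix y z assume "y \<in> preds X map_less x" "z \<in> preds X map_less x"
  then obtain \<xi> \<eta> where "\<xi> \<in> elts \<alpha>" "\<eta> \<in> elts \<alpha>" "y = x |` elts \<xi>" "z = x |` elts \<eta>"
    using preds_map_less[OF assms x \<alpha>(2,1)] by blast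
  moreover have "\<xi> \<in> elts \<eta> \<or> \<xi> = \<eta> \<or> \<eta> \<in> elts \<xi>"
    using calculation below_linear below_trans[OF \<alpha>(1)] by blast
  ultimately show "y = z \<or> map_less y z \<or> map_less z y"
    using map_less_restrict_iff[OF \<alpha>(2,1)] by blast
qed

lemma tree_height_eq:
  assumes "level_closed X" "\<And>\<alpha>. \<alpha> \<in> elts \<kappa> \<Longrightarrow> \<exists>x\<in>X. dom x = elts \<alpha>"
  shows "tree_height X map_less = \<kappa>"
proof -
  have "(\<lambda>x. osucc (otp map_less (preds X map_less x))) ` X = osucc ` elts \<kappa>"
  proof (intro equalityI subsetI)
    fix y :: "'k hset" assume "y \<in> (\<lambda>x. osucc (otp map_less (preds X map_less x))) ` X"
    then obtain x where x: "x \<in> X" "y = osucc (otp map_less (preds X map_less x))" by blast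
    then obtain \<alpha> where "\<alpha> \<in> elts \<kappa>" "dom x = elts \<alpha>"
      using assms unfolding level_closed_def by blast
    then show "y \<in> osucc ` elts \<kappa>" using otp_preds[OF assms(1) x(1)] x by blast
  next
    fix y assume "y \<in> osucc ` elts \<kappa>"
    then obtain \<alpha> where \<alpha>: "\<alpha> \<in> elts \<kappa>" "y = osucc \<alpha>" by blast
    then obtain x where "x \<in> X" "dom x = elts \<alpha>" using assms(2) by blast
    then show "y \<in> (\<lambda>x. osucc (otp map_less (preds X map_less x))) ` X"
      using otp_preds[OF assms(1) _ _ \<alpha>(1)] \<alpha>(2) by blast
  qed
  moreover have "osup (osucc ` elts \<kappa>) = \<kappa>"
    by (subst osup_eq_iff[OF Ord_kappa]) (use osucc_below mem_osucc_self in blast)+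
  ultimately show ?thesis unfolding tree_height_def by simp
qed

lemma small_levels_below:
  assumes "level_closed X" "\<And>\<alpha>. \<alpha> \<in> elts \<kappa> \<Longrightarrow> small {x \<in> X. dom x = elts \<alpha>}" "\<theta> \<in> elts \<kappa>"
  shows "small {x \<in> X. dom x \<subseteq> elts \<theta>}"
proof (rule small_subset)
  \<comment> \<open>The successor of \<theta> appears because nodes of length exactly \<theta> are
    included.\<close>
  show "small (\<Union>\<alpha>\<in>elts (osucc \<theta>). {x \<in> X. dom x = elts \<alpha>})"
    using assms(2) below_trans[OF osucc_below[OF assms(3)]]
    by (intro small_UN small_elts osucc_below assms(3)) simp
  show "{x \<in> X. dom x \<subseteq> elts \<theta>} \<subseteq> (\<Union>\<alpha>\<in>elts (osucc \<theta>). {x \<in> X. dom x = elts \<alpha>})"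
  proof
    fix x assume x: "x \<in> {x \<in> X. dom x \<subseteq> elts \<theta>}"
    then obtain \<alpha> where \<alpha>: "\<alpha> \<in> elts \<kappa>" "dom x = elts \<alpha>"
      using assms(1) unfolding level_closed_def by blast
    then have "\<alpha> \<in> elts (osucc \<theta>)"
      using x below_subset_iff assms(3) by (auto simp: elts_osucc)
    then show "x \<in> (\<Union>\<alpha>\<in>elts (osucc \<theta>). {x \<in> X. dom x = elts \<alpha>})" using x \<alpha> by blast
  qed
qed

text \<open>Large branches are excluded through antichains: each node of a branch splits, so one of
  its immediate successors leaves the branch, and these successors form an antichain. If antichains
  have bounded length, so has the branch. Splitting is demanded only from \<delta> on, since below
  \<delta> a derived tree has one node per level.\<close>

lemma souslin_mapsI:
  assumes X: "level_closed X"
    and nonempty: "\<And>\<alpha>. \<alpha> \<in> elts \<kappa> \<Longrightarrow> \<exists>x\<in>X. dom x = elts \<alpha>"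
    and levels: "\<And>\<alpha>. \<alpha> \<in> elts \<kappa> \<Longrightarrow> small {x \<in> X. dom x = elts \<alpha>}"
    and \<delta>: "\<delta> \<in> elts \<kappa>"
    and splits: "\<And>x \<alpha>. x \<in> X \<Longrightarrow> \<alpha> \<in> elts \<kappa> \<Longrightarrow> dom x = elts \<alpha> \<Longrightarrow> elts \<delta> \<subseteq> elts \<alpha> \<Longrightarrow>
      \<exists>y\<in>X. \<exists>z\<in>X. dom y = elts (osucc \<alpha>) \<and> dom z = elts (osucc \<alpha>) \<and> x \<subseteq>\<^sub>m y \<and> x \<subseteq>\<^sub>m z \<and> y \<noteq> z"
    and antichains: "\<And>A. is_antichain X map_less A \<Longrightarrow> \<exists>\<theta>\<in>elts \<kappa>. \<forall>a\<in>A. dom a \<subseteq> elts \<theta>"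
  shows "souslin \<kappa> X map_less"
proof -
  \<comment> \<open>Nodes of bounded length occupy fewer than \<kappa> levels, each of them small,
    so by regularity there are fewer than \<kappa> of them.\<close>
  have not_bounded: False
    if "|A| =o |elts \<kappa>|" "A \<subseteq> X" "\<theta> \<in> elts \<kappa>" "\<And>a. a \<in> A \<Longrightarrow> dom a \<subseteq> elts \<theta>" for A \<theta>
  proof -
    have "A \<subseteq> {x \<in> X. dom x \<subseteq> elts \<theta>}" using that by blast
    moreover have "small {x \<in> X. dom x \<subseteq> elts \<theta>}"
      by (rule small_levels_below[OF X _ that(3)]) (rule levels)
    ultimately have "small A" using small_subset by blast
    then show False using that(1) not_ordLess_ordIso by blast
  qed
  have "\<not> |A| =o |elts \<kappa>|" if A: "is_branch X map_less A" for A
  proof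
    assume card: "|A| =o |elts \<kappa>|"
    have "is_chain X map_less A" using A by (simp add: is_branch_def)
    then have chain: "A \<subseteq> X" "\<And>x y. x \<in> A \<Longrightarrow> y \<in> A \<Longrightarrow> x \<subseteq>\<^sub>m y \<or> y \<subseteq>\<^sub>m x"
      unfolding is_chain_def map_less_def by (blast, metis map_le_refl)
    define A' where "A' = {a \<in> A. elts \<delta> \<subseteq> dom a}"
    have "\<exists>y\<in>X. \<exists>\<alpha>\<in>elts \<kappa>. dom a = elts \<alpha> \<and> dom y = elts (osucc \<alpha>) \<and> a \<subseteq>\<^sub>m y \<and> (\<forall>b\<in>A. \<not> y \<subseteq>\<^sub>m b)"
      if a: "a \<in> A'" for a
    proof -
      obtain \<alpha> where \<alpha>: "\<alpha> \<in> elts \<kappa>" "dom a = elts \<alpha>"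
        using X a chain(1) unfolding level_closed_def A'_def by blast
      obtain y z where yz: "y \<in> X" "z \<in> X" "dom y = elts (osucc \<alpha>)" "dom z = elts (osucc \<alpha>)"
        "a \<subseteq>\<^sub>m y" "a \<subseteq>\<^sub>m z" "y \<noteq> z"
        using splits[of a \<alpha>] a chain(1) \<alpha> unfolding A'_def by blast
      \<comment> \<open>Members of the branch above y and above z are comparable, so the longer one
        extends both; but two nodes of equal length below one node coincide.\<close>
      have False if b: "b \<in> A" "y \<subseteq>\<^sub>m b" "b' \<in> A" "z \<subseteq>\<^sub>m b'" for b b'
      proof -
        obtain c where "y \<subseteq>\<^sub>m c" "z \<subseteq>\<^sub>m c"
          using chain(2)[OF b(1,3)] b map_le_trans by metis
        then have "y = z" using map_le_eq_restrict yz(3,4) by metis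
        then show False using yz by blast
      qed
      then consider "\<forall>b\<in>A. \<not> y \<subseteq>\<^sub>m b" | "\<forall>b\<in>A. \<not> z \<subseteq>\<^sub>m b" by blast
      then show ?thesis
      proof cases
        case 1
        show ?thesis by (rule bexI[OF _ yz(1)], rule bexI[OF _ \<alpha>(1)]) (simp add: 1 yz \<alpha>)
      next
        case 2
        show ?thesis by (rule bexI[OF _ yz(2)], rule bexI[OF _ \<alpha>(1)]) (simp add: 2 yz \<alpha>)
      qed
    qed
    then obtain f where f: "\<And>a. a \<in> A' \<Longrightarrow> f a \<in> X \<and> (\<exists>\<alpha>\<in>elts \<kappa>. dom a = elts \<alpha> \<and>
        dom (f a) = elts (osucc \<alpha>) \<and> a \<subseteq>\<^sub>m f a \<and> (\<forall>b\<in>A. \<not> f a \<subseteq>\<^sub>m b))"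
      by metis
    \<comment> \<open>If \<open>f a\<close> were strictly below \<open>f b\<close>, it would already
      be below b, as \<open>f b\<close> is only one step longer than b. But \<open>f a\<close> is
      below no member of the branch.\<close>
    have "\<not> map_less (f a) (f b)" if ab: "a \<in> A'" "b \<in> A'" for a b
    proof
      assume less: "map_less (f a) (f b)"
      obtain \<alpha> where \<alpha>: "\<alpha> \<in> elts \<kappa>" "dom (f a) = elts (osucc \<alpha>)" "\<And>b. b \<in> A \<Longrightarrow> \<not> f a \<subseteq>\<^sub>m b"
        using f[OF ab(1)] by blast
      obtain \<beta> where \<beta>: "\<beta> \<in> elts \<kappa>" "dom b = elts \<beta>" "dom (f b) = elts (osucc \<beta>)" "b \<subseteq>\<^sub>m f b"
        using f[OF ab(2)] by blast
      have le: "f a \<subseteq>\<^sub>m f b" "f a \<noteq> f b" using less unfolding map_less_def by auto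
      have "\<alpha> \<noteq> \<beta>" using le map_le_dom_eq[OF le(1)] \<alpha> \<beta> by auto
      moreover have "elts (osucc \<alpha>) \<subseteq> elts (osucc \<beta>)" using map_le_implies_dom_le[OF le(1)] \<alpha> \<beta> by simp
      ultimately have "\<alpha> \<in> elts \<beta>" using elts_osucc \<alpha> \<beta> by auto
      then have "elts (osucc \<alpha>) \<subseteq> elts \<beta>"
        using elts_osucc[OF \<alpha>(1)] Ord_mem_subset[OF Ord_below[OF \<beta>(1)]] by auto
      then have "f a \<subseteq>\<^sub>m b" using map_le_of_common[OF le(1) \<beta>(4)] \<alpha> \<beta> by simp
      then show False using \<alpha>(3) ab unfolding A'_def by blast
    qed
    then have "is_antichain X map_less (f ` A')" using f unfolding is_antichain_def by blast
    then obtain \<theta> where \<theta>: "\<theta> \<in> elts \<kappa>" "\<forall>a\<in>f ` A'. dom a \<subseteq> elts \<theta>" using antichains by blast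
    \<comment> \<open>\<theta> bounds the nodes of length at least \<delta>, and \<delta> itself the
      remaining ones.\<close>
    obtain \<rho> where \<rho>: "\<rho> \<in> elts \<kappa>" "\<theta> \<in> elts \<rho>" "\<delta> \<in> elts \<rho>" by (rule common_bound[OF \<theta>(1) \<delta>])
    have "dom a \<subseteq> elts \<rho>" if a: "a \<in> A" for a
    proof (cases "a \<in> A'")
      case True
      have "a \<subseteq>\<^sub>m f a" using f[OF True] by blast
      then have "dom a \<subseteq> dom (f a)" by (rule map_le_implies_dom_le)
      also have "\<dots> \<subseteq> elts \<theta>" using \<theta>(2) True by blast
      finally show ?thesis using Ord_mem_subset[OF Ord_below[OF \<rho>(1)] \<rho>(2)] by blast
    next
      case False
      obtain \<alpha> where \<alpha>: "\<alpha> \<in> elts \<kappa>" "dom a = elts \<alpha>"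
        using X a chain(1) unfolding level_closed_def by blast
      then have "\<not> elts \<delta> \<subseteq> elts \<alpha>" using False a unfolding A'_def by blast
      then have "\<alpha> \<in> elts \<delta>" using below_not_mem_iff[OF \<alpha>(1) \<delta>] by blast
      then have "\<alpha> \<in> elts \<rho>" using \<rho> Ord_mem_trans[OF Ord_below] by blast
      then show ?thesis using \<alpha> Ord_mem_subset[OF Ord_below[OF \<rho>(1)]] by blast
    qed
    then show False using not_bounded[OF card chain(1) \<rho>(1)] by blast
  qed
  moreover have "\<not> |A| =o |elts \<kappa>|" if A: "is_antichain X map_less A" for A
  proof
    assume "|A| =o |elts \<kappa>|"
    moreover have "A \<subseteq> X" using A unfolding is_antichain_def by blast
    moreover obtain \<theta> where "\<theta> \<in> elts \<kappa>" "\<forall>a\<in>A. dom a \<subseteq> elts \<theta>" using antichains[OF A] by blast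
    ultimately show False using not_bounded[of A \<theta>] by blast
  qed
  moreover have "tree_height X map_less = \<kappa>" by (rule tree_height_eq[OF X nonempty])
  ultimately show ?thesis
    unfolding souslin_def using is_tree_maps[OF X] tree_level_eq[OF X] levels by auto
qed

end

section \<open>Guessing and coding\<close>

locale proxy = regular_cardinal \<kappa> for \<kappa> :: "'k hset" +
  fixes \<chi> \<sigma> :: "'k hset" and \<C> :: "'k hset \<Rightarrow> 'k hfun set" and B :: "'k hset \<Rightarrow> 'k hset set"
  assumes chi_below: "\<chi> \<in> elts \<kappa>" and infinite_chi: "infinite (elts \<chi>)"
    and closed: "less_closed \<chi> \<kappa>" and sigma_below: "\<sigma> \<in> elts \<kappa>"
    and disjoint_B: "disjoint_family_on B (elts \<kappa>)"
    and clubs: "\<And>\<alpha>. \<alpha> \<in> acc_pts (elts \<kappa>) \<Longrightarrow>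
      \<C> \<alpha> \<subseteq> {C \<in> club_funs \<kappa>. sup_dom C = \<alpha>} \<and> \<C> \<alpha> \<noteq> {} \<and> |\<C> \<alpha>| <o |elts \<kappa>| \<and>
      (\<forall>C\<in>\<C> \<alpha>. \<forall>\<alpha>'\<in>acc_pts (dom C). \<exists>D\<in>\<C> \<alpha>'. sqsub \<chi> D C)"
    and guesses: "\<And>\<Omega> p \<iota> n. \<forall>i\<in>elts \<kappa>. \<Omega> i \<subseteq> H_card \<kappa> \<and> p i \<in> H_plus \<kappa> \<and> \<iota> i \<in> elts \<kappa> \<Longrightarrow>
      n \<in> elts omega \<Longrightarrow>
      stationary_in
        {\<alpha> \<in> E_ge \<kappa> \<chi>. |\<C> \<alpha>| <o |elts (osucc (osucc (ozero :: 'k hset)))| \<and>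
          (\<forall>C\<in>\<C> \<alpha>. \<forall>i\<in>elts \<alpha> \<inter> elts \<kappa>.
            osup {\<gamma> \<in> dom C. succ_set n (dom C - elts \<gamma>) \<subseteq> guess \<kappa> (B (\<iota> i)) (\<Omega> i) (p i) C} = \<alpha>)}
        \<kappa>"
begin

lemma chi_subset: "\<tau> \<in> elts \<chi> \<Longrightarrow> \<tau> \<in> elts \<kappa>"
  using below_trans[OF chi_below] .

lemma zero_in_chi: "ozero \<in> elts \<chi>"
  using below_linear[OF zero_below chi_below] infinite_chi by auto

lemma one_in_chi: "osucc ozero \<in> elts \<chi>"
proof -
  have "osucc ozero \<noteq> \<chi>" using infinite_chi elts_one by auto
  moreover have "\<chi> \<notin> elts (osucc ozero)" using infinite_chi elts_one by auto
  ultimately show ?thesis using below_linear[OF one_below chi_below] by blast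
qed

section \<open>Sequences of length below \<chi>\<close>

definition seqs :: "'a set \<Rightarrow> ('k hset \<rightharpoonup> 'a) set" where
  "seqs X = {v. \<exists>\<mu>\<in>elts \<chi>. dom v = elts \<mu> \<and> ran v \<subseteq> X}"

lemma seqs_map_inj:
  assumes "inj_on f X" "f ` X \<subseteq> Y"
  shows "inj_on (\<lambda>v. map_option f \<circ> v) (seqs X)" "(\<lambda>v. map_option f \<circ> v) ` seqs X \<subseteq> seqs Y"
proof -
  show "inj_on (\<lambda>v. map_option f \<circ> v) (seqs X)"
  proof (intro inj_onI ext)
    fix v w i assume vw: "v \<in> seqs X" "w \<in> seqs X" "map_option f \<circ> v = map_option f \<circ> w"
    have "ran v \<subseteq> X" "ran w \<subseteq> X" using vw(1,2) unfolding seqs_def by blast+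
    moreover have "map_option f (v i) = map_option f (w i)" using vw(3) by (metis comp_apply)
    ultimately show "v i = w i" using assms(1)
      by (cases "v i"; cases "w i") (auto simp: ran_def inj_on_def)
  qed
  show "(\<lambda>v. map_option f \<circ> v) ` seqs X \<subseteq> seqs Y"
  proof (rule image_subsetI)
    fix v assume "v \<in> seqs X"
    then obtain \<mu> where "\<mu> \<in> elts \<chi>" "dom v = elts \<mu>" "ran v \<subseteq> X" unfolding seqs_def by blast
    moreover have "dom (map_option f \<circ> v) = dom v" by auto
    moreover have "ran (map_option f \<circ> v) \<subseteq> Y"
      using assms(2) \<open>ran v \<subseteq> X\<close> by (fastforce simp: ran_def)
    ultimately show "map_option f \<circ> v \<in> seqs Y" unfolding seqs_def by blast
  qed
qed

text \<open>(<\<chi>)-closedness, transported from ordinals below \<kappa> to arbitrary small sets.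
  It bounds both the full levels and the number of vectors on a level.\<close>

lemma small_seqs:
  assumes "small X" shows "small (seqs X)"
proof -
  obtain \<theta> f where \<theta>: "\<theta> \<in> elts \<kappa>" "inj_on f X" "f ` X \<subseteq> elts \<theta>"
    using small_embed[OF assms] by metis
  have "small (seqs (elts \<theta>))"
    using closed \<theta>(1) unfolding less_closed_def seqs_def by blast
  then show ?thesis using seqs_map_inj[OF \<theta>(2,3)] by (rule small_inj)
qed

text \<open>A sequence of length below \<chi> in \<kappa> is bounded by regularity, so all such
  sequences form a union of \<kappa> many sets of size below \<kappa>.\<close>

lemma card_seqs:
  assumes "|X| \<le>o |elts \<kappa>|" shows "|seqs X| \<le>o |elts \<kappa>|"
proof -
  obtain f where f: "inj_on f X" "f ` X \<subseteq> elts \<kappa>"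
    using assms card_of_ordLeq[of X "elts \<kappa>"] by blast
  have "seqs (elts \<kappa>) \<subseteq> (\<Union>\<theta>\<in>elts \<kappa>. seqs (elts \<theta>))"
  proof
    fix v assume "v \<in> seqs (elts \<kappa>)"
    then obtain \<mu> where \<mu>: "\<mu> \<in> elts \<chi>" "dom v = elts \<mu>" "ran v \<subseteq> elts \<kappa>" unfolding seqs_def by blast
    have "ran v = (\<lambda>i. the (v i)) ` elts \<mu>"
      using \<mu>(2) by (force simp: ran_def)
    then have "small (ran v)" using small_image[OF small_elts[OF chi_subset[OF \<mu>(1)]]] by metis
    then obtain \<theta> where "\<theta> \<in> elts \<kappa>" "ran v \<subseteq> elts \<theta>" by (rule small_bounded[OF _ \<mu>(3)])
    then show "v \<in> (\<Union>\<theta>\<in>elts \<kappa>. seqs (elts \<theta>))" using \<mu> unfolding seqs_def by blast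
  qed
  moreover have "|\<Union>\<theta>\<in>elts \<kappa>. seqs (elts \<theta>)| \<le>o |elts \<kappa>|"
    by (rule card_of_UNION_ordLeq_infinite[OF infinite_kappa card_of_refl[THEN ordIso_imp_ordLeq]])
      (use small_seqs small_elts ordLess_imp_ordLeq in blast)
  ultimately have "|seqs (elts \<kappa>)| \<le>o |elts \<kappa>|" using card_of_mono1 ordLeq_transitive by blast
  moreover have "|seqs X| \<le>o |seqs (elts \<kappa>)|"
    using card_of_ordLeqI[OF seqs_map_inj(1)[OF f]] seqs_map_inj(2)[OF f] by (simp add: image_subset_iff)
  ultimately show ?thesis by (rule ordLeq_transitive[rotated])
qed

section \<open>Ordinals of cofinality at least \<chi>\<close>

lemma E_ge_not_cofinal:
  assumes "\<alpha> \<in> E_ge \<kappa> \<chi>" "\<tau> \<in> elts \<chi>" shows "\<not> cofinal_length \<tau> \<alpha>"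
proof -
  have \<alpha>: "\<alpha> \<in> elts \<kappa>" "\<chi> = cofin \<alpha> \<or> \<chi> \<in> elts (cofin \<alpha>)" using assms(1) unfolding E_ge_def by auto
  then have "\<tau> \<in> elts (cofin \<alpha>)"
    using assms(2) Ord_mem_trans[OF cofin_props(1)[OF Ord_below[OF \<alpha>(1)]]] by blast
  then show ?thesis by (rule cofin_props(3)[OF Ord_below[OF \<alpha>(1)]])
qed

lemma E_ge_subset_acc:
  assumes "\<alpha> \<in> E_ge \<kappa> \<chi>" shows "\<alpha> \<in> acc_pts (elts \<kappa>)"
  unfolding acc_kappa_iff
proof (intro conjI ballI)
  show \<alpha>: "\<alpha> \<in> elts \<kappa>" using assms unfolding E_ge_def by auto
  show "\<alpha> \<noteq> ozero"
    using E_ge_not_cofinal[OF assms zero_in_chi] cofinal_length_self[OF Ord_ozero] by blast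
  fix \<xi> assume "\<xi> \<in> elts \<alpha>"
  \<comment> \<open>A map with domain {0} is not cofinal in \<alpha>; with constant value \<xi> this
    yields a member of \<alpha> above \<xi>.\<close>
  then have "\<exists>\<eta>. \<eta> \<in> elts \<alpha> \<and> (\<lambda>_. \<xi>) ` elts (osucc (ozero :: 'k hset)) \<subseteq> elts \<eta>"
    using not_cofinal_length_bounded[OF Ord_below[OF \<alpha>] E_ge_not_cofinal[OF assms one_in_chi], of "\<lambda>_. \<xi>"]
    by (metis image_subsetI)
  then show "\<exists>\<eta>\<in>elts \<alpha>. \<xi> \<in> elts \<eta>" by (auto simp: elts_one)
qed

lemma E_geI:
  assumes "\<alpha> \<in> elts \<kappa>" "cofin \<alpha> \<notin> elts \<chi>" shows "\<alpha> \<in> E_ge \<kappa> \<chi>"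
  using assms Ord_linear[OF cofin_props(1)[OF Ord_below[OF assms(1)]] Ord_below[OF chi_below]]
  unfolding E_ge_def by auto

lemma E_ge_cofin: "\<alpha> \<in> E_ge \<kappa> \<chi> \<Longrightarrow> cofin \<alpha> \<notin> elts \<chi>"
  using E_ge_not_cofinal cofin_props(2)[OF Ord_below] unfolding E_ge_def by blast

lemma E_ge_bounded:
  assumes "\<alpha> \<in> E_ge \<kappa> \<chi>" "\<tau> \<in> elts \<chi>" "f ` elts \<tau> \<subseteq> elts \<alpha>"
  shows "\<exists>\<xi>\<in>elts \<alpha>. f ` elts \<tau> \<subseteq> elts \<xi>"
proof -
  have "Ord \<alpha>" using assms(1) Ord_below unfolding E_ge_def by blast
  then obtain \<xi> where "\<xi> \<in> elts \<alpha>" "f ` elts \<tau> \<subseteq> elts \<xi>"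
    by (rule not_cofinal_length_bounded[OF _ E_ge_not_cofinal[OF assms(1,2)] assms(3)])
  then show ?thesis by blast
qed

lemma cofin_in_chi_iff:
  assumes "\<alpha> \<in> elts \<kappa>"
  shows "cofin \<alpha> \<in> elts \<chi> \<longleftrightarrow> (\<exists>\<tau>\<in>elts \<chi>. cofinal_length \<tau> \<alpha>)"
  using E_geI[OF assms] E_ge_not_cofinal cofin_props(2)[OF Ord_below[OF assms]] by blast

lemma club_funD:
  assumes "\<alpha> \<in> acc_pts (elts \<kappa>)" "C \<in> \<C> \<alpha>"
  shows "dom C \<subseteq> elts \<alpha>" "\<And>\<xi>. \<xi> \<in> elts \<alpha> \<Longrightarrow> \<exists>\<gamma>\<in>dom C. \<xi> \<in> elts \<gamma>"
    "\<And>\<beta>. \<beta> \<in> elts \<alpha> \<Longrightarrow> \<beta> \<noteq> ozero \<Longrightarrow> (\<And>\<xi>. \<xi> \<in> elts \<beta> \<Longrightarrow> \<exists>\<gamma>\<in>dom C \<inter> elts \<beta>. \<xi> \<in> elts \<gamma>) \<Longrightarrow> \<beta> \<in> dom C"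
proof -
  have "C \<in> club_funs \<kappa>" "sup_dom C = \<alpha>" using clubs[OF assms(1)] assms(2) by blast+
  then have C: "club_in (dom C) \<alpha>" "osup (dom C) = \<alpha>" unfolding club_funs_def sup_dom_def by auto
  have \<alpha>: "\<alpha> \<in> elts \<kappa>" using assms(1) acc_kappa_iff by blast
  show sub: "dom C \<subseteq> elts \<alpha>" using C(1) unfolding club_in_def by blast
  show "\<exists>\<gamma>\<in>dom C. \<xi> \<in> elts \<gamma>" if "\<xi> \<in> elts \<alpha>" for \<xi>
    using C(2) that osup_eq_iff[OF Ord_below[OF \<alpha>] sub] by blast
  show "\<beta> \<in> dom C" if \<beta>: "\<beta> \<in> elts \<alpha>" "\<beta> \<noteq> ozero"
    "\<And>\<xi>. \<xi> \<in> elts \<beta> \<Longrightarrow> \<exists>\<gamma>\<in>dom C \<inter> elts \<beta>. \<xi> \<in> elts \<gamma>" for \<beta>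
  proof -
    have "osup (dom C \<inter> elts \<beta>) = \<beta>"
      by (subst osup_eq_iff[OF Ord_below[OF below_trans[OF \<alpha> \<beta>(1)]]]) (use \<beta>(3) in auto)
    then show ?thesis using C(1) \<beta>(1,2) unfolding club_in_def by blast
  qed
qed

lemma next_exists:
  assumes "D \<subseteq> elts \<kappa>" "\<gamma> \<in> D" "\<zeta> \<in> D" "\<gamma> \<in> elts \<zeta>"
  shows "\<exists>\<beta>. is_next D \<gamma> \<beta>"
proof -
  have "{\<zeta> \<in> D. \<gamma> \<in> elts \<zeta>} \<noteq> {}" using assms by blast
  moreover have "Ord \<xi>" if "\<xi> \<in> {\<zeta> \<in> D. \<gamma> \<in> elts \<zeta>}" for \<xi> using that assms(1) Ord_below by blast
  ultimately have "\<exists>\<beta>\<in>{\<zeta> \<in> D. \<gamma> \<in> elts \<zeta>}. \<forall>\<zeta>\<in>{\<zeta> \<in> D. \<gamma> \<in> elts \<zeta>}. elts \<beta> \<subseteq> elts \<zeta>"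
    by (rule set_of_Ords_least)
  then show ?thesis using assms(2) unfolding is_next_def by blast
qed

text \<open>The principle is instantiated with one set \<Omega>, the club D as parameter, and
  \<iota>_i = i, so that a single \<alpha> serves every cell with index below \<alpha>. Submodels
  disappear: what remains of them is that \<beta> lies in D and that C \<beta> is \<Omega> cut off
  at \<beta>. The club D controls the points \<beta>, and D' the level \<alpha>.\<close>

lemma guessing:
  assumes \<Omega>: "\<Omega> \<subseteq> elts \<kappa>" and D: "club_in D \<kappa>" and D': "club_in D' \<kappa>"
  shows "\<exists>\<alpha> C. \<alpha> \<in> D' \<and> \<alpha> \<in> E_ge \<kappa> \<chi> \<and> \<C> \<alpha> = {C} \<and>
    (\<forall>\<iota>\<in>elts \<alpha>. \<forall>\<xi>\<in>elts \<alpha>. \<exists>\<gamma> \<beta>. \<xi> \<in> elts \<gamma> \<and> is_next (dom C) \<gamma> \<beta> \<and> \<beta> \<in> B \<iota> \<and> \<beta> \<in> D \<and>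
      elts (the (C \<beta>)) = \<Omega> \<inter> elts \<beta>)"
proof -
  have D\<kappa>: "D \<subseteq> elts \<kappa>" using D unfolding club_in_def by blast
  let ?G = "\<lambda>\<iota> C. guess \<kappa> (B \<iota>) \<Omega> (vset D) C"
  let ?S = "{\<alpha> \<in> E_ge \<kappa> \<chi>. |\<C> \<alpha>| <o |elts (osucc (osucc (ozero :: 'k hset)))| \<and>
          (\<forall>C\<in>\<C> \<alpha>. \<forall>i\<in>elts \<alpha> \<inter> elts \<kappa>.
            osup {\<gamma> \<in> dom C. succ_set (osucc ozero) (dom C - elts \<gamma>) \<subseteq> ?G i C} = \<alpha>)}"
  have "stationary_in ?S \<kappa>"
    using guesses[of "\<lambda>_. \<Omega>" "\<lambda>_. vset D" "\<lambda>i. i", OF _ one_in_omega]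
      \<Omega> kappa_subset_H vset_in_H_plus[OF D\<kappa>] by blast
  then obtain \<alpha> where \<alpha>: "\<alpha> \<in> ?S" "\<alpha> \<in> D'" using D' unfolding stationary_in_def by blast
  then have E: "\<alpha> \<in> E_ge \<kappa> \<chi>" by blast
  then have acc: "\<alpha> \<in> acc_pts (elts \<kappa>)" by (rule E_ge_subset_acc)
  then have \<alpha>\<kappa>: "\<alpha> \<in> elts \<kappa>" using acc_kappa_iff by blast
  obtain C where C: "C \<in> \<C> \<alpha>" using clubs[OF acc] by blast
  have "C' = C" if C': "C' \<in> \<C> \<alpha>" for C'
  proof (rule ccontr)
    assume neq: "C' \<noteq> C"
    \<comment> \<open>Two members of \<C> \<alpha> would give an injection of the ordinal 2 into it,
      against the bound \<nu> = 2.\<close>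
    define f where "f z = (if z = ozero then C else C')" for z :: "'k hset"
    have "elts (osucc (osucc (ozero :: 'k hset))) = {ozero, osucc ozero}"
      using elts_osucc[OF one_below] elts_one by auto
    then have "inj_on f (elts (osucc (osucc ozero)))" "f ` elts (osucc (osucc ozero)) \<subseteq> \<C> \<alpha>"
      using neq C C' by (auto simp: inj_on_def f_def)
    then have "|elts (osucc (osucc (ozero :: 'k hset)))| \<le>o |\<C> \<alpha>|"
      using card_of_ordLeq[of "elts (osucc (osucc ozero))" "\<C> \<alpha>"] by blast
    then show False using \<alpha>(1) not_ordLess_ordLeq by blast
  qed
  then have single: "\<C> \<alpha> = {C}" using C by blast
  have "\<exists>\<gamma> \<beta>. \<xi> \<in> elts \<gamma> \<and> is_next (dom C) \<gamma> \<beta> \<and> \<beta> \<in> B \<iota> \<and> \<beta> \<in> D \<and> elts (the (C \<beta>)) = \<Omega> \<inter> elts \<beta>"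
    if \<iota>: "\<iota> \<in> elts \<alpha>" and \<xi>: "\<xi> \<in> elts \<alpha>" for \<iota> \<xi>
  proof -
    let ?R = "{\<gamma> \<in> dom C. succ_set (osucc ozero) (dom C - elts \<gamma>) \<subseteq> ?G \<iota> C}"
    note dC = club_funD[OF acc C]
    have "\<iota> \<in> elts \<kappa>" using \<iota> \<alpha>\<kappa> below_trans by blast
    then have "osup ?R = \<alpha>" using \<alpha>(1) \<iota> C by blast
    moreover have "?R \<subseteq> elts \<alpha>" using dC(1) by blast
    ultimately obtain \<gamma> where \<gamma>: "\<gamma> \<in> ?R" "\<xi> \<in> elts \<gamma>"
      using osup_eq_iff[OF Ord_below[OF \<alpha>\<kappa>]] \<xi> by blast
    have d\<kappa>: "dom C \<subseteq> elts \<kappa>" using dC(1) below_subset[OF \<alpha>\<kappa>] by blast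
    have "\<gamma> \<in> elts \<alpha>" using \<gamma>(1) dC(1) by blast
    then obtain \<zeta> where "\<zeta> \<in> dom C" "\<gamma> \<in> elts \<zeta>" using dC(2) by blast
    then obtain \<beta> where \<beta>: "is_next (dom C) \<gamma> \<beta>" using next_exists[OF d\<kappa>] \<gamma>(1) by blast
    then have "\<beta> \<in> ?G \<iota> C" using next_in_succ_set[OF d\<kappa> \<beta>] \<gamma>(1) by blast
    then obtain M where \<beta>B: "\<beta> \<in> B \<iota>" and M: "elem_submodel M (H_plus \<kappa>)" "vset D \<in> M"
      "M \<inter> elts \<kappa> = elts \<beta>" "M \<inter> \<Omega> = elts (the (C \<beta>))"
      unfolding guess_def by blast
    have "\<beta> \<in> elts \<kappa>" "\<gamma> \<in> elts \<beta>" using \<beta> d\<kappa> unfolding is_next_def by blast+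
    moreover have "\<beta> \<noteq> ozero" using \<open>\<gamma> \<in> elts \<beta>\<close> by auto
    ultimately have "\<beta> \<in> D" using elem_submodel_club[OF M(1-3) kappa_subset_H_plus D] by blast
    \<comment> \<open>As \<Omega> consists of ordinals below \<kappa>, its trace on M is its trace
      on \<beta>.\<close>
    moreover have "elts (the (C \<beta>)) = \<Omega> \<inter> elts \<beta>" using M(3,4) \<Omega> by blast
    ultimately show ?thesis using \<gamma>(2) \<beta> \<beta>B by blast
  qed
  then show ?thesis using \<alpha>(2) E single by blast
qed

text \<open>A superset of the tree that is available before the tree: the recursion for the levels
  consults codes of vectors of nodes, so the coding has to be fixed in advance.\<close>

definition nodes :: "'k hfun set" where
  "nodes = {t. \<exists>\<alpha>\<in>elts \<kappa>. dom t = elts \<alpha> \<and> ran t \<subseteq> elts \<kappa>}"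

text \<open>Guessing a bounded set \<open>X\<close> beyond its supremum returns \<open>X\<close> itself.\<close>

lemma card_bounded_subsets:
  "|{X. \<exists>\<theta>\<in>elts \<kappa>. X \<subseteq> elts \<theta>}| \<le>o |elts \<kappa>|" (is "|?P| \<le>o _")
proof -
  have guess: "\<exists>\<alpha>\<in>elts \<kappa>. \<exists>\<beta>\<in>elts \<kappa>. X = elts (the ((THE C. C \<in> \<C> \<alpha>) \<beta>))" if X: "X \<in> ?P" for X
  proof -
    obtain \<theta> where \<theta>: "\<theta> \<in> elts \<kappa>" "X \<subseteq> elts \<theta>" using X by blast
    \<comment> \<open>With the identity as F this is the club of ordinals above \<theta>. It is used
      both for the level \<alpha> and for the point \<beta>, and the guess is taken in the cell of
      index \<theta>, or of any other ordinal below \<alpha>.\<close>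
    have D: "club_in {\<beta> \<in> elts \<kappa>. \<theta> \<in> elts \<beta> \<and> (\<forall>\<gamma>\<in>elts \<beta>. \<gamma> \<in> elts \<beta>)} \<kappa>" (is "club_in ?D \<kappa>")
      by (rule club_closure_points[where F = "\<lambda>\<gamma>. \<gamma>", OF _ \<theta>(1)])
    have "X \<subseteq> elts \<kappa>" using \<theta> below_subset by blast
    then obtain \<alpha> C where \<alpha>: "\<alpha> \<in> ?D" "\<C> \<alpha> = {C}"
      and g: "\<forall>\<iota>\<in>elts \<alpha>. \<forall>\<xi>\<in>elts \<alpha>. \<exists>\<gamma> \<beta>. \<xi> \<in> elts \<gamma> \<and> is_next (dom C) \<gamma> \<beta> \<and> \<beta> \<in> B \<iota> \<and> \<beta> \<in> ?D \<and>
        elts (the (C \<beta>)) = X \<inter> elts \<beta>"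
      using guessing[OF _ D D, of X] by blast
    have "\<theta> \<in> elts \<alpha>" using \<alpha> by blast
    then obtain \<beta> where \<beta>: "\<beta> \<in> ?D" "elts (the (C \<beta>)) = X \<inter> elts \<beta>" using g by blast
    have "elts \<theta> \<subseteq> elts \<beta>" using \<beta>(1) Ord_mem_subset[OF Ord_below] by blast
    then have "X = elts (the (C \<beta>))" using \<beta>(2) \<theta>(2) by blast
    \<comment> \<open>As \<C> \<alpha> is a singleton, C is recovered from \<alpha>, and so X from
      the pair of \<alpha> and \<beta>.\<close>
    moreover have "(THE C. C \<in> \<C> \<alpha>) = C" using \<alpha>(2) by simp
    ultimately show ?thesis using \<alpha>(1) \<beta>(1) by blast
  qed
  have "?P \<subseteq> (\<lambda>(\<alpha>, \<beta>). elts (the ((THE C. C \<in> \<C> \<alpha>) \<beta>))) ` (elts \<kappa> \<times> elts \<kappa>)"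
  proof
    fix X assume "X \<in> ?P"
    from guess[OF this] obtain \<alpha> \<beta> where "\<alpha> \<in> elts \<kappa>" "\<beta> \<in> elts \<kappa>" "X = elts (the ((THE C. C \<in> \<C> \<alpha>) \<beta>))"
      by (elim bexE)
    then show "X \<in> (\<lambda>(\<alpha>, \<beta>). elts (the ((THE C. C \<in> \<C> \<alpha>) \<beta>))) ` (elts \<kappa> \<times> elts \<kappa>)"
      by (intro image_eqI[of _ _ "(\<alpha>, \<beta>)"]) auto
  qed
  then have "|?P| \<le>o |(\<lambda>(\<alpha>, \<beta>). elts (the ((THE C. C \<in> \<C> \<alpha>) \<beta>))) ` (elts \<kappa> \<times> elts \<kappa>)|"
    by (rule card_of_mono1)
  then have "|?P| \<le>o |elts \<kappa> \<times> elts \<kappa>|" using card_of_image by (rule ordLeq_transitive)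
  also have "|elts \<kappa> \<times> elts \<kappa>| =o |elts \<kappa>|" by (rule card_of_Times_same_infinite[OF infinite_kappa])
  finally show ?thesis .
qed

text \<open>Through a pairing function the graph of a node becomes a small, hence bounded, subset of
  \<kappa>, and bounded subsets have been counted.\<close>

lemma card_nodes: "|nodes| \<le>o |elts \<kappa>|"
proof -
  have "|elts \<kappa> \<times> elts \<kappa>| \<le>o |elts \<kappa>|"
    using card_of_Times_same_infinite[OF infinite_kappa] ordIso_imp_ordLeq by blast
  then obtain g where g: "inj_on g (elts \<kappa> \<times> elts \<kappa>)" "g ` (elts \<kappa> \<times> elts \<kappa>) \<subseteq> elts \<kappa>"
    using card_of_ordLeq[of "elts \<kappa> \<times> elts \<kappa>" "elts \<kappa>"] by blast
  have sub: "Map.graph t \<subseteq> elts \<kappa> \<times> elts \<kappa>" if t: "t \<in> nodes" for t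
  proof
    fix p assume p: "p \<in> Map.graph t"
    obtain \<alpha> where "\<alpha> \<in> elts \<kappa>" "dom t = elts \<alpha>" "ran t \<subseteq> elts \<kappa>" using t unfolding nodes_def by blast
    then show "p \<in> elts \<kappa> \<times> elts \<kappa>"
      using p below_subset[of \<alpha>] by (cases p) (auto simp: graph_def ran_def)
  qed
  have "g ` Map.graph t \<in> {X. \<exists>\<theta>\<in>elts \<kappa>. X \<subseteq> elts \<theta>}" if t: "t \<in> nodes" for t
  proof -
    obtain \<alpha> where \<alpha>: "\<alpha> \<in> elts \<kappa>" "dom t = elts \<alpha>" using t unfolding nodes_def by blast
    have "Map.graph t = (\<lambda>i. (i, the (t i))) ` elts \<alpha>"
      unfolding \<alpha>(2)[symmetric] by (force simp: graph_def)
    then have "small (g ` Map.graph t)" using small_image[OF small_image[OF small_elts[OF \<alpha>(1)]]] by metis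
    moreover have "g ` Map.graph t \<subseteq> elts \<kappa>" using sub[OF t] g(2) by blast
    ultimately obtain \<theta> where "\<theta> \<in> elts \<kappa>" "g ` Map.graph t \<subseteq> elts \<theta>" by (rule small_bounded)
    then show ?thesis by blast
  qed
  moreover have "inj_on (\<lambda>t. g ` Map.graph t) nodes"
  proof (rule inj_onI)
    fix s t assume st: "s \<in> nodes" "t \<in> nodes" "g ` Map.graph s = g ` Map.graph t"
    then have "Map.graph s = Map.graph t" using inj_on_image_eq_iff[OF g(1)] sub by metis
    then show "s = t" by (simp add: graph_inject)
  qed
  ultimately have "|nodes| \<le>o |{X. \<exists>\<theta>\<in>elts \<kappa>. X \<subseteq> elts \<theta>}|"
    by (intro card_of_ordLeqI[of "\<lambda>t. g ` Map.graph t"])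
  then show ?thesis using card_bounded_subsets by (rule ordLeq_transitive)
qed

text \<open>Only surjectivity is arranged: arguments pass from a vector to some code of it, so
  several codes of one vector do no harm.\<close>

definition vcode :: "'k hset \<Rightarrow> 'k hset \<rightharpoonup> 'k hfun" where
  "vcode = (SOME f. f ` elts \<kappa> = seqs nodes)"

lemma vcode_image: "vcode ` elts \<kappa> = seqs nodes"
proof -
  have "Map.empty \<in> seqs nodes" unfolding seqs_def using zero_in_chi by (auto intro!: bexI[of _ ozero])
  then have "seqs nodes \<noteq> {}" by blast
  then have "\<exists>f. f ` elts \<kappa> = seqs nodes"
    using card_of_ordLeq2[of "seqs nodes" "elts \<kappa>"] card_seqs[OF card_nodes] by blast
  then show ?thesis unfolding vcode_def by (rule someI_ex)
qed

end

section \<open>The tree\<close>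

text \<open>Defined for arbitrary families, with a chosen value where members disagree; it is
  meaningful for chains, where no disagreement occurs.\<close>

definition map_Union :: "('a \<rightharpoonup> 'b) set \<Rightarrow> 'a \<rightharpoonup> 'b" where
  "map_Union F = (\<lambda>i. if \<exists>y. \<exists>f\<in>F. f i = Some y then Some (SOME y. \<exists>f\<in>F. f i = Some y) else None)"

lemma dom_map_Union: "dom (map_Union F) = (\<Union>f\<in>F. dom f)"
  by (auto simp: map_Union_def dom_def)

lemma map_Union_SomeD: "map_Union F i = Some y \<Longrightarrow> \<exists>f\<in>F. f i = Some y"
proof -
  assume *: "map_Union F i = Some y"
  then have ex: "\<exists>y. \<exists>f\<in>F. f i = Some y" unfolding map_Union_def by (metis option.distinct(1))
  then have "y = (SOME y. \<exists>f\<in>F. f i = Some y)" using * unfolding map_Union_def by simp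
  then show ?thesis using someI_ex[OF ex] by simp
qed

lemma le_map_Union:
  assumes "\<And>f g. f \<in> F \<Longrightarrow> g \<in> F \<Longrightarrow> f \<subseteq>\<^sub>m g \<or> g \<subseteq>\<^sub>m f" "f \<in> F"
  shows "f \<subseteq>\<^sub>m map_Union F"
  unfolding map_le_def
proof
  fix i assume i: "i \<in> dom f"
  then have "i \<in> dom (map_Union F)" using assms(2) unfolding dom_map_Union by blast
  then obtain y where y: "map_Union F i = Some y" by blast
  then obtain g where g: "g \<in> F" "g i = Some y" using map_Union_SomeD by metis
  have "f i = g i" using assms(1)[OF assms(2) g(1)] i g(2) unfolding map_le_def by (metis domI)
  then show "f i = map_Union F i" using y g by simp
qed

context proxy
begin

section \<open>Canonical branches along a club\<close>

definition part :: "'k hset \<Rightarrow> 'k hset" where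
  "part \<beta> = (THE \<iota>. \<iota> \<in> elts \<kappa> \<and> \<beta> \<in> B \<iota>)"

lemma part_eq: "\<iota> \<in> elts \<kappa> \<Longrightarrow> \<beta> \<in> B \<iota> \<Longrightarrow> part \<beta> = \<iota>"
  unfolding part_def using disjoint_B unfolding disjoint_family_on_def by (intro the_equality) blast+

text \<open>Unlike \<open>is_next\<close>, this mentions only the part of D below \<beta>. Replacing
  C by an initial segment that reaches up to \<beta> therefore leaves predecessors unchanged, as
  coherence requires.\<close>

definition is_pred :: "'k hset set \<Rightarrow> 'k hset \<Rightarrow> 'k hset \<Rightarrow> bool" where
  "is_pred D \<gamma> \<beta> \<longleftrightarrow> \<gamma> \<in> D \<inter> elts \<beta> \<and> (\<forall>\<zeta>\<in>D \<inter> elts \<beta>. \<gamma> \<notin> elts \<zeta>)"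

text \<open>
  At a successor point \<open>\<beta>\<close> of \<open>dom C\<close>, a node \<open>x\<close> listed in the vector \<open>v\<close> attached to the cell of \<open>\<beta>\<close>
  is moved along so that all of \<open>v\<close> jointly gets above one vector \<open>w\<close> coded in \<open>C \<beta>\<close>, if possible.
  Here \<open>z\<close> gives the canonical extensions to the predecessor level.
\<close>

definition absorbs :: "('k hset \<Rightarrow> 'k hfun set) \<Rightarrow> 'k hfun \<Rightarrow> 'k hset \<Rightarrow> ('k hfun \<Rightarrow> 'k hfun) \<Rightarrow>
    ('k hset \<rightharpoonup> 'k hfun) \<Rightarrow> ('k hset \<rightharpoonup> 'k hfun) \<Rightarrow> bool" where
  "absorbs L C \<beta> z v w \<longleftrightarrow> w \<in> vcode ` elts (the (C \<beta>)) \<and> dom w = dom v \<and>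
    (\<forall>i\<in>dom v. \<exists>t\<in>L \<beta>. z (the (v i)) \<subseteq>\<^sub>m t \<and> the (w i) \<subseteq>\<^sub>m t)"

text \<open>The target w is chosen independently of x. Separate calls for the members of v therefore
  agree on one vector, and each call takes the coordinate at which its own x stands in v.\<close>

definition ext_node :: "('k hset \<Rightarrow> 'k hfun set) \<Rightarrow> 'k hfun \<Rightarrow> 'k hset \<Rightarrow> ('k hfun \<Rightarrow> 'k hfun) \<Rightarrow>
    'k hfun \<Rightarrow> 'k hfun" where
  "ext_node L C \<beta> z x = (let v = vcode (part \<beta>) in
    if x \<in> ran v \<and> (\<exists>w. absorbs L C \<beta> z v w)
    then SOME t. t \<in> L \<beta> \<and> z x \<subseteq>\<^sub>m t \<and>
      the ((SOME w. absorbs L C \<beta> z v w) (SOME i. v i = Some x)) \<subseteq>\<^sub>m t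
    else SOME t. t \<in> L \<beta> \<and> z x \<subseteq>\<^sub>m t)"

text \<open>The coordinate is recovered by choosing an index with value x, hence the demand that x
  occur only once in v. The chosen vector may differ from the given w, so the conclusion speaks of
  some w' common to all x.\<close>

lemma ext_node_absorbs:
  assumes "vcode (part \<beta>) = v" "absorbs L C \<beta> z v w"
  obtains w' where "absorbs L C \<beta> z v w'"
    "\<And>x i. v i = Some x \<Longrightarrow> (\<And>j. v j = Some x \<Longrightarrow> j = i) \<Longrightarrow> the (w' i) \<subseteq>\<^sub>m ext_node L C \<beta> z x"
proof -
  define w' where "w' = (SOME w. absorbs L C \<beta> z v w)"
  have w': "absorbs L C \<beta> z v w'" unfolding w'_def using assms(2) by (rule someI[where P = "absorbs L C \<beta> z v"])
  have "the (w' i) \<subseteq>\<^sub>m ext_node L C \<beta> z x"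
    if i: "v i = Some x" and uniq: "\<And>j. v j = Some x \<Longrightarrow> j = i" for x i
  proof -
    have i_eq: "(SOME i. v i = Some x) = i" using i uniq by (rule some_equality)
    have c: "x \<in> ran v \<and> (\<exists>w. absorbs L C \<beta> z v w)" using ranI[of v, OF i] assms(2) by blast
    have ext: "ext_node L C \<beta> z x = (SOME t. t \<in> L \<beta> \<and> z x \<subseteq>\<^sub>m t \<and> the (w' i) \<subseteq>\<^sub>m t)"
      unfolding ext_node_def Let_def assms(1) if_P[OF c] i_eq w'_def by (rule refl)
    have "i \<in> dom v" using i by blast
    then have "\<exists>t\<in>L \<beta>. z (the (v i)) \<subseteq>\<^sub>m t \<and> the (w' i) \<subseteq>\<^sub>m t"
      using w' unfolding absorbs_def by blast
    then have "\<exists>t. t \<in> L \<beta> \<and> z x \<subseteq>\<^sub>m t \<and> the (w' i) \<subseteq>\<^sub>m t" unfolding i option.sel by blast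
    from someI_ex[OF this] show ?thesis unfolding ext by blast
  qed
  then show ?thesis using that w' by blast
qed

text \<open>When a move is possible, \<open>absorbs\<close> itself supplies the node to be chosen;
  the hypotheses supply it for the default case.\<close>

lemma ext_node_in:
  assumes "t \<in> L \<beta>" "z x \<subseteq>\<^sub>m t"
  shows "ext_node L C \<beta> z x \<in> L \<beta> \<and> z x \<subseteq>\<^sub>m ext_node L C \<beta> z x"
proof (cases "x \<in> ran (vcode (part \<beta>)) \<and> (\<exists>w. absorbs L C \<beta> z (vcode (part \<beta>)) w)")
  case True
  define v where "v = vcode (part \<beta>)"
  define w where "w = (SOME w. absorbs L C \<beta> z v w)"
  define i where "i = (SOME i. v i = Some x)"
  have ext: "ext_node L C \<beta> z x = (SOME t. t \<in> L \<beta> \<and> z x \<subseteq>\<^sub>m t \<and> the (w i) \<subseteq>\<^sub>m t)"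
    unfolding ext_node_def Let_def w_def i_def v_def using True by (rule if_P)
  have "\<exists>i. v i = Some x" using True unfolding v_def ran_def by blast
  then have i: "v i = Some x" unfolding i_def by (rule someI_ex)
  have "\<exists>w. absorbs L C \<beta> z v w" using True unfolding v_def by blast
  then have "absorbs L C \<beta> z v w" unfolding w_def by (rule someI_ex)
  moreover have "i \<in> dom v" using i by blast
  ultimately have "\<exists>t\<in>L \<beta>. z (the (v i)) \<subseteq>\<^sub>m t \<and> the (w i) \<subseteq>\<^sub>m t" unfolding absorbs_def by blast
  then have "\<exists>t. t \<in> L \<beta> \<and> z x \<subseteq>\<^sub>m t \<and> the (w i) \<subseteq>\<^sub>m t" unfolding i option.sel by blast
  from someI_ex[OF this] show ?thesis unfolding ext by blast
next
  case False
  then have "ext_node L C \<beta> z x = (SOME t. t \<in> L \<beta> \<and> z x \<subseteq>\<^sub>m t)"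
    unfolding ext_node_def Let_def by (rule if_not_P)
  then show ?thesis using someI[of "\<lambda>t. t \<in> L \<beta> \<and> z x \<subseteq>\<^sub>m t" t] assms by simp
qed

text \<open>The recursion runs on \<beta> alone and returns a function of x: at a successor point,
  \<open>ext_node\<close> consults the canonical extensions of all nodes of the attached vector. The
  levels L are a parameter because branches are formed while the tree is still under
  construction.\<close>

function branch_at :: "('k hset \<Rightarrow> 'k hfun set) \<Rightarrow> 'k hfun \<Rightarrow> 'k hset \<Rightarrow> 'k hfun \<Rightarrow> 'k hfun" where
  "branch_at L C \<beta> = (\<lambda>x. if dom x = elts \<beta> then x
    else if \<exists>\<gamma>. is_pred (dom C) \<gamma> \<beta> then ext_node L C \<beta> (branch_at L C (SOME \<gamma>. is_pred (dom C) \<gamma> \<beta>)) x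
    else map_Union ((\<lambda>\<gamma>. branch_at L C \<gamma> x) ` {\<gamma> \<in> dom C \<inter> elts \<beta>. dom x \<subseteq> elts \<gamma>}))"
  by auto
termination
proof (relation "inv_image {(x, y). x \<in> elts y} (\<lambda>(_, _, \<beta>). \<beta>)")
  show "wf (inv_image {(x, y :: 'k hset). x \<in> elts y} (\<lambda>(_ :: 'k hset \<Rightarrow> 'k hfun set, _ :: 'k hfun, \<beta>). \<beta>))"
    by (rule wf_inv_image[OF mem_wf])
  fix L :: "'k hset \<Rightarrow> 'k hfun set" and C x :: "'k hfun" and \<beta> :: "'k hset"
  assume "\<exists>\<gamma>. is_pred (dom C) \<gamma> \<beta>"
  then have "is_pred (dom C) (SOME \<gamma>. is_pred (dom C) \<gamma> \<beta>) \<beta>" by (rule someI_ex)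
  then show "((L, C, SOME \<gamma>. is_pred (dom C) \<gamma> \<beta>), (L, C, \<beta>)) \<in> inv_image {(x, y). x \<in> elts y} (\<lambda>(_, _, \<beta>). \<beta>)"
    unfolding is_pred_def by simp
qed auto

declare branch_at.simps [simp del]

lemma branch_at_start: "dom x = elts \<beta> \<Longrightarrow> branch_at L C \<beta> x = x"
  by (subst branch_at.simps) simp

lemma branch_at_limit:
  "dom x \<noteq> elts \<beta> \<Longrightarrow> \<nexists>\<gamma>. is_pred (dom C) \<gamma> \<beta> \<Longrightarrow>
    branch_at L C \<beta> x = map_Union ((\<lambda>\<gamma>. branch_at L C \<gamma> x) ` {\<gamma> \<in> dom C \<inter> elts \<beta>. dom x \<subseteq> elts \<gamma>})"
  by (subst branch_at.simps) simp

lemma is_pred_unique: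
  assumes "D \<subseteq> elts \<kappa>" "is_pred D \<gamma> \<beta>" "is_pred D \<gamma>' \<beta>" shows "\<gamma> = \<gamma>'"
  using assms below_linear[of \<gamma> \<gamma>'] unfolding is_pred_def by blast

lemma branch_at_succ:
  assumes "dom C \<subseteq> elts \<kappa>" "is_pred (dom C) \<gamma> \<beta>" "dom x \<noteq> elts \<beta>"
  shows "branch_at L C \<beta> x = ext_node L C \<beta> (branch_at L C \<gamma>) x"
proof -
  have "(SOME \<gamma>. is_pred (dom C) \<gamma> \<beta>) = \<gamma>"
    using assms is_pred_unique[OF assms(1)] by (intro some_equality) blast+
  then show ?thesis using assms by (subst branch_at.simps) auto
qed

lemma is_pred_of_next: "is_next D \<gamma> \<beta> \<Longrightarrow> is_pred D \<gamma> \<beta>"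
  unfolding is_next_def is_pred_def using mem_not_refl by blast

text \<open>A branch at \<beta> consults C and L only up to \<beta>. This serves twice: to replace
  the truncated level function of the recursion by \<open>lev\<close>, and to pass from C to a
  coherent D at a limit point.\<close>

lemma branch_at_cong:
  assumes "Ord \<beta>" "\<And>\<gamma>. \<gamma> = \<beta> \<or> \<gamma> \<in> elts \<beta> \<Longrightarrow> C \<gamma> = C' \<gamma>" "\<And>\<gamma>. \<gamma> = \<beta> \<or> \<gamma> \<in> elts \<beta> \<Longrightarrow> L \<gamma> = L' \<gamma>"
  shows "branch_at L C \<beta> = branch_at L' C' \<beta>"
  using assms
proof (induction \<beta> rule: hset_induct)
  case (1 \<beta>)
  have IH: "branch_at L C \<gamma> = branch_at L' C' \<gamma>" if \<gamma>: "\<gamma> \<in> elts \<beta>" for \<gamma>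
  proof (rule 1(1)[OF \<gamma>])
    show "Ord \<gamma>" using 1(2) \<gamma> by (rule Ord_mem)
    show "C \<xi> = C' \<xi>" "L \<xi> = L' \<xi>" if "\<xi> = \<gamma> \<or> \<xi> \<in> elts \<gamma>" for \<xi>
      using that 1(3,4) \<gamma> Ord_mem_trans[OF 1(2) \<gamma>] by blast+
  qed
  have dom: "dom C \<inter> elts \<beta> = dom C' \<inter> elts \<beta>" using 1(3) by (auto simp: dom_def)
  then have pred: "is_pred (dom C) \<gamma> \<beta> \<longleftrightarrow> is_pred (dom C') \<gamma> \<beta>" for \<gamma> unfolding is_pred_def by simp
  have ext: "ext_node L C \<beta> = ext_node L' C' \<beta>"
  proof -
    have eq: "C \<beta> = C' \<beta>" "L \<beta> = L' \<beta>" using 1(3)[of \<beta>] 1(4)[of \<beta>] by blast+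
    have "absorbs L C \<beta> = absorbs L' C' \<beta>" by (rule ext, rule ext, rule ext) (simp add: absorbs_def eq)
    note abs = this
    show ?thesis by (rule ext, rule ext) (unfold ext_node_def abs eq, rule refl)
  qed
  show ?case
  proof
    fix x :: "'k hfun"
    consider "dom x = elts \<beta>" | "dom x \<noteq> elts \<beta>" "\<exists>\<gamma>. is_pred (dom C) \<gamma> \<beta>"
      | "dom x \<noteq> elts \<beta>" "\<nexists>\<gamma>. is_pred (dom C) \<gamma> \<beta>" by blast
    then show "branch_at L C \<beta> x = branch_at L' C' \<beta> x"
    proof cases
      case 1
      then show ?thesis by (simp add: branch_at_start)
    next
      case 2
      let ?\<gamma> = "SOME \<gamma>. is_pred (dom C) \<gamma> \<beta>"
      have "is_pred (dom C) ?\<gamma> \<beta>" using 2(2) by (rule someI_ex)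
      then have "branch_at L C ?\<gamma> = branch_at L' C' ?\<gamma>" unfolding is_pred_def by (intro IH) blast
      moreover have "branch_at L C \<beta> x = ext_node L C \<beta> (branch_at L C ?\<gamma>) x"
        by (subst branch_at.simps) (use 2 in simp)
      moreover have "branch_at L' C' \<beta> x = ext_node L' C' \<beta> (branch_at L' C' ?\<gamma>) x"
        by (subst branch_at.simps) (use 2 pred in simp)
      ultimately show ?thesis by (simp add: ext)
    next
      case 3
      have "branch_at L C \<beta> x = map_Union ((\<lambda>\<gamma>. branch_at L C \<gamma> x) ` {\<gamma> \<in> dom C \<inter> elts \<beta>. dom x \<subseteq> elts \<gamma>})"
        by (rule branch_at_limit[OF 3])
      also have "\<dots> = map_Union ((\<lambda>\<gamma>. branch_at L' C' \<gamma> x) ` {\<gamma> \<in> dom C' \<inter> elts \<beta>. dom x \<subseteq> elts \<gamma>})"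
        unfolding dom by (rule arg_cong[where f = map_Union], rule image_cong) (use IH in auto)
      also have "\<dots> = branch_at L' C' \<beta> x" using 3 pred by (simp add: branch_at_limit)
      finally show ?thesis .
    qed
  qed
qed

section \<open>The levels of the tree\<close>

definition branch_limit :: "('k hset \<Rightarrow> 'k hfun set) \<Rightarrow> 'k hfun \<Rightarrow> 'k hfun \<Rightarrow> 'k hfun" where
  "branch_limit L C x = map_Union ((\<lambda>\<gamma>. branch_at L C \<gamma> x) ` {\<gamma> \<in> dom C. dom x \<subseteq> elts \<gamma>})"

text \<open>New values range over \<omega> and \<beta>, whose union is the maximum asked for by
  prolificness, and over \<sigma> for the sake of splitting.\<close>

definition level_step :: "('k hset \<Rightarrow> 'k hfun set) \<Rightarrow> 'k hset \<Rightarrow> 'k hfun set" where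
  "level_step L \<alpha> = (if \<alpha> = ozero then {Map.empty}
    else if \<exists>\<beta>\<in>elts \<kappa>. \<alpha> = osucc \<beta>
      then {t(\<beta> \<mapsto> i) | t \<beta> i. \<beta> \<in> elts \<kappa> \<and> \<alpha> = osucc \<beta> \<and> t \<in> L \<beta> \<and> i \<in> elts omega \<union> elts \<beta> \<union> elts \<sigma>}
    else if cofin \<alpha> \<in> elts \<chi> then {t. dom t = elts \<alpha> \<and> (\<forall>\<beta>\<in>elts \<alpha>. t |` elts \<beta> \<in> L \<beta>)}
    else {branch_limit L C x | C x. C \<in> \<C> \<alpha> \<and> (\<exists>\<delta>\<in>dom C. x \<in> L \<delta>)})"

definition lev :: "'k hset \<Rightarrow> 'k hfun set" where
  "lev = wfrec {(x, y). x \<in> elts y} level_step"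

lemma lev_unfold: "lev \<alpha> = level_step (cut lev {(x, y). x \<in> elts y} \<alpha>) \<alpha>"
  unfolding lev_def by (subst wfrec[OF mem_wf]) (rule refl)

lemma cut_lev: "\<beta> \<in> elts \<alpha> \<Longrightarrow> cut lev {(x, y). x \<in> elts y} \<alpha> \<beta> = lev \<beta>"
  by (simp add: cut_apply)

lemma lev_zero: "lev ozero = {Map.empty}"
  by (subst lev_unfold) (simp add: level_step_def)

lemma lev_succ:
  assumes "\<beta> \<in> elts \<kappa>"
  shows "lev (osucc \<beta>) = {t(\<beta> \<mapsto> i) | t i. t \<in> lev \<beta> \<and> i \<in> elts omega \<union> elts \<beta> \<union> elts \<sigma>}"
proof -
  have "lev (osucc \<beta>) = {t(\<gamma> \<mapsto> i) | t \<gamma> i. \<gamma> \<in> elts \<kappa> \<and> osucc \<beta> = osucc \<gamma> \<and>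
      t \<in> cut lev {(x, y). x \<in> elts y} (osucc \<beta>) \<gamma> \<and> i \<in> elts omega \<union> elts \<gamma> \<union> elts \<sigma>}"
    by (subst lev_unfold) (use assms osucc_neq_ozero[OF assms] in \<open>auto simp: level_step_def\<close>)
  also have "\<dots> = {t(\<beta> \<mapsto> i) | t i. t \<in> lev \<beta> \<and> i \<in> elts omega \<union> elts \<beta> \<union> elts \<sigma>}"
    using osucc_inj[OF assms] assms cut_lev[OF mem_osucc_self[OF assms]] by fastforce
  finally show ?thesis .
qed

lemma lev_limit:
  assumes "\<alpha> \<in> acc_pts (elts \<kappa>)" "cofin \<alpha> \<in> elts \<chi>"
  shows "lev \<alpha> = {t. dom t = elts \<alpha> \<and> (\<forall>\<beta>\<in>elts \<alpha>. t |` elts \<beta> \<in> lev \<beta>)}"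
proof -
  have "\<alpha> \<noteq> ozero" "\<not> (\<exists>\<beta>\<in>elts \<kappa>. \<alpha> = osucc \<beta>)"
    using assms(1) acc_kappa_iff osucc_not_acc by blast+
  then have "lev \<alpha> = {t. dom t = elts \<alpha> \<and> (\<forall>\<beta>\<in>elts \<alpha>. t |` elts \<beta> \<in> cut lev {(x, y). x \<in> elts y} \<alpha> \<beta>)}"
    by (subst lev_unfold) (simp add: level_step_def assms(2))
  then show ?thesis by (simp add: cut_lev)
qed

text \<open>All points of \<open>dom C\<close> are below \<alpha>, so branches consult the truncated
  level function only where it agrees with \<open>lev\<close>.\<close>

lemma lev_E_ge:
  assumes "\<alpha> \<in> E_ge \<kappa> \<chi>"
  shows "lev \<alpha> = {branch_limit lev C x | C x. C \<in> \<C> \<alpha> \<and> (\<exists>\<delta>\<in>dom C. x \<in> lev \<delta>)}"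
proof -
  let ?L = "cut lev {(x, y). x \<in> elts y} \<alpha>"
  have acc: "\<alpha> \<in> acc_pts (elts \<kappa>)" using assms by (rule E_ge_subset_acc)
  then have \<alpha>: "\<alpha> \<in> elts \<kappa>" "\<alpha> \<noteq> ozero" "\<not> (\<exists>\<beta>\<in>elts \<kappa>. \<alpha> = osucc \<beta>)"
    using acc_kappa_iff osucc_not_acc by blast+
  have eq: "lev \<alpha> = {branch_limit ?L C x | C x. C \<in> \<C> \<alpha> \<and> (\<exists>\<delta>\<in>dom C. x \<in> ?L \<delta>)}"
    by (subst lev_unfold) (simp add: level_step_def \<alpha>(2,3) E_ge_cofin[OF assms])
  have l: "branch_limit ?L C x = branch_limit lev C x" if C: "C \<in> \<C> \<alpha>" for C x
  proof -
    have "branch_at ?L C \<gamma> = branch_at lev C \<gamma>" if "\<gamma> \<in> dom C" for \<gamma>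
    proof (rule branch_at_cong)
      have \<gamma>: "\<gamma> \<in> elts \<alpha>" using that club_funD(1)[OF acc C] by blast
      then show "Ord \<gamma>" using Ord_mem[OF Ord_below[OF \<alpha>(1)]] by blast
      show "?L \<xi> = lev \<xi>" if "\<xi> = \<gamma> \<or> \<xi> \<in> elts \<gamma>" for \<xi>
        using that \<gamma> Ord_mem_trans[OF Ord_below[OF \<alpha>(1)]] cut_lev by blast
    qed simp
    then show ?thesis unfolding branch_limit_def by (intro arg_cong[where f = map_Union] image_cong) auto
  qed
  have d: "?L \<delta> = lev \<delta>" if "C \<in> \<C> \<alpha>" "\<delta> \<in> dom C" for C \<delta>
    using cut_lev that club_funD(1)[OF acc that(1)] by blast
  show ?thesis
  proof (intro equalityI subsetI)
    fix t assume "t \<in> lev \<alpha>"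
    then obtain C x \<delta> where "t = branch_limit ?L C x" "C \<in> \<C> \<alpha>" "\<delta> \<in> dom C" "x \<in> ?L \<delta>" unfolding eq by blast
    then show "t \<in> {branch_limit lev C x | C x. C \<in> \<C> \<alpha> \<and> (\<exists>\<delta>\<in>dom C. x \<in> lev \<delta>)}" using l d by blast
  next
    fix t assume "t \<in> {branch_limit lev C x | C x. C \<in> \<C> \<alpha> \<and> (\<exists>\<delta>\<in>dom C. x \<in> lev \<delta>)}"
    then obtain C x \<delta> where t: "t = branch_limit lev C x" "C \<in> \<C> \<alpha>" "\<delta> \<in> dom C" "x \<in> lev \<delta>" by blast
    then have "t = branch_limit ?L C x" "x \<in> ?L \<delta>" using l d by auto
    then show "t \<in> lev \<alpha>" unfolding eq using t(2,3) by blast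
  qed
qed

lemma lim_in_lev:
  "\<alpha> \<in> E_ge \<kappa> \<chi> \<Longrightarrow> C \<in> \<C> \<alpha> \<Longrightarrow> \<delta> \<in> dom C \<Longrightarrow> x \<in> lev \<delta> \<Longrightarrow> branch_limit lev C x \<in> lev \<alpha>"
  unfolding lev_E_ge by blast

text \<open>The induction invariant. Extendibility is carried along because the choices in
  \<open>ext_node\<close> rely on it, and smallness because the size of a limit level is estimated
  through the levels below.\<close>

definition good_level :: "'k hset \<Rightarrow> bool" where
  "good_level \<alpha> \<longleftrightarrow> (\<forall>t\<in>lev \<alpha>. dom t = elts \<alpha> \<and> ran t \<subseteq> elts \<kappa> \<and> (\<forall>\<beta>\<in>elts \<alpha>. t |` elts \<beta> \<in> lev \<beta>)) \<and>
    (\<forall>\<beta>\<in>elts \<alpha>. \<forall>s\<in>lev \<beta>. \<exists>t\<in>lev \<alpha>. s \<subseteq>\<^sub>m t) \<and> small (lev \<alpha>)"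

lemma goodD:
  assumes "good_level \<alpha>" "t \<in> lev \<alpha>"
  shows "dom t = elts \<alpha>" "ran t \<subseteq> elts \<kappa>" "\<And>\<beta>. \<beta> \<in> elts \<alpha> \<Longrightarrow> t |` elts \<beta> \<in> lev \<beta>"
  using assms unfolding good_level_def by auto

lemma good_extend: "good_level \<alpha> \<Longrightarrow> \<beta> \<in> elts \<alpha> \<Longrightarrow> s \<in> lev \<beta> \<Longrightarrow> \<exists>t\<in>lev \<alpha>. s \<subseteq>\<^sub>m t"
  unfolding good_level_def by auto

lemma good_small: "good_level \<alpha> \<Longrightarrow> small (lev \<alpha>)"
  unfolding good_level_def by auto

text \<open>Glues nodes along an unbounded set E of levels. It is applied both at limit points
  inside a club and at the level above the whole club.\<close>

lemma union_branch:
  assumes \<alpha>: "\<alpha> \<in> elts \<kappa>" and good_level: "\<forall>\<beta>\<in>elts \<alpha>. good_level \<beta>"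
    and E: "E \<subseteq> elts \<alpha>" "\<forall>\<xi>\<in>elts \<alpha>. \<exists>\<gamma>\<in>E. \<xi> \<in> elts \<gamma>"
    and f: "\<forall>\<gamma>\<in>E. f \<gamma> \<in> lev \<gamma>"
      "\<forall>\<gamma>\<in>E. \<forall>\<gamma>'\<in>E. elts \<gamma> \<subseteq> elts \<gamma>' \<longrightarrow> f \<gamma> \<subseteq>\<^sub>m f \<gamma>'"
  shows "dom (map_Union (f ` E)) = elts \<alpha>" "\<And>\<xi>. \<xi> \<in> elts \<alpha> \<Longrightarrow> map_Union (f ` E) |` elts \<xi> \<in> lev \<xi>"
    "\<And>\<gamma>. \<gamma> \<in> E \<Longrightarrow> f \<gamma> \<subseteq>\<^sub>m map_Union (f ` E)" "ran (map_Union (f ` E)) \<subseteq> elts \<kappa>"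
proof -
  let ?t = "map_Union (f ` E)"
  have f': "dom (f \<gamma>) = elts \<gamma>" "ran (f \<gamma>) \<subseteq> elts \<kappa>" "\<And>\<xi>. \<xi> \<in> elts \<gamma> \<Longrightarrow> f \<gamma> |` elts \<xi> \<in> lev \<xi>"
    if "\<gamma> \<in> E" for \<gamma>
  proof -
    have "f \<gamma> \<in> lev \<gamma>" "good_level \<gamma>" using f(1) good_level that E(1) by blast+
    from goodD[OF this(2,1)]
    show "dom (f \<gamma>) = elts \<gamma>" "ran (f \<gamma>) \<subseteq> elts \<kappa>" "\<And>\<xi>. \<xi> \<in> elts \<gamma> \<Longrightarrow> f \<gamma> |` elts \<xi> \<in> lev \<xi>" .
  qed
  have E\<kappa>: "E \<subseteq> elts \<kappa>" using E(1) below_subset[OF \<alpha>] by blast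
  have chain: "g \<subseteq>\<^sub>m h \<or> h \<subseteq>\<^sub>m g" if gh: "g \<in> f ` E" "h \<in> f ` E" for g h
  proof -
    obtain \<gamma> \<gamma>' where \<gamma>: "\<gamma> \<in> E" "\<gamma>' \<in> E" "g = f \<gamma>" "h = f \<gamma>'" using gh by blast
    then have "elts \<gamma> \<subseteq> elts \<gamma>' \<or> elts \<gamma>' \<subseteq> elts \<gamma>"
      using below_not_mem_iff[of \<gamma> \<gamma>'] below_subset_iff[of \<gamma> \<gamma>'] E\<kappa> by blast
    then show ?thesis using f(2) \<gamma> by blast
  qed
  show le: "f \<gamma> \<subseteq>\<^sub>m ?t" if "\<gamma> \<in> E" for \<gamma>
    by (rule le_map_Union[OF chain]) (use that in auto)
  have "(\<Union>g\<in>f ` E. dom g) = (\<Union>\<gamma>\<in>E. elts \<gamma>)" using f'(1) by auto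
  also have "\<dots> = elts \<alpha>" using E Ord_mem_subset[OF Ord_below[OF \<alpha>]] by blast
  finally show dom: "dom ?t = elts \<alpha>" by (simp add: dom_map_Union)
  show "?t |` elts \<xi> \<in> lev \<xi>" if \<xi>: "\<xi> \<in> elts \<alpha>" for \<xi>
  proof -
    obtain \<gamma> where \<gamma>: "\<gamma> \<in> E" "\<xi> \<in> elts \<gamma>" using E(2) \<xi> by blast
    then have \<gamma>\<kappa>: "\<gamma> \<in> elts \<kappa>" using E\<kappa> by blast
    have "f \<gamma> |` elts \<xi> \<subseteq>\<^sub>m ?t" using restrict_map_le le[OF \<gamma>(1)] by (rule map_le_trans)
    then have "f \<gamma> |` elts \<xi> = ?t |` elts \<xi>"
      by (rule map_le_eq_restrict) (rule dom_restrict_below[OF f'(1)[OF \<gamma>(1)] \<gamma>\<kappa> \<gamma>(2)])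
    then show ?thesis using f'(3)[OF \<gamma>] by simp
  qed
  show "ran ?t \<subseteq> elts \<kappa>"
  proof
    fix y assume "y \<in> ran ?t"
    then obtain i where "?t i = Some y" unfolding ran_def by blast
    then obtain \<gamma> where "\<gamma> \<in> E" "f \<gamma> i = Some y" using map_Union_SomeD by (metis imageE)
    then show "y \<in> elts \<kappa>" using f'(2) unfolding ran_def by blast
  qed
qed

text \<open>The supremum \<eta> of \<open>dom C\<close> below \<beta> is a limit of
  \<open>dom C\<close>, since no member below \<beta> is largest. Were \<eta> less than \<beta>,
  closedness would put it into \<open>dom C\<close>, and a member beyond it would contradict its
  choice. The point \<delta> makes \<eta> nonzero.\<close>

lemma no_pred_unbounded:
  assumes \<alpha>: "\<alpha> \<in> acc_pts (elts \<kappa>)" "C \<in> \<C> \<alpha>" and \<beta>: "\<beta> \<in> elts \<alpha>" and \<delta>: "\<delta> \<in> dom C" "\<delta> \<in> elts \<beta>"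
    and no_pred: "\<nexists>\<gamma>. is_pred (dom C) \<gamma> \<beta>" and \<xi>: "\<xi> \<in> elts \<beta>"
  shows "\<exists>\<zeta>\<in>dom C \<inter> elts \<beta>. \<xi> \<in> elts \<zeta>"
proof -
  note dC = club_funD[OF \<alpha>]
  have \<alpha>\<kappa>: "\<alpha> \<in> elts \<kappa>" using \<alpha>(1) acc_kappa_iff by blast
  have \<beta>\<kappa>: "\<beta> \<in> elts \<kappa>" using \<beta> below_trans[OF \<alpha>\<kappa>] by blast
  define \<eta> where "\<eta> = osup (dom C \<inter> elts \<beta>)"
  have sub: "dom C \<inter> elts \<beta> \<subseteq> elts \<beta>" by blast
  have \<eta>: "elts \<eta> = \<Union> (elts ` (dom C \<inter> elts \<beta>))" "Ord \<eta>"
    unfolding \<eta>_def by (rule elts_osup[OF Ord_below[OF \<beta>\<kappa>] sub], rule Ord_osup[OF Ord_below[OF \<beta>\<kappa>] sub])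
  have up: "\<exists>\<zeta>'\<in>dom C \<inter> elts \<beta>. \<zeta> \<in> elts \<zeta>'" if "\<zeta> \<in> dom C \<inter> elts \<beta>" for \<zeta>
    using no_pred that unfolding is_pred_def by blast
  have "elts \<eta> \<subseteq> elts \<beta>" unfolding \<eta>(1) using Ord_mem_subset[OF Ord_below[OF \<beta>\<kappa>]] by blast
  then consider "\<eta> = \<beta>" | "\<eta> \<in> elts \<beta>" using Ord_subset_iff[OF \<eta>(2) Ord_below[OF \<beta>\<kappa>]] by blast
  then show ?thesis
  proof cases
    case 1
    then show ?thesis using \<xi> \<eta>(1) by blast
  next
    case 2
    have "\<delta> \<in> elts \<eta>" using up[of \<delta>] \<delta> \<eta>(1) by blast
    then have "\<eta> \<noteq> ozero" by auto
    moreover have "\<eta> \<in> elts \<alpha>" using 2 \<beta> Ord_mem_trans[OF Ord_below[OF \<alpha>\<kappa>]] by blast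
    moreover have "\<exists>\<gamma>\<in>dom C \<inter> elts \<eta>. \<xi> \<in> elts \<gamma>" if \<xi>: "\<xi> \<in> elts \<eta>" for \<xi>
    proof -
      obtain \<zeta> where \<zeta>: "\<zeta> \<in> dom C \<inter> elts \<beta>" "\<xi> \<in> elts \<zeta>" using \<xi> \<eta>(1) by blast
      then have "\<zeta> \<in> elts \<eta>" using up[OF \<zeta>(1)] \<eta>(1) by blast
      then show ?thesis using \<zeta> by blast
    qed
    ultimately have "\<eta> \<in> dom C" using dC(3)[of \<eta>] by blast
    then obtain \<zeta> where \<zeta>: "\<zeta> \<in> dom C \<inter> elts \<beta>" "\<eta> \<in> elts \<zeta>" using up[of \<eta>] 2 by blast
    then have "\<eta> \<in> elts \<eta>" unfolding \<eta>(1) by blast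
    then show ?thesis using mem_not_refl by blast
  qed
qed

text \<open>The critical case is a limit point \<beta> of \<open>dom C\<close>, where the union must
  be a node. For cofinality below \<chi> every branch is one. Otherwise coherence provides D in \<C>
  \<beta> that is an initial segment of C, and the canonical branch along D from the same x is this
  very union.\<close>

lemma branch_at_props:
  assumes \<alpha>: "\<alpha> \<in> acc_pts (elts \<kappa>)" "C \<in> \<C> \<alpha>" and good_level: "\<forall>\<beta>\<in>elts \<alpha>. good_level \<beta>"
    and \<delta>: "\<delta> \<in> dom C" "x \<in> lev \<delta>"
    and \<beta>: "\<beta> \<in> dom C" "elts \<delta> \<subseteq> elts \<beta>"
  shows "branch_at lev C \<beta> x \<in> lev \<beta> \<and>
    (\<forall>\<gamma>\<in>dom C. elts \<delta> \<subseteq> elts \<gamma> \<and> elts \<gamma> \<subseteq> elts \<beta> \<longrightarrow> branch_at lev C \<gamma> x \<subseteq>\<^sub>m branch_at lev C \<beta> x)"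
  using \<beta>
proof (induction \<beta> rule: hset_induct)
  case (1 \<beta>)
  note dC = club_funD[OF \<alpha>]
  have \<alpha>\<kappa>: "\<alpha> \<in> elts \<kappa>" using \<alpha>(1) acc_kappa_iff by blast
  have d\<kappa>: "dom C \<subseteq> elts \<kappa>" using dC(1) below_subset[OF \<alpha>\<kappa>] by blast
  have \<beta>\<alpha>: "\<beta> \<in> elts \<alpha>" and \<beta>\<kappa>: "\<beta> \<in> elts \<kappa>" and \<delta>\<kappa>: "\<delta> \<in> elts \<kappa>"
    using 1(2) \<delta>(1) dC(1) d\<kappa> by blast+
  have "good_level \<delta>" using good_level \<delta>(1) dC(1) by blast
  then have domx: "dom x = elts \<delta>" using \<delta>(2) by (rule goodD(1))
  have IH: "branch_at lev C \<gamma> x \<in> lev \<gamma>"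
    "\<And>\<gamma>'. \<gamma>' \<in> dom C \<Longrightarrow> elts \<delta> \<subseteq> elts \<gamma>' \<Longrightarrow> elts \<gamma>' \<subseteq> elts \<gamma> \<Longrightarrow> branch_at lev C \<gamma>' x \<subseteq>\<^sub>m branch_at lev C \<gamma> x"
    if "\<gamma> \<in> elts \<beta>" "\<gamma> \<in> dom C" "elts \<delta> \<subseteq> elts \<gamma>" for \<gamma>
    using 1(1)[OF that] by blast+
  have refl_case: "\<gamma> \<in> elts \<beta> \<or> \<gamma> = \<beta>" if "\<gamma> \<in> dom C" "elts \<gamma> \<subseteq> elts \<beta>" for \<gamma>
    using below_subset_iff[of \<gamma> \<beta>] that d\<kappa> \<beta>\<kappa> by blast
  consider (start) "\<beta> = \<delta>" | (succ) \<gamma>\<^sub>0 where "\<delta> \<in> elts \<beta>" "is_pred (dom C) \<gamma>\<^sub>0 \<beta>"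
    | (limit) "\<delta> \<in> elts \<beta>" "\<nexists>\<gamma>. is_pred (dom C) \<gamma> \<beta>"
    using below_subset_iff[OF \<delta>\<kappa> \<beta>\<kappa>] 1(3) by blast
  then show ?case
  proof cases
    case start
    then have "branch_at lev C \<beta> x = x" using domx by (simp add: branch_at_start)
    moreover have "\<gamma> = \<beta>" if "elts \<delta> \<subseteq> elts \<gamma> \<and> elts \<gamma> \<subseteq> elts \<beta>" for \<gamma>
      using that start by (metis elts_inject subset_antisym)
    ultimately show ?thesis using \<delta>(2) start by (metis map_le_refl)
  next
    case succ
    have \<gamma>\<^sub>0: "\<gamma>\<^sub>0 \<in> dom C" "\<gamma>\<^sub>0 \<in> elts \<beta>" "\<And>\<zeta>. \<zeta> \<in> dom C \<Longrightarrow> \<zeta> \<in> elts \<beta> \<Longrightarrow> elts \<zeta> \<subseteq> elts \<gamma>\<^sub>0"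
      using succ(2) below_not_mem_iff[of \<gamma>\<^sub>0] d\<kappa> unfolding is_pred_def by blast+
    have \<delta>\<gamma>: "elts \<delta> \<subseteq> elts \<gamma>\<^sub>0" using \<gamma>\<^sub>0(3) \<delta>(1) succ(1) by blast
    note IH0 = IH[OF \<gamma>\<^sub>0(2,1) \<delta>\<gamma>]
    obtain t where "t \<in> lev \<beta>" "branch_at lev C \<gamma>\<^sub>0 x \<subseteq>\<^sub>m t"
      using good_extend[OF bspec[OF good_level \<beta>\<alpha>] \<gamma>\<^sub>0(2) IH0(1)] by blast
    then have e: "ext_node lev C \<beta> (branch_at lev C \<gamma>\<^sub>0) x \<in> lev \<beta>"
      "branch_at lev C \<gamma>\<^sub>0 x \<subseteq>\<^sub>m ext_node lev C \<beta> (branch_at lev C \<gamma>\<^sub>0) x"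
      using ext_node_in[of t lev \<beta> "branch_at lev C \<gamma>\<^sub>0" x C] by blast+
    have "dom x \<noteq> elts \<beta>" using domx succ(1) elts_inject mem_not_refl by metis
    then have b: "branch_at lev C \<beta> x = ext_node lev C \<beta> (branch_at lev C \<gamma>\<^sub>0) x" by (rule branch_at_succ[OF d\<kappa> succ(2)])
    have "branch_at lev C \<gamma> x \<subseteq>\<^sub>m branch_at lev C \<beta> x"
      if \<gamma>: "\<gamma> \<in> dom C" "elts \<delta> \<subseteq> elts \<gamma>" "elts \<gamma> \<subseteq> elts \<beta>" for \<gamma>
    proof (cases "\<gamma> = \<beta>")
      case False
      then have "elts \<gamma> \<subseteq> elts \<gamma>\<^sub>0" using refl_case[OF \<gamma>(1,3)] \<gamma>\<^sub>0(3) \<gamma>(1) by blast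
      then have "branch_at lev C \<gamma> x \<subseteq>\<^sub>m branch_at lev C \<gamma>\<^sub>0 x" by (rule IH0(2)[OF \<gamma>(1,2)])
      then show ?thesis using e(2) unfolding b by (rule map_le_trans)
    qed simp
    then show ?thesis using e(1) b by simp
  next
    case limit
    let ?E = "{\<gamma> \<in> dom C \<inter> elts \<beta>. dom x \<subseteq> elts \<gamma>}"
    let ?t = "map_Union ((\<lambda>\<gamma>. branch_at lev C \<gamma> x) ` ?E)"
    have "dom x \<noteq> elts \<beta>" using domx limit(1) elts_inject mem_not_refl by metis
    then have b: "branch_at lev C \<beta> x = ?t" using limit(2) by (rule branch_at_limit)
    note unb = no_pred_unbounded[OF \<alpha> \<beta>\<alpha> \<delta>(1) limit]
    \<comment> \<open>Points of \<open>dom C\<close> below \<delta> carry no part of the branch; an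
      ordinal below such a point is below \<delta>, which itself belongs to the index set.\<close>
    have unbE: "\<exists>\<gamma>\<in>?E. \<xi> \<in> elts \<gamma>" if \<xi>: "\<xi> \<in> elts \<beta>" for \<xi>
    proof -
      obtain \<zeta> where \<zeta>: "\<zeta> \<in> dom C \<inter> elts \<beta>" "\<xi> \<in> elts \<zeta>" using unb[OF \<xi>] by blast
      show ?thesis
      proof (cases "elts \<delta> \<subseteq> elts \<zeta>")
        case True
        then show ?thesis using \<zeta> domx by blast
      next
        case False
        then have "\<zeta> \<in> elts \<delta>" using below_not_mem_iff[of \<zeta> \<delta>] \<zeta>(1) d\<kappa> \<delta>\<kappa> by blast
        then have "\<xi> \<in> elts \<delta>" using Ord_mem_trans[OF Ord_below[OF \<delta>\<kappa>]] \<zeta>(2) by blast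
        then show ?thesis using \<delta>(1) limit(1) domx by blast
      qed
    qed
    then have unbE: "\<forall>\<xi>\<in>elts \<beta>. \<exists>\<gamma>\<in>?E. \<xi> \<in> elts \<gamma>" by blast
    have good': "\<forall>\<gamma>\<in>elts \<beta>. good_level \<gamma>"
      using good_level Ord_mem_trans[OF Ord_below[OF \<alpha>\<kappa>] \<beta>\<alpha>] by blast
    have E1: "\<forall>\<gamma>\<in>?E. branch_at lev C \<gamma> x \<in> lev \<gamma>" using IH(1) domx by simp
    have E2: "\<forall>\<gamma>\<in>?E. \<forall>\<gamma>'\<in>?E. elts \<gamma> \<subseteq> elts \<gamma>' \<longrightarrow> branch_at lev C \<gamma> x \<subseteq>\<^sub>m branch_at lev C \<gamma>' x"
      using IH(2) domx by simp
    have "?E \<subseteq> elts \<beta>" by blast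
    note u = union_branch[where f = "\<lambda>\<gamma>. branch_at lev C \<gamma> x" and E = ?E, OF \<beta>\<kappa> good' this unbE E1 E2]
    have t1: "dom ?t = elts \<beta>" by (rule u(1))
    have t2: "?t |` elts \<xi> \<in> lev \<xi>" if "\<xi> \<in> elts \<beta>" for \<xi> using that by (rule u(2))
    have t3: "branch_at lev C \<gamma> x \<subseteq>\<^sub>m ?t" if "\<gamma> \<in> ?E" for \<gamma> using that by (rule u(3))
    have acc: "\<beta> \<in> acc_pts (elts \<kappa>)"
      unfolding acc_kappa_iff using \<beta>\<kappa> limit(1) unb by auto
    have "?t \<in> lev \<beta>"
    proof (cases "cofin \<beta> \<in> elts \<chi>")
      case True
      then show ?thesis unfolding lev_limit[OF acc True] using t1 t2 by blast
    next
      case False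
      have "osup (dom C \<inter> elts \<beta>) = \<beta>"
        by (subst osup_eq_iff[OF Ord_below[OF \<beta>\<kappa>]]) (use unb in auto)
      then have "\<beta> \<in> acc_pts (dom C)" unfolding acc_pts_def using 1(2) limit(1) by auto
      then obtain D where D: "D \<in> \<C> \<beta>" "sqsub \<chi> D C" using clubs[OF \<alpha>(1)] \<alpha>(2) by blast
      have "sup_dom D = \<beta>" using clubs[OF acc] D(1) by blast
      \<comment> \<open>The cofinality of \<beta> excludes the second alternative of
        \<open>sqsub\<close>.\<close>
      then have DC: "D = C |` elts \<beta>" using D(2) False unfolding sqsub_def by simp
      have dD: "dom D = dom C \<inter> elts \<beta>" unfolding DC by simp
      have "branch_at lev D \<gamma> = branch_at lev C \<gamma>" if "\<gamma> \<in> dom C \<inter> elts \<beta>" for \<gamma>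
      proof (rule branch_at_cong)
        show "Ord \<gamma>" using that d\<kappa> Ord_below by blast
        show "D \<xi> = C \<xi>" if "\<xi> = \<gamma> \<or> \<xi> \<in> elts \<gamma>" for \<xi>
        proof -
          have "\<xi> \<in> elts \<beta>" using that \<open>\<gamma> \<in> dom C \<inter> elts \<beta>\<close> Ord_mem_trans[OF Ord_below[OF \<beta>\<kappa>]] by blast
          then show ?thesis unfolding DC by simp
        qed
      qed simp
      then have "branch_limit lev D x = ?t"
        unfolding branch_limit_def dD by (intro arg_cong[where f = map_Union] image_cong) auto
      moreover have "\<delta> \<in> dom D" using dD \<delta>(1) limit(1) by blast
      ultimately show ?thesis
        using lim_in_lev[OF E_geI[OF \<beta>\<kappa> False] D(1) _ \<delta>(2)] by simp
    qed
    moreover have "branch_at lev C \<gamma> x \<subseteq>\<^sub>m ?t"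
      if \<gamma>: "\<gamma> \<in> dom C" "elts \<delta> \<subseteq> elts \<gamma>" "elts \<gamma> \<subseteq> elts \<beta>" for \<gamma>
    proof (cases "\<gamma> = \<beta>")
      case True
      then show ?thesis using b by simp
    next
      case False
      then have "\<gamma> \<in> ?E" using refl_case[OF \<gamma>(1,3)] \<gamma> domx by blast
      then show ?thesis by (rule t3)
    qed
    ultimately show ?thesis unfolding b by blast
  qed
qed

lemma lim_props:
  assumes \<alpha>: "\<alpha> \<in> acc_pts (elts \<kappa>)" "C \<in> \<C> \<alpha>" and good_level: "\<forall>\<beta>\<in>elts \<alpha>. good_level \<beta>"
    and \<delta>: "\<delta> \<in> dom C" "x \<in> lev \<delta>"
  shows "dom (branch_limit lev C x) = elts \<alpha>" "\<And>\<xi>. \<xi> \<in> elts \<alpha> \<Longrightarrow> branch_limit lev C x |` elts \<xi> \<in> lev \<xi>"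
    "\<And>\<gamma>. \<gamma> \<in> dom C \<Longrightarrow> elts \<delta> \<subseteq> elts \<gamma> \<Longrightarrow> branch_at lev C \<gamma> x \<subseteq>\<^sub>m branch_limit lev C x"
    "x \<subseteq>\<^sub>m branch_limit lev C x" "ran (branch_limit lev C x) \<subseteq> elts \<kappa>"
proof -
  note dC = club_funD[OF \<alpha>] and branch_at = branch_at_props[OF \<alpha> good_level \<delta>]
  have \<alpha>\<kappa>: "\<alpha> \<in> elts \<kappa>" using \<alpha>(1) acc_kappa_iff by blast
  have d\<kappa>: "dom C \<subseteq> elts \<kappa>" using dC(1) below_subset[OF \<alpha>\<kappa>] by blast
  have \<delta>\<kappa>: "\<delta> \<in> elts \<kappa>" using \<delta>(1) d\<kappa> by blast
  have "good_level \<delta>" using good_level \<delta>(1) dC(1) by blast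
  then have domx: "dom x = elts \<delta>" using \<delta>(2) by (rule goodD(1))
  let ?E = "{\<gamma> \<in> dom C. dom x \<subseteq> elts \<gamma>}"
  have unbE: "\<exists>\<gamma>\<in>?E. \<xi> \<in> elts \<gamma>" if \<xi>: "\<xi> \<in> elts \<alpha>" for \<xi>
  proof -
    obtain \<zeta> where \<zeta>: "\<zeta> \<in> dom C" "\<xi> \<in> elts \<zeta>" using dC(2)[OF \<xi>] by blast
    show ?thesis
    proof (cases "elts \<delta> \<subseteq> elts \<zeta>")
      case True
      then show ?thesis using \<zeta> domx by blast
    next
      case False
      then have "\<zeta> \<in> elts \<delta>" using below_not_mem_iff[of \<zeta> \<delta>] \<zeta>(1) d\<kappa> \<delta>\<kappa> by blast
      then have "\<xi> \<in> elts \<delta>" using Ord_mem_trans[OF Ord_below[OF \<delta>\<kappa>]] \<zeta>(2) by blast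
      then show ?thesis using \<delta>(1) domx by blast
    qed
  qed
  then have unbE: "\<forall>\<xi>\<in>elts \<alpha>. \<exists>\<gamma>\<in>?E. \<xi> \<in> elts \<gamma>" by blast
  have E1: "\<forall>\<gamma>\<in>?E. branch_at lev C \<gamma> x \<in> lev \<gamma>" using branch_at domx by simp
  have E2: "\<forall>\<gamma>\<in>?E. \<forall>\<gamma>'\<in>?E. elts \<gamma> \<subseteq> elts \<gamma>' \<longrightarrow> branch_at lev C \<gamma> x \<subseteq>\<^sub>m branch_at lev C \<gamma>' x"
    using branch_at domx by simp
  have "?E \<subseteq> elts \<alpha>" using dC(1) by blast
  note u = union_branch[where f = "\<lambda>\<gamma>. branch_at lev C \<gamma> x" and E = ?E, OF \<alpha>\<kappa> good_level this unbE E1 E2]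
  show "dom (branch_limit lev C x) = elts \<alpha>" unfolding branch_limit_def by (rule u(1))
  show "branch_limit lev C x |` elts \<xi> \<in> lev \<xi>" if "\<xi> \<in> elts \<alpha>" for \<xi>
    unfolding branch_limit_def using that by (rule u(2))
  show le: "branch_at lev C \<gamma> x \<subseteq>\<^sub>m branch_limit lev C x" if "\<gamma> \<in> dom C" "elts \<delta> \<subseteq> elts \<gamma>" for \<gamma>
    unfolding branch_limit_def using that domx by (intro u(3)) auto
  show "x \<subseteq>\<^sub>m branch_limit lev C x" using le[OF \<delta>(1) order_refl] domx by (simp add: branch_at_start)
  show "ran (branch_limit lev C x) \<subseteq> elts \<kappa>" unfolding branch_limit_def by (rule u(4))
qed

lemma good_zero: "good_level ozero"
  unfolding good_level_def lev_zero by (simp add: small_countable)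

lemma good_succ:
  assumes \<beta>: "\<beta> \<in> elts \<kappa>" and good_level: "good_level \<beta>"
  shows "good_level (osucc \<beta>)"
proof -
  let ?I = "elts omega \<union> elts \<beta> \<union> elts \<sigma>"
  have I: "?I \<subseteq> elts \<kappa>" using omega_subset below_subset[OF \<beta>] below_subset[OF sigma_below] by blast
  have restr: "t(\<beta> \<mapsto> i) |` elts \<gamma> = t |` elts \<gamma>" if "\<gamma> = \<beta> \<or> \<gamma> \<in> elts \<beta>" for t :: "'k hfun" and i \<gamma>
  proof -
    have "\<beta> \<notin> elts \<gamma>" using that mem_not_refl mem_not_sym by metis
    then show ?thesis by (intro ext) (auto simp: restrict_map_def)
  qed
  have "dom u = elts (osucc \<beta>) \<and> ran u \<subseteq> elts \<kappa> \<and> (\<forall>\<gamma>\<in>elts (osucc \<beta>). u |` elts \<gamma> \<in> lev \<gamma>)"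
    if u: "u \<in> lev (osucc \<beta>)" for u
  proof -
    obtain t i where t: "u = t(\<beta> \<mapsto> i)" "t \<in> lev \<beta>" "i \<in> ?I" using u unfolding lev_succ[OF \<beta>] by blast
    note gt = goodD[OF good_level t(2)]
    have "dom u = elts (osucc \<beta>)" using gt(1) t(1) by (simp add: elts_osucc[OF \<beta>])
    moreover have "ran u \<subseteq> insert i (ran t)" unfolding t(1) by (auto simp: ran_def split: if_splits)
    then have "ran u \<subseteq> elts \<kappa>" using gt(2) t(3) I by blast
    moreover have "u |` elts \<gamma> \<in> lev \<gamma>" if "\<gamma> \<in> elts (osucc \<beta>)" for \<gamma>
    proof -
      have \<gamma>: "\<gamma> = \<beta> \<or> \<gamma> \<in> elts \<beta>" using that by (simp add: elts_osucc[OF \<beta>])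
      have "t |` elts \<beta> = t" using map_le_eq_restrict[OF map_le_refl gt(1)] by simp
      then show ?thesis using \<gamma> restr[OF \<gamma>] gt(3) t(1,2) by metis
    qed
    ultimately show ?thesis by blast
  qed
  moreover have "\<exists>u\<in>lev (osucc \<beta>). s \<subseteq>\<^sub>m u" if \<gamma>: "\<gamma> \<in> elts (osucc \<beta>)" "s \<in> lev \<gamma>" for \<gamma> s
  proof -
    have "\<exists>t\<in>lev \<beta>. s \<subseteq>\<^sub>m t"
    proof (cases "\<gamma> = \<beta>")
      case True
      then show ?thesis using \<gamma>(2) map_le_refl by blast
    next
      case False
      then have "\<gamma> \<in> elts \<beta>" using \<gamma>(1) by (simp add: elts_osucc[OF \<beta>])
      then show ?thesis using good_extend[OF good_level] \<gamma>(2) by blast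
    qed
    then obtain t where t: "t \<in> lev \<beta>" "s \<subseteq>\<^sub>m t" by blast
    have "\<beta> \<notin> dom t" using goodD(1)[OF good_level t(1)] mem_not_refl by simp
    then have "t \<subseteq>\<^sub>m t(\<beta> \<mapsto> ozero)" unfolding map_le_def by auto
    then have "s \<subseteq>\<^sub>m t(\<beta> \<mapsto> ozero)" using t(2) map_le_trans by blast
    moreover have "t(\<beta> \<mapsto> ozero) \<in> lev (osucc \<beta>)"
      unfolding lev_succ[OF \<beta>] using t(1) zero_in_omega by blast
    ultimately show ?thesis by blast
  qed
  moreover have "small (lev (osucc \<beta>))"
  proof (rule small_subset)
    have "small ?I"
      by (intro small_Un small_countable[OF countable_omega] small_elts \<beta> sigma_below)
    then show "small ((\<lambda>(t, i). t(\<beta> \<mapsto> i)) ` (lev \<beta> \<times> ?I))"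
      by (intro small_image small_Times good_small[OF good_level])
    show "lev (osucc \<beta>) \<subseteq> (\<lambda>(t, i). t(\<beta> \<mapsto> i)) ` (lev \<beta> \<times> ?I)"
      unfolding lev_succ[OF \<beta>] by auto
  qed
  ultimately show ?thesis unfolding good_level_def by blast
qed

lemma good_limit:
  assumes acc: "\<alpha> \<in> acc_pts (elts \<kappa>)" and good_level: "\<forall>\<beta>\<in>elts \<alpha>. good_level \<beta>"
  shows "good_level \<alpha>"
proof -
  have \<alpha>: "\<alpha> \<in> elts \<kappa>" and unb: "\<And>\<xi>. \<xi> \<in> elts \<alpha> \<Longrightarrow> \<exists>\<eta>\<in>elts \<alpha>. \<xi> \<in> elts \<eta>"
    using acc unfolding acc_kappa_iff by blast+
  have lim_in: "branch_limit lev C x \<in> lev \<alpha>" if x: "C \<in> \<C> \<alpha>" "\<delta> \<in> dom C" "x \<in> lev \<delta>" for C \<delta> x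
  proof (cases "cofin \<alpha> \<in> elts \<chi>")
    case True
    show ?thesis unfolding lev_limit[OF acc True]
      using lim_props(1,2)[OF acc x(1) good_level x(2,3)] by blast
  next
    case False
    show ?thesis by (rule lim_in_lev[OF E_geI[OF \<alpha> False] x])
  qed
  have small_below: "small (\<Union>\<beta>\<in>elts \<alpha>. lev \<beta>)"
    by (rule small_UN[OF small_elts[OF \<alpha>]]) (use good_level good_small in blast)
  have "dom u = elts \<alpha> \<and> ran u \<subseteq> elts \<kappa> \<and> (\<forall>\<gamma>\<in>elts \<alpha>. u |` elts \<gamma> \<in> lev \<gamma>)"
    if u: "u \<in> lev \<alpha>" for u
  proof (cases "cofin \<alpha> \<in> elts \<chi>")
    case True
    then have u': "dom u = elts \<alpha>" "\<forall>\<gamma>\<in>elts \<alpha>. u |` elts \<gamma> \<in> lev \<gamma>"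
      using u unfolding lev_limit[OF acc True] by blast+
    have "ran u \<subseteq> elts \<kappa>"
    proof
      fix y assume "y \<in> ran u"
      then obtain i where i: "u i = Some y" unfolding ran_def by blast
      then have "i \<in> elts \<alpha>" using u'(1) by blast
      then obtain \<eta> where \<eta>: "\<eta> \<in> elts \<alpha>" "i \<in> elts \<eta>" using unb by blast
      have "(u |` elts \<eta>) i = Some y" using i \<eta>(2) by simp
      then have "y \<in> ran (u |` elts \<eta>)" by (rule ranI)
      then show "y \<in> elts \<kappa>" using goodD(2) good_level u'(2) \<eta>(1) by blast
    qed
    then show ?thesis using u' by blast
  next
    case False
    then obtain C x \<delta> where C: "u = branch_limit lev C x" "C \<in> \<C> \<alpha>" "\<delta> \<in> dom C" "x \<in> lev \<delta>"
      using u unfolding lev_E_ge[OF E_geI[OF \<alpha> False]] by blast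
    show ?thesis unfolding C(1) using lim_props(1,2,5)[OF acc C(2) good_level C(3,4)] by blast
  qed
  moreover have "\<exists>t\<in>lev \<alpha>. s \<subseteq>\<^sub>m t" if s: "\<beta> \<in> elts \<alpha>" "s \<in> lev \<beta>" for \<beta> s
  proof -
    obtain C where C: "C \<in> \<C> \<alpha>" using clubs[OF acc] by blast
    \<comment> \<open>Canonical branches start on levels in \<open>dom C\<close>, so s is lifted to
      such a level before a branch is taken.\<close>
    obtain \<delta> where \<delta>: "\<delta> \<in> dom C" "\<beta> \<in> elts \<delta>" using club_funD(2)[OF acc C s(1)] by blast
    have "good_level \<delta>" using good_level club_funD(1)[OF acc C] \<delta>(1) by blast
    then obtain x where x: "x \<in> lev \<delta>" "s \<subseteq>\<^sub>m x" using good_extend \<delta>(2) s(2) by blast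
    have "s \<subseteq>\<^sub>m branch_limit lev C x" using x(2) lim_props(4)[OF acc C good_level \<delta>(1) x(1)] by (rule map_le_trans)
    then show ?thesis using lim_in[OF C \<delta>(1) x(1)] by blast
  qed
  moreover have "small (lev \<alpha>)"
  proof (cases "cofin \<alpha> \<in> elts \<chi>")
    case True
    obtain f where f: "f ` elts (cofin \<alpha>) \<subseteq> elts \<alpha>"
      "\<forall>\<xi>\<in>elts \<alpha>. \<exists>\<eta>\<in>elts (cofin \<alpha>). \<xi> = f \<eta> \<or> \<xi> \<in> elts (f \<eta>)"
      using cofin_props(2)[OF Ord_below[OF \<alpha>]] unfolding cofinal_length_def by blast
    \<comment> \<open>A branch is determined by its restrictions along a cofinal sequence of length
      \<open>cofin \<alpha>\<close>, that is, by fewer than \<chi> nodes from below;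
      (<\<chi>)-closedness bounds the number of such sequences.\<close>
    define g where "g t = (\<lambda>\<eta>. if \<eta> \<in> elts (cofin \<alpha>) then Some (t |` elts (f \<eta>)) else None)"
      for t :: "'k hfun"
    show ?thesis
    proof (rule small_inj)
      show "small (seqs (\<Union>\<beta>\<in>elts \<alpha>. lev \<beta>))" by (rule small_seqs[OF small_below])
      show "inj_on g (lev \<alpha>)"
      proof (intro inj_onI ext)
        fix s t i assume st: "s \<in> lev \<alpha>" "t \<in> lev \<alpha>" "g s = g t"
        show "s i = t i"
        proof (cases "i \<in> elts \<alpha>")
          case True
          then obtain \<xi> where \<xi>: "\<xi> \<in> elts \<alpha>" "i \<in> elts \<xi>" using unb by blast
          then obtain \<eta> where \<eta>: "\<eta> \<in> elts (cofin \<alpha>)" "\<xi> = f \<eta> \<or> \<xi> \<in> elts (f \<eta>)" using f(2) by blast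
          have "Ord (f \<eta>)" using f(1) \<eta>(1) below_trans[OF \<alpha>] Ord_below by blast
          then have i: "i \<in> elts (f \<eta>)" using \<eta>(2) \<xi>(2) Ord_mem_trans by blast
          have "s |` elts (f \<eta>) = t |` elts (f \<eta>)" using fun_cong[OF st(3), of \<eta>] \<eta>(1) by (simp add: g_def)
          then have "(s |` elts (f \<eta>)) i = (t |` elts (f \<eta>)) i" by simp
          then show ?thesis using i by simp
        next
          case False
          moreover have "dom s = elts \<alpha>" "dom t = elts \<alpha>"
            using st(1,2) unfolding lev_limit[OF acc \<open>cofin \<alpha> \<in> elts \<chi>\<close>] by blast+
          ultimately show ?thesis by (metis domIff)
        qed
      qed
      show "g ` lev \<alpha> \<subseteq> seqs (\<Union>\<beta>\<in>elts \<alpha>. lev \<beta>)"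
      proof (rule image_subsetI)
        fix t assume "t \<in> lev \<alpha>"
        then have t: "\<forall>\<beta>\<in>elts \<alpha>. t |` elts \<beta> \<in> lev \<beta>" unfolding lev_limit[OF acc True] by blast
        have "dom (g t) = elts (cofin \<alpha>)" by (auto simp: g_def split: if_splits)
        moreover have "ran (g t) \<subseteq> (\<Union>\<beta>\<in>elts \<alpha>. lev \<beta>)"
        proof
          fix y assume "y \<in> ran (g t)"
          then obtain \<eta> where "g t \<eta> = Some y" unfolding ran_def by blast
          then have "\<eta> \<in> elts (cofin \<alpha>)" "y = t |` elts (f \<eta>)" by (auto simp: g_def split: if_splits)
          then show "y \<in> (\<Union>\<beta>\<in>elts \<alpha>. lev \<beta>)" using t f(1) by blast
        qed
        ultimately show "g t \<in> seqs (\<Union>\<beta>\<in>elts \<alpha>. lev \<beta>)" unfolding seqs_def using True by blast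
      qed
    qed
  next
    case False
    show ?thesis
    proof (rule small_subset)
      \<comment> \<open>Here a node is determined by a member of \<C> \<alpha> and a starting node,
        and \<mu> = \<kappa> makes \<C> \<alpha> small.\<close>
      have "small (\<C> \<alpha>)" using clubs[OF acc] by blast
      then show "small ((\<lambda>(C, x). branch_limit lev C x) ` (\<C> \<alpha> \<times> (\<Union>\<beta>\<in>elts \<alpha>. lev \<beta>)))"
        by (intro small_image small_Times small_below)
      show "lev \<alpha> \<subseteq> (\<lambda>(C, x). branch_limit lev C x) ` (\<C> \<alpha> \<times> (\<Union>\<beta>\<in>elts \<alpha>. lev \<beta>))"
      proof
        fix u assume "u \<in> lev \<alpha>"
        then obtain C x \<delta> where C: "u = branch_limit lev C x" "C \<in> \<C> \<alpha>" "\<delta> \<in> dom C" "x \<in> lev \<delta>"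
          unfolding lev_E_ge[OF E_geI[OF \<alpha> False]] by blast
        have "\<delta> \<in> elts \<alpha>" using club_funD(1)[OF acc C(2)] C(3) by blast
        then have "(C, x) \<in> \<C> \<alpha> \<times> (\<Union>\<beta>\<in>elts \<alpha>. lev \<beta>)" using C by blast
        then show "u \<in> (\<lambda>(C, x). branch_limit lev C x) ` (\<C> \<alpha> \<times> (\<Union>\<beta>\<in>elts \<alpha>. lev \<beta>))"
          using C(1) by (intro image_eqI[of _ _ "(C, x)"]) auto
      qed
    qed
  qed
  ultimately show ?thesis unfolding good_level_def by blast
qed

lemma good_all: "\<alpha> \<in> elts \<kappa> \<Longrightarrow> good_level \<alpha>"
proof (induction \<alpha> rule: hset_induct)
  case (1 \<alpha>)
  have IH: "\<forall>\<beta>\<in>elts \<alpha>. good_level \<beta>" using 1 below_trans by blast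
  from 1(2) show ?case
  proof (cases rule: below_cases)
    case zero
    then show ?thesis using good_zero by simp
  next
    case (succ \<beta>)
    then show ?thesis using good_succ[OF succ(1)] IH mem_osucc_self by blast
  next
    case limit
    then show ?thesis by (rule good_limit[OF _ IH])
  qed
qed

end

section \<open>Freeness\<close>

lemma map_le_iff_graph: "s \<subseteq>\<^sub>m t \<longleftrightarrow> Map.graph s \<subseteq> Map.graph t"
  by (auto simp: map_le_def graph_def dom_def)

lemma restrict_map_superset: "dom t \<subseteq> S \<Longrightarrow> t |` S = t"
proof
  fix i assume "dom t \<subseteq> S"
  then have "i \<notin> S \<Longrightarrow> t i = None" by (metis domIff subsetD)
  then show "(t |` S) i = t i" by (simp add: restrict_map_def)
qed

context proxy
begin

section \<open>Vectors of nodes and dense sets\<close>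

lemmas lev_dom = goodD(1)[OF good_all]
  and lev_ran = goodD(2)[OF good_all]
  and lev_restrict = goodD(3)[OF good_all]
  and lev_extend = good_extend[OF good_all]
  and lev_small = good_small[OF good_all]

lemma lev_extend_le:
  assumes "\<alpha> \<in> elts \<kappa>" "\<beta> \<in> elts \<kappa>" "elts \<beta> \<subseteq> elts \<alpha>" "s \<in> lev \<beta>"
  shows "\<exists>t\<in>lev \<alpha>. s \<subseteq>\<^sub>m t"
proof (cases "\<beta> = \<alpha>")
  case True
  then show ?thesis using assms(4) map_le_refl by blast
next
  case False
  then have "\<beta> \<in> elts \<alpha>" using below_subset_iff[OF assms(2,1)] assms(3) by blast
  then show ?thesis using lev_extend[OF assms(1)] assms(4) by blast
qed

lemma lev_restrict_le:
  assumes "\<alpha> \<in> elts \<kappa>" "\<beta> \<in> elts \<kappa>" "elts \<beta> \<subseteq> elts \<alpha>" "t \<in> lev \<alpha>"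
  shows "t |` elts \<beta> \<in> lev \<beta>"
proof (cases "\<beta> = \<alpha>")
  case True
  then show ?thesis using assms(4) map_le_eq_restrict[OF map_le_refl lev_dom[OF assms(1,4)]] by simp
next
  case False
  then have "\<beta> \<in> elts \<alpha>" using below_subset_iff[OF assms(2,1)] assms(3) by blast
  then show ?thesis using lev_restrict[OF assms(1,4)] by blast
qed

text \<open>From the level of s on, this is level \<alpha> of the derived tree in coordinate form:
  one node per index in place of one function on \<alpha>.\<close>

definition vecs :: "'k hset \<Rightarrow> ('k hset \<Rightarrow> 'k hfun) \<Rightarrow> 'k hset \<Rightarrow> ('k hset \<rightharpoonup> 'k hfun) set" where
  "vecs \<tau> s \<alpha> = {v. dom v = elts \<tau> \<and> (\<forall>i\<in>elts \<tau>. the (v i) \<in> lev \<alpha> \<and> s i \<subseteq>\<^sub>m the (v i))}"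

lemma vecs_subset_seqs: "\<tau> \<in> elts \<chi> \<Longrightarrow> vecs \<tau> s \<alpha> \<subseteq> seqs (lev \<alpha>)"
proof
  fix v assume \<tau>: "\<tau> \<in> elts \<chi>" and "v \<in> vecs \<tau> s \<alpha>"
  then have v: "dom v = elts \<tau>" "\<forall>i\<in>elts \<tau>. the (v i) \<in> lev \<alpha>" unfolding vecs_def by blast+
  have "ran v \<subseteq> lev \<alpha>"
  proof
    fix x assume "x \<in> ran v"
    then obtain i where i: "v i = Some x" unfolding ran_def by blast
    then have "i \<in> elts \<tau>" using v(1) by blast
    then show "x \<in> lev \<alpha>" using v(2) i by fastforce
  qed
  then show "v \<in> seqs (lev \<alpha>)" unfolding seqs_def using \<tau> v(1) by blast
qed

lemma lev_subset_nodes: "\<alpha> \<in> elts \<kappa> \<Longrightarrow> lev \<alpha> \<subseteq> nodes"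
  unfolding nodes_def using lev_dom lev_ran by blast

lemma vcode_surj:
  assumes "v \<in> seqs nodes" shows "\<exists>\<xi>\<in>elts \<kappa>. vcode \<xi> = v"
proof -
  have "v \<in> vcode ` elts \<kappa>" using assms by (simp add: vcode_image)
  then show ?thesis by (elim imageE) auto
qed

lemma seqs_mono: "X \<subseteq> Y \<Longrightarrow> seqs X \<subseteq> seqs Y"
  unfolding seqs_def by blast

text \<open>
  Given a vector \<open>y\<close> of level \<open>\<alpha>\<close>, fewer than the cofinality of \<open>\<alpha>\<close> many canonical branches are involved,
  so their starting nodes form a vector with a code \<open>\<iota>\<close> below \<open>\<alpha>\<close>; at a point \<open>\<beta>\<close> of \<open>B \<iota>\<close> that guesses
  the dense set \<open>E\<close>, the branches were jointly moved above an element of \<open>E\<close>.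
\<close>

lemma dense_captured:
  assumes \<delta>: "\<delta> \<in> elts \<kappa>" and \<tau>: "\<tau> \<in> elts \<chi>" and inj: "inj_on s (elts \<tau>)" and s: "s ` elts \<tau> \<subseteq> lev \<delta>"
    and dense: "\<And>\<gamma> z. \<gamma> \<in> elts \<kappa> \<Longrightarrow> elts \<delta> \<subseteq> elts \<gamma> \<Longrightarrow> z \<in> vecs \<tau> s \<gamma> \<Longrightarrow>
      \<exists>e\<in>E. \<exists>\<nu>\<in>elts \<kappa>. e \<in> vecs \<tau> s \<nu> \<and> (\<forall>i\<in>elts \<tau>. the (z i) \<subseteq>\<^sub>m the (e i))"
  shows "\<exists>\<alpha>\<in>elts \<kappa>. elts \<delta> \<subseteq> elts \<alpha> \<and> (\<forall>y\<in>vecs \<tau> s \<alpha>. \<exists>e\<in>E. \<exists>\<beta>\<in>elts \<alpha>.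
    \<forall>i\<in>elts \<tau>. the (e i) \<subseteq>\<^sub>m the (y i) \<and> dom (the (e i)) \<subseteq> elts \<beta>)"
proof -
  \<comment> \<open>The function F arises here: for each of the fewer than \<kappa> vectors of level
    \<gamma> it bounds the code and the level of some member of E above it. Closure of \<beta> under
    F will put such a code into C \<beta>.\<close>
  have "\<exists>\<theta>\<in>elts \<kappa>. elts \<delta> \<subseteq> elts \<gamma> \<longrightarrow> (\<forall>z\<in>vecs \<tau> s \<gamma>. \<exists>\<xi>\<in>elts \<theta>. \<exists>\<nu>\<in>elts \<theta>.
      vcode \<xi> \<in> E \<and> vcode \<xi> \<in> vecs \<tau> s \<nu> \<and> (\<forall>i\<in>elts \<tau>. the (z i) \<subseteq>\<^sub>m the (vcode \<xi> i)))"
    if \<gamma>: "\<gamma> \<in> elts \<kappa>" for \<gamma>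
  proof (cases "elts \<delta> \<subseteq> elts \<gamma>")
    case True
    have "\<exists>\<xi>\<in>elts \<kappa>. \<exists>\<nu>\<in>elts \<kappa>. vcode \<xi> \<in> E \<and> vcode \<xi> \<in> vecs \<tau> s \<nu> \<and>
        (\<forall>i\<in>elts \<tau>. the (z i) \<subseteq>\<^sub>m the (vcode \<xi> i))" if z: "z \<in> vecs \<tau> s \<gamma>" for z
    proof -
      obtain e \<nu> where e: "e \<in> E" "\<nu> \<in> elts \<kappa>" "e \<in> vecs \<tau> s \<nu>" "\<forall>i\<in>elts \<tau>. the (z i) \<subseteq>\<^sub>m the (e i)"
        using dense[OF \<gamma> True z] by blast
      have "e \<in> seqs nodes"
        using e(3) vecs_subset_seqs[OF \<tau>] seqs_mono[OF lev_subset_nodes[OF e(2)]] by blast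
      from vcode_surj[OF this] obtain \<xi> where \<xi>: "\<xi> \<in> elts \<kappa>" "vcode \<xi> = e" by blast
      show ?thesis by (rule bexI[OF _ \<xi>(1)], rule bexI[OF _ e(2)]) (simp add: \<xi>(2) e)
    qed
    then obtain \<Xi> \<Lambda> where sel: "\<And>z. z \<in> vecs \<tau> s \<gamma> \<Longrightarrow> \<Xi> z \<in> elts \<kappa> \<and> \<Lambda> z \<in> elts \<kappa> \<and> vcode (\<Xi> z) \<in> E \<and>
        vcode (\<Xi> z) \<in> vecs \<tau> s (\<Lambda> z) \<and> (\<forall>i\<in>elts \<tau>. the (z i) \<subseteq>\<^sub>m the (vcode (\<Xi> z) i))"
      by metis
    have sm: "small (vecs \<tau> s \<gamma>)"
      using small_subset[OF small_seqs[OF lev_small[OF \<gamma>]] vecs_subset_seqs[OF \<tau>]] .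
    have "small (\<Xi> ` vecs \<tau> s \<gamma> \<union> \<Lambda> ` vecs \<tau> s \<gamma>)" by (intro small_Un small_image sm)
    moreover have "\<Xi> ` vecs \<tau> s \<gamma> \<union> \<Lambda> ` vecs \<tau> s \<gamma> \<subseteq> elts \<kappa>" using sel by blast
    ultimately obtain \<theta> where \<theta>: "\<theta> \<in> elts \<kappa>" "\<Xi> ` vecs \<tau> s \<gamma> \<union> \<Lambda> ` vecs \<tau> s \<gamma> \<subseteq> elts \<theta>"
      by (rule small_bounded)
    have "\<exists>\<xi>\<in>elts \<theta>. \<exists>\<nu>\<in>elts \<theta>. vcode \<xi> \<in> E \<and> vcode \<xi> \<in> vecs \<tau> s \<nu> \<and>
        (\<forall>i\<in>elts \<tau>. the (z i) \<subseteq>\<^sub>m the (vcode \<xi> i))" if z: "z \<in> vecs \<tau> s \<gamma>" for z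
    proof -
      have "\<Xi> z \<in> elts \<theta>" "\<Lambda> z \<in> elts \<theta>" using \<theta>(2) z by blast+
      then show ?thesis using sel[OF z] by (intro bexI[of _ "\<Xi> z"] bexI[of _ "\<Lambda> z"]) simp_all
    qed
    then show ?thesis using \<theta>(1) by blast
  qed (use \<gamma> in blast)
  then obtain F where F: "\<And>\<gamma>. \<gamma> \<in> elts \<kappa> \<Longrightarrow> F \<gamma> \<in> elts \<kappa>"
    "\<And>\<gamma> z. \<gamma> \<in> elts \<kappa> \<Longrightarrow> elts \<delta> \<subseteq> elts \<gamma> \<Longrightarrow> z \<in> vecs \<tau> s \<gamma> \<Longrightarrow> \<exists>\<xi>\<in>elts (F \<gamma>). \<exists>\<nu>\<in>elts (F \<gamma>).
      vcode \<xi> \<in> E \<and> vcode \<xi> \<in> vecs \<tau> s \<nu> \<and> (\<forall>i\<in>elts \<tau>. the (z i) \<subseteq>\<^sub>m the (vcode \<xi> i))"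
    by metis
  \<comment> \<open>The function G arises here: it bounds codes of vectors whose coordinates may sit
    on different levels below \<gamma>, as starting nodes do. Closure of \<alpha> under G keeps the
    code of a starting vector below \<alpha>.\<close>
  have "\<exists>\<theta>\<in>elts \<kappa>. \<forall>v\<in>seqs (\<Union>\<beta>\<in>elts \<gamma>. lev \<beta>). \<exists>\<iota>\<in>elts \<theta>. vcode \<iota> = v" if \<gamma>: "\<gamma> \<in> elts \<kappa>" for \<gamma>
  proof -
    let ?S = "seqs (\<Union>\<beta>\<in>elts \<gamma>. lev \<beta>)"
    have "small (\<Union>\<beta>\<in>elts \<gamma>. lev \<beta>)"
      by (rule small_UN[OF small_elts[OF \<gamma>]]) (rule lev_small[OF below_trans[OF \<gamma>]])
    then have sm: "small ?S" by (rule small_seqs)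
    have "?S \<subseteq> seqs nodes" using lev_subset_nodes below_trans[OF \<gamma>] by (intro seqs_mono) blast
    then have "\<forall>v\<in>?S. \<exists>\<iota>. \<iota> \<in> elts \<kappa> \<and> vcode \<iota> = v" using vcode_surj by blast
    then obtain c where c: "\<forall>v\<in>?S. c v \<in> elts \<kappa> \<and> vcode (c v) = v" by metis
    then have "c ` ?S \<subseteq> elts \<kappa>" by blast
    then obtain \<theta> where \<theta>: "\<theta> \<in> elts \<kappa>" "c ` ?S \<subseteq> elts \<theta>" by (rule small_bounded[OF small_image[OF sm]])
    then show ?thesis using c by blast
  qed
  then obtain G where G: "\<And>\<gamma>. \<gamma> \<in> elts \<kappa> \<Longrightarrow> G \<gamma> \<in> elts \<kappa>"
    "\<And>\<gamma> v. \<gamma> \<in> elts \<kappa> \<Longrightarrow> v \<in> seqs (\<Union>\<beta>\<in>elts \<gamma>. lev \<beta>) \<Longrightarrow> \<exists>\<iota>\<in>elts (G \<gamma>). vcode \<iota> = v"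
    by metis
  define D where "D = {\<beta> \<in> elts \<kappa>. \<delta> \<in> elts \<beta> \<and> (\<forall>\<gamma>\<in>elts \<beta>. F \<gamma> \<in> elts \<beta>)}"
  define D' where "D' = {\<beta> \<in> elts \<kappa>. \<delta> \<in> elts \<beta> \<and> (\<forall>\<gamma>\<in>elts \<beta>. G \<gamma> \<in> elts \<beta>)}"
  define \<Omega> where "\<Omega> = {\<xi> \<in> elts \<kappa>. vcode \<xi> \<in> E}"
  have "club_in D \<kappa>" unfolding D_def by (rule club_closure_points[OF F(1) \<delta>])
  moreover have "club_in D' \<kappa>" unfolding D'_def by (rule club_closure_points[OF G(1) \<delta>])
  moreover have "\<Omega> \<subseteq> elts \<kappa>" unfolding \<Omega>_def by blast
  ultimately obtain \<alpha> C where \<alpha>D: "\<alpha> \<in> D'" and \<alpha>E: "\<alpha> \<in> E_ge \<kappa> \<chi>" and C: "\<C> \<alpha> = {C}"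
    and guess: "\<forall>\<iota>\<in>elts \<alpha>. \<forall>\<xi>\<in>elts \<alpha>. \<exists>\<gamma> \<beta>. \<xi> \<in> elts \<gamma> \<and> is_next (dom C) \<gamma> \<beta> \<and> \<beta> \<in> B \<iota> \<and> \<beta> \<in> D \<and>
      elts (the (C \<beta>)) = \<Omega> \<inter> elts \<beta>"
    using guessing[of \<Omega> D D'] by blast
  have acc: "\<alpha> \<in> acc_pts (elts \<kappa>)" using \<alpha>E by (rule E_ge_subset_acc)
  have \<alpha>: "\<alpha> \<in> elts \<kappa>" "\<delta> \<in> elts \<alpha>" and \<alpha>G: "\<And>\<gamma>. \<gamma> \<in> elts \<alpha> \<Longrightarrow> G \<gamma> \<in> elts \<alpha>"
    using \<alpha>D unfolding D'_def by blast+
  note \<alpha>trans = Ord_mem_trans[OF Ord_below[OF \<alpha>(1)]]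
  have CC: "C \<in> \<C> \<alpha>" using C by blast
  note dC = club_funD[OF acc CC]
  have d\<kappa>: "dom C \<subseteq> elts \<kappa>" using dC(1) below_subset[OF \<alpha>(1)] by blast
  have goods: "\<forall>\<beta>\<in>elts \<alpha>. good_level \<beta>" using good_all below_trans[OF \<alpha>(1)] by blast
  have "\<exists>e\<in>E. \<exists>\<beta>\<in>elts \<alpha>. \<forall>i\<in>elts \<tau>. the (e i) \<subseteq>\<^sub>m the (y i) \<and> dom (the (e i)) \<subseteq> elts \<beta>"
    if y: "y \<in> vecs \<tau> s \<alpha>" for y
  proof -
    have y': "the (y i) \<in> lev \<alpha>" "s i \<subseteq>\<^sub>m the (y i)" if "i \<in> elts \<tau>" for i
      using y that unfolding vecs_def by blast+
    \<comment> \<open>All coordinates of y are canonical branches along the same C, since \<C>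
      \<alpha> is a singleton.\<close>
    have "\<exists>x \<delta>'. the (y i) = branch_limit lev C x \<and> \<delta>' \<in> dom C \<and> x \<in> lev \<delta>'" if "i \<in> elts \<tau>" for i
      using y'(1)[OF that] unfolding lev_E_ge[OF \<alpha>E] C by blast
    then obtain X \<Delta> where X: "\<And>i. i \<in> elts \<tau> \<Longrightarrow> the (y i) = branch_limit lev C (X i) \<and> \<Delta> i \<in> dom C \<and> X i \<in> lev (\<Delta> i)"
      by metis
    have domX: "dom (X i) = elts (\<Delta> i)" if "i \<in> elts \<tau>" for i
      using X[OF that] lev_dom d\<kappa> by blast
    have "\<Delta> ` elts \<tau> \<subseteq> elts \<alpha>" using X dC(1) by blast
    \<comment> \<open>The cofinality of \<alpha> is at least \<chi>, so fewer than \<chi> starting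
      levels have a common bound below \<alpha>.\<close>
    then obtain \<xi>\<^sub>0 where \<xi>\<^sub>0: "\<xi>\<^sub>0 \<in> elts \<alpha>" "\<Delta> ` elts \<tau> \<subseteq> elts \<xi>\<^sub>0" using E_ge_bounded[OF \<alpha>E \<tau>] by blast
    have \<xi>\<^sub>0\<kappa>: "\<xi>\<^sub>0 \<in> elts \<kappa>" using \<xi>\<^sub>0(1) below_trans[OF \<alpha>(1)] by blast
    define v where "v = (\<lambda>i. if i \<in> elts \<tau> then Some (X i) else None)"
    have domv: "dom v = elts \<tau>" unfolding v_def by (auto split: if_splits)
    have "ran v \<subseteq> (\<Union>\<beta>\<in>elts \<xi>\<^sub>0. lev \<beta>)"
      unfolding v_def ran_def using X \<xi>\<^sub>0(2) by (auto split: if_splits)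
    then have "v \<in> seqs (\<Union>\<beta>\<in>elts \<xi>\<^sub>0. lev \<beta>)" unfolding seqs_def using \<tau> domv by blast
    then obtain \<iota> where \<iota>: "\<iota> \<in> elts (G \<xi>\<^sub>0)" "vcode \<iota> = v" using G(2)[OF \<xi>\<^sub>0\<kappa>] by blast
    have \<iota>\<alpha>: "\<iota> \<in> elts \<alpha>" using \<alpha>trans[OF \<alpha>G[OF \<xi>\<^sub>0(1)] \<iota>(1)] .
    \<comment> \<open>Branches along C with the same start coincide, and one node above both
      \<open>s i\<close> and \<open>s j\<close> forces these to be equal. Injectivity of s thus
      passes to the starting nodes, as \<open>ext_node_absorbs\<close> demands.\<close>
    have X_inj: "i = j" if ij: "i \<in> elts \<tau>" "j \<in> elts \<tau>" "X i = X j" for i j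
    proof -
      have "the (y i) = the (y j)" using X[OF ij(1)] X[OF ij(2)] ij(3) by simp
      then have le: "s i \<subseteq>\<^sub>m the (y j)" "s j \<subseteq>\<^sub>m the (y j)" using y'(2)[OF ij(1)] y'(2)[OF ij(2)] by simp_all
      have "dom (s i) = elts \<delta>" "dom (s j) = elts \<delta>" using lev_dom[OF \<delta>] s ij by blast+
      then have "s i = s j" using map_le_eq_restrict[OF le(1)] map_le_eq_restrict[OF le(2)] by simp
      then show ?thesis using inj ij(1,2) unfolding inj_on_def by blast
    qed
    \<comment> \<open>The larger of \<delta> and the bound on the starting levels: guessing beyond
      it puts \<gamma> above all starts and above \<delta>.\<close>
    obtain \<rho> where \<rho>: "\<rho> \<in> elts \<alpha>" "elts \<delta> \<subseteq> elts \<rho>" "elts \<xi>\<^sub>0 \<subseteq> elts \<rho>"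
      using below_not_mem_iff[OF \<delta> \<xi>\<^sub>0\<kappa>] below_subset_iff[OF \<delta> \<xi>\<^sub>0\<kappa>] \<xi>\<^sub>0(1) \<alpha>(2) by blast
    obtain \<gamma> \<beta> where \<gamma>: "\<rho> \<in> elts \<gamma>" and nxt: "is_next (dom C) \<gamma> \<beta>" and \<beta>B: "\<beta> \<in> B \<iota>" and \<beta>D: "\<beta> \<in> D"
      and C\<beta>: "elts (the (C \<beta>)) = \<Omega> \<inter> elts \<beta>"
      using guess \<iota>\<alpha> \<rho>(1) by blast
    have \<gamma>\<beta>: "\<gamma> \<in> dom C" "\<beta> \<in> dom C" "\<gamma> \<in> elts \<beta>" using nxt unfolding is_next_def by blast+
    have \<kappa>s: "\<gamma> \<in> elts \<kappa>" "\<beta> \<in> elts \<kappa>" "\<beta> \<in> elts \<alpha>" using \<gamma>\<beta> d\<kappa> dC(1) by blast+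
    note \<beta>trans = Ord_mem_trans[OF Ord_below[OF \<kappa>s(2)]]
    have \<rho>\<gamma>: "elts \<rho> \<subseteq> elts \<gamma>" using Ord_mem_subset[OF Ord_below[OF \<kappa>s(1)] \<gamma>] .
    have \<gamma>\<beta>sub: "elts \<gamma> \<subseteq> elts \<beta>" using Ord_mem_subset[OF Ord_below[OF \<kappa>s(2)] \<gamma>\<beta>(3)] .
    have \<delta>\<gamma>: "elts \<delta> \<subseteq> elts \<gamma>" using \<rho>(2) \<rho>\<gamma> by blast
    have \<Delta>\<gamma>: "\<Delta> i \<in> elts \<gamma>" "elts (\<Delta> i) \<subseteq> elts \<gamma>" if "i \<in> elts \<tau>" for i
    proof -
      show *: "\<Delta> i \<in> elts \<gamma>" using \<xi>\<^sub>0(2) that \<rho>(3) \<rho>\<gamma> by blast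
      show "elts (\<Delta> i) \<subseteq> elts \<gamma>" using Ord_mem_subset[OF Ord_below[OF \<kappa>s(1)] *] .
    qed
    have pt: "part \<beta> = \<iota>" using part_eq[OF below_trans[OF \<alpha>(1) \<iota>\<alpha>] \<beta>B] .
    let ?z = "branch_at lev C \<gamma>"
    have z: "?z (X i) \<in> lev \<gamma>" "?z (X i) \<subseteq>\<^sub>m the (y i)" "s i \<subseteq>\<^sub>m ?z (X i)" if i: "i \<in> elts \<tau>" for i
    proof -
      have Xi: "the (y i) = branch_limit lev C (X i)" "\<Delta> i \<in> dom C" "X i \<in> lev (\<Delta> i)" using X[OF i] by blast+
      show 1: "?z (X i) \<in> lev \<gamma>" using branch_at_props[OF acc CC goods Xi(2,3) \<gamma>\<beta>(1) \<Delta>\<gamma>(2)[OF i]] by blast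
      show 2: "?z (X i) \<subseteq>\<^sub>m the (y i)"
        unfolding Xi(1) by (rule lim_props(3)[OF acc CC goods Xi(2,3) \<gamma>\<beta>(1) \<Delta>\<gamma>(2)[OF i]])
      have "dom (s i) = elts \<delta>" "dom (?z (X i)) = elts \<gamma>" using lev_dom[OF \<delta>] s i lev_dom[OF \<kappa>s(1) 1] by blast+
      then show "s i \<subseteq>\<^sub>m ?z (X i)" using map_le_of_common[OF y'(2)[OF i] 2] \<delta>\<gamma> by simp
    qed
    define zv where "zv = (\<lambda>i. if i \<in> elts \<tau> then Some (?z (X i)) else None)"
    \<comment> \<open>The joint position at \<gamma> is a vector above s, so density applies to it,
      and closure under F puts the code of an extension in E below \<beta>.\<close>
    have "zv \<in> vecs \<tau> s \<gamma>" unfolding vecs_def zv_def using z by (auto split: if_splits)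
    then obtain \<xi> \<nu> where \<xi>: "\<xi> \<in> elts (F \<gamma>)" "\<nu> \<in> elts (F \<gamma>)" "vcode \<xi> \<in> E" "vcode \<xi> \<in> vecs \<tau> s \<nu>"
      "\<forall>i\<in>elts \<tau>. the (zv i) \<subseteq>\<^sub>m the (vcode \<xi> i)"
      using F(2)[OF \<kappa>s(1) \<delta>\<gamma>] by blast
    have "F \<gamma> \<in> elts \<beta>" using \<beta>D \<gamma>\<beta>(3) unfolding D_def by blast
    then have \<xi>\<beta>: "\<xi> \<in> elts \<beta>" "\<nu> \<in> elts \<beta>" using \<beta>trans \<xi>(1,2) by blast+
    have "absorbs lev C \<beta> ?z v (vcode \<xi>)"
      unfolding absorbs_def
    proof (intro conjI ballI)
      have "\<xi> \<in> \<Omega> \<inter> elts \<beta>" unfolding \<Omega>_def using \<xi>\<beta>(1) \<xi>(3) below_trans[OF \<kappa>s(2)] by blast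
      then show "vcode \<xi> \<in> vcode ` elts (the (C \<beta>))" unfolding C\<beta> by (rule imageI)
      show "dom (vcode \<xi>) = dom v" using \<xi>(4) domv unfolding vecs_def by blast
      fix i assume "i \<in> dom v"
      then have i: "i \<in> elts \<tau>" using domv by blast
      have "the (vcode \<xi> i) \<in> lev \<nu>" using \<xi>(4) i unfolding vecs_def by blast
      then obtain t where t: "t \<in> lev \<beta>" "the (vcode \<xi> i) \<subseteq>\<^sub>m t" using lev_extend[OF \<kappa>s(2) \<xi>\<beta>(2)] by blast
      have "?z (X i) \<subseteq>\<^sub>m the (vcode \<xi> i)" using \<xi>(5) i unfolding zv_def by simp
      then have "?z (X i) \<subseteq>\<^sub>m t" using t(2) by (rule map_le_trans)
      moreover have "the (v i) = X i" using i unfolding v_def by simp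
      ultimately show "\<exists>t\<in>lev \<beta>. ?z (the (v i)) \<subseteq>\<^sub>m t \<and> the (vcode \<xi> i) \<subseteq>\<^sub>m t" using t by auto
    qed
    moreover have "vcode (part \<beta>) = v" using pt \<iota>(2) by simp
    ultimately obtain w where w: "absorbs lev C \<beta> ?z v w"
      "\<And>x i. v i = Some x \<Longrightarrow> (\<And>j. v j = Some x \<Longrightarrow> j = i) \<Longrightarrow> the (w i) \<subseteq>\<^sub>m ext_node lev C \<beta> ?z x"
      using ext_node_absorbs by metis
    \<comment> \<open>The vector actually chosen need not be \<open>vcode \<xi>\<close>, but every
      code in C \<beta> belongs to \<Omega> and so names a member of E.\<close>
    have "w \<in> E" using w(1) unfolding absorbs_def C\<beta> \<Omega>_def by blast
    moreover have "the (w i) \<subseteq>\<^sub>m the (y i) \<and> dom (the (w i)) \<subseteq> elts \<beta>" if i: "i \<in> elts \<tau>" for i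
    proof -
      have Xi: "the (y i) = branch_limit lev C (X i)" "\<Delta> i \<in> dom C" "X i \<in> lev (\<Delta> i)" using X[OF i] by blast+
      have \<Delta>\<beta>: "\<Delta> i \<in> elts \<beta>" "elts (\<Delta> i) \<subseteq> elts \<beta>" using \<Delta>\<gamma>[OF i] \<gamma>\<beta>sub by blast+
      have vi: "v i = Some (X i)" using i unfolding v_def by simp
      have "j = i" if "v j = Some (X i)" for j
      proof -
        have "j \<in> elts \<tau>" using that domv by blast
        then show ?thesis using that X_inj[of j i] i unfolding v_def by simp
      qed
      then have 1: "the (w i) \<subseteq>\<^sub>m ext_node lev C \<beta> ?z (X i)" by (rule w(2)[OF vi])
      have "dom (X i) \<noteq> elts \<beta>" using domX[OF i] \<Delta>\<beta>(1) elts_inject mem_not_refl by metis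
      then have "branch_at lev C \<beta> (X i) = ext_node lev C \<beta> ?z (X i)"
        by (rule branch_at_succ[OF d\<kappa> is_pred_of_next[OF nxt]])
      then have le: "the (w i) \<subseteq>\<^sub>m branch_at lev C \<beta> (X i)" using 1 by simp
      have "branch_at lev C \<beta> (X i) \<subseteq>\<^sub>m the (y i)"
        unfolding Xi(1) by (rule lim_props(3)[OF acc CC goods Xi(2,3) \<gamma>\<beta>(2) \<Delta>\<beta>(2)])
      then have "the (w i) \<subseteq>\<^sub>m the (y i)" by (rule map_le_trans[OF le])
      moreover have "branch_at lev C \<beta> (X i) \<in> lev \<beta>"
        using branch_at_props[OF acc CC goods Xi(2,3) \<gamma>\<beta>(2) \<Delta>\<beta>(2)] by blast
      then have "dom (the (w i)) \<subseteq> elts \<beta>"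
        using map_le_implies_dom_le[OF le] lev_dom[OF \<kappa>s(2)] by blast
      ultimately show ?thesis by blast
    qed
    ultimately show ?thesis using \<kappa>s(3) by blast
  qed
  then show ?thesis using \<alpha> Ord_mem_subset[OF Ord_below[OF \<alpha>(1)] \<alpha>(2)] by blast
qed

text \<open>Suppose a in V has level at least \<alpha>. Its restriction to \<alpha> lies above some
  e in E of smaller level. As e is below a, it must be above some member of V, which by the
  antichain condition is a itself; then a has level below \<alpha>. Speaking of vectors lets the
  argument serve the tree and its derived trees alike.\<close>

lemma vector_antichain_bounded:
  assumes \<delta>: "\<delta> \<in> elts \<kappa>" and \<tau>: "\<tau> \<in> elts \<chi>" "\<tau> \<noteq> ozero"
    and s: "inj_on s (elts \<tau>)" "s ` elts \<tau> \<subseteq> lev \<delta>"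
    and V: "\<And>v. v \<in> V \<Longrightarrow> \<exists>\<gamma>\<in>elts \<kappa>. elts \<delta> \<subseteq> elts \<gamma> \<and> v \<in> vecs \<tau> s \<gamma>"
    and anti: "\<And>v w. v \<in> V \<Longrightarrow> w \<in> V \<Longrightarrow> (\<And>i. i \<in> elts \<tau> \<Longrightarrow> the (v i) \<subseteq>\<^sub>m the (w i)) \<Longrightarrow> v = w"
  shows "\<exists>\<alpha>\<in>elts \<kappa>. \<forall>v\<in>V. \<exists>\<gamma>\<in>elts \<alpha>. v \<in> vecs \<tau> s \<gamma>"
proof -
  define le :: "('k hset \<rightharpoonup> 'k hfun) \<Rightarrow> ('k hset \<rightharpoonup> 'k hfun) \<Rightarrow> bool"
    where "le v w \<longleftrightarrow> (\<forall>i\<in>elts \<tau>. the (v i) \<subseteq>\<^sub>m the (w i))" for v w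
  have le_trans: "le u v \<Longrightarrow> le v w \<Longrightarrow> le u w" for u v w
    unfolding le_def using map_le_trans by blast
  define E where "E = {e. (\<exists>a\<in>V. le a e) \<or> (\<forall>a\<in>V. \<not> le e a)}"
  have dense: "\<exists>e\<in>E. \<exists>\<nu>\<in>elts \<kappa>. e \<in> vecs \<tau> s \<nu> \<and> (\<forall>i\<in>elts \<tau>. the (z i) \<subseteq>\<^sub>m the (e i))"
    if z: "\<gamma> \<in> elts \<kappa>" "elts \<delta> \<subseteq> elts \<gamma>" "z \<in> vecs \<tau> s \<gamma>" for \<gamma> z
  proof (cases "\<exists>a\<in>V. le z a")
    case True
    then obtain a where a: "a \<in> V" "le z a" by blast
    have "le a a" unfolding le_def by simp
    then have "a \<in> E" unfolding E_def using a(1) by blast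
    then show ?thesis using V[OF a(1)] a(2) unfolding le_def by blast
  next
    case False
    then have "z \<in> E" unfolding E_def by blast
    then show ?thesis using z map_le_refl by blast
  qed
  have "\<exists>\<alpha>\<in>elts \<kappa>. elts \<delta> \<subseteq> elts \<alpha> \<and> (\<forall>y\<in>vecs \<tau> s \<alpha>. \<exists>e\<in>E. \<exists>\<beta>\<in>elts \<alpha>.
      \<forall>i\<in>elts \<tau>. the (e i) \<subseteq>\<^sub>m the (y i) \<and> dom (the (e i)) \<subseteq> elts \<beta>)"
    by (rule dense_captured[OF \<delta> \<tau>(1) s]) (rule dense)
  then obtain \<alpha> where \<alpha>: "\<alpha> \<in> elts \<kappa>" "elts \<delta> \<subseteq> elts \<alpha>"
    and capt: "\<forall>y\<in>vecs \<tau> s \<alpha>. \<exists>e\<in>E. \<exists>\<beta>\<in>elts \<alpha>.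
      \<forall>i\<in>elts \<tau>. the (e i) \<subseteq>\<^sub>m the (y i) \<and> dom (the (e i)) \<subseteq> elts \<beta>"
    by blast
  have "\<exists>\<gamma>\<in>elts \<alpha>. a \<in> vecs \<tau> s \<gamma>" if a: "a \<in> V" for a
  proof -
    obtain \<gamma> where \<gamma>: "\<gamma> \<in> elts \<kappa>" "elts \<delta> \<subseteq> elts \<gamma>" "a \<in> vecs \<tau> s \<gamma>" using V[OF a] by blast
    have "\<gamma> \<in> elts \<alpha>"
    proof (rule ccontr)
      assume "\<gamma> \<notin> elts \<alpha>"
      then have \<alpha>\<gamma>: "elts \<alpha> \<subseteq> elts \<gamma>" using below_not_mem_iff[OF \<gamma>(1) \<alpha>(1)] by blast
      have a': "the (a i) \<in> lev \<gamma>" "s i \<subseteq>\<^sub>m the (a i)" if "i \<in> elts \<tau>" for i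
        using \<gamma>(3) that unfolding vecs_def by blast+
      define y where "y = (\<lambda>i. if i \<in> elts \<tau> then Some (the (a i) |` elts \<alpha>) else None)"
      have "the (a i) |` elts \<alpha> \<in> lev \<alpha>" "s i \<subseteq>\<^sub>m the (a i) |` elts \<alpha>" if i: "i \<in> elts \<tau>" for i
      proof -
        show 1: "the (a i) |` elts \<alpha> \<in> lev \<alpha>" by (rule lev_restrict_le[OF \<gamma>(1) \<alpha>(1) \<alpha>\<gamma> a'(1)[OF i]])
        have "dom (s i) = elts \<delta>" using lev_dom[OF \<delta>] s(2) i by blast
        then show "s i \<subseteq>\<^sub>m the (a i) |` elts \<alpha>"
          using map_le_of_common[OF a'(2)[OF i] restrict_map_le] lev_dom[OF \<alpha>(1) 1] \<alpha>(2) by blast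
      qed
      then have "y \<in> vecs \<tau> s \<alpha>" unfolding vecs_def y_def by (auto split: if_splits)
      then obtain e \<beta> where e: "e \<in> E" "\<beta> \<in> elts \<alpha>"
        "\<forall>i\<in>elts \<tau>. the (e i) \<subseteq>\<^sub>m the (y i) \<and> dom (the (e i)) \<subseteq> elts \<beta>" using capt by blast
      have "le y a" unfolding le_def y_def by (simp add: restrict_map_le)
      moreover have "le e y" using e(3) unfolding le_def by blast
      ultimately have ea: "le e a" using le_trans by blast
      then obtain a\<^sub>0 where a\<^sub>0: "a\<^sub>0 \<in> V" "le a\<^sub>0 e" using e(1) a unfolding E_def by blast
      have "le a\<^sub>0 a" using le_trans[OF a\<^sub>0(2) ea] .
      then have "a\<^sub>0 = a" using anti[OF a\<^sub>0(1) a] unfolding le_def by blast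
      obtain i where i: "i \<in> elts \<tau>" using \<tau>(2) elts_empty_iff by blast
      have "the (a i) \<subseteq>\<^sub>m the (e i)" using a\<^sub>0(2) i unfolding le_def \<open>a\<^sub>0 = a\<close> by blast
      then have "elts \<gamma> \<subseteq> elts \<beta>"
        using map_le_implies_dom_le lev_dom[OF \<gamma>(1) a'(1)[OF i]] e(3) i by blast
      then show False using e(2) \<alpha>\<gamma> mem_not_refl by blast
    qed
    then show ?thesis using \<gamma>(3) by blast
  qed
  then show ?thesis using \<alpha>(1) by blast
qed

section \<open>The tree and its structural properties\<close>

definition TT :: "'k hfun set" where
  "TT = (\<Union>\<alpha>\<in>elts \<kappa>. lev \<alpha>)"

lemma TT_lev: "t \<in> TT \<Longrightarrow> dom t = elts \<alpha> \<Longrightarrow> \<alpha> \<in> elts \<kappa> \<and> t \<in> lev \<alpha>"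
proof -
  assume t: "t \<in> TT" "dom t = elts \<alpha>"
  then obtain \<beta> where \<beta>: "\<beta> \<in> elts \<kappa>" "t \<in> lev \<beta>" unfolding TT_def by blast
  then have "\<beta> = \<alpha>" using lev_dom[OF \<beta>] t(2) by (simp add: elts_inject)
  then show ?thesis using \<beta> by simp
qed

lemma lev_TT: "\<alpha> \<in> elts \<kappa> \<Longrightarrow> t \<in> lev \<alpha> \<Longrightarrow> t \<in> TT"
  unfolding TT_def by blast

lemma TT_cases: "t \<in> TT \<Longrightarrow> \<exists>\<alpha>\<in>elts \<kappa>. dom t = elts \<alpha> \<and> t \<in> lev \<alpha>"
  unfolding TT_def using lev_dom by blast

lemma stl_level_TT: "\<alpha> \<in> elts \<kappa> \<Longrightarrow> stl_level TT \<alpha> = lev \<alpha>"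
  unfolding stl_level_def using TT_lev lev_TT lev_dom by blast

lemma stl_level_TT_mem: "t \<in> stl_level TT \<alpha> \<Longrightarrow> \<alpha> \<in> elts \<kappa>"
  unfolding stl_level_def using TT_lev by blast

lemma level_nodes_TT: "\<alpha> \<in> elts \<kappa> \<Longrightarrow> {x \<in> TT. dom x = elts \<alpha>} = lev \<alpha>"
  using stl_level_TT unfolding stl_level_def .

lemma lev_nonempty: "\<alpha> \<in> elts \<kappa> \<Longrightarrow> lev \<alpha> \<noteq> {}"
  using lev_extend_le[OF _ zero_below, of \<alpha> Map.empty] lev_zero by auto

lemma TT_restrict:
  assumes "t \<in> TT" "Ord \<beta>" shows "t |` elts \<beta> \<in> TT"
proof -
  obtain \<alpha> where \<alpha>: "\<alpha> \<in> elts \<kappa>" "dom t = elts \<alpha>" "t \<in> lev \<alpha>" using TT_cases[OF assms(1)] by blast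
  show ?thesis
  proof (cases "\<beta> \<in> elts \<alpha>")
    case True
    then show ?thesis using lev_restrict[OF \<alpha>(1,3) True] lev_TT below_trans[OF \<alpha>(1)] by blast
  next
    case False
    then have "elts \<alpha> \<subseteq> elts \<beta>" using Ord_not_mem_iff[OF assms(2) Ord_below[OF \<alpha>(1)]] by blast
    then have "t |` elts \<beta> = t" using \<alpha>(2) by (intro restrict_map_superset) simp
    then show ?thesis using assms(1) by simp
  qed
qed

lemma streamlined_TT: "streamlined \<kappa> TT"
  unfolding streamlined_def
proof (intro conjI ballI allI impI subsetI CollectI)
  fix t assume "t \<in> TT"
  then obtain \<alpha> where \<alpha>: "\<alpha> \<in> elts \<kappa>" "dom t = elts \<alpha>" "t \<in> lev \<alpha>" using TT_cases by blast
  then have "ran t \<subseteq> H_card \<kappa>" using lev_ran[OF \<alpha>(1,3)] kappa_subset_H by blast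
  then show "\<exists>\<alpha>\<in>elts \<kappa>. dom t = elts \<alpha> \<and> ran t \<subseteq> H_card \<kappa>" using \<alpha> by blast
qed (rule TT_restrict)

lemma level_closed_TT: "level_closed TT"
  unfolding level_closed_def
proof (intro conjI ballI)
  fix t assume t: "t \<in> TT"
  then show "\<exists>\<alpha>\<in>elts \<kappa>. dom t = elts \<alpha>" using TT_cases by blast
  fix \<beta> assume "\<beta> \<in> elts \<kappa>"
  then show "t |` elts \<beta> \<in> TT" by (intro TT_restrict[OF t] Ord_below)
qed

lemma normal_TT: "normal_tree TT"
  unfolding normal_tree_def
proof (intro allI impI ballI)
  fix \<alpha> \<beta> s assume \<beta>: "Ord \<beta> \<and> stl_level TT \<beta> \<noteq> {}" and \<alpha>: "\<alpha> \<in> elts \<beta>" and s: "s \<in> stl_level TT \<alpha>"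
  have \<beta>\<kappa>: "\<beta> \<in> elts \<kappa>" using \<beta> stl_level_TT_mem by blast
  then have \<alpha>\<kappa>: "\<alpha> \<in> elts \<kappa>" using \<alpha> below_trans by blast
  show "\<exists>t\<in>stl_level TT \<beta>. s \<subseteq>\<^sub>m t"
    using lev_extend[OF \<beta>\<kappa> \<alpha>] s unfolding stl_level_TT[OF \<alpha>\<kappa>] stl_level_TT[OF \<beta>\<kappa>] by blast
qed

lemma succ_in_lev:
  "\<alpha> \<in> elts \<kappa> \<Longrightarrow> t \<in> lev \<alpha> \<Longrightarrow> i \<in> elts omega \<union> elts \<alpha> \<union> elts \<sigma> \<Longrightarrow> t(\<alpha> \<mapsto> i) \<in> lev (osucc \<alpha>)"
  unfolding lev_succ by blast

lemma succ_extends: "\<alpha> \<in> elts \<kappa> \<Longrightarrow> dom t = elts \<alpha> \<Longrightarrow> t \<subseteq>\<^sub>m t(\<alpha> \<mapsto> i)"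
  using mem_not_refl[of \<alpha>] by (auto simp: map_le_def)

lemma prolific_TT: "prolific_tree \<kappa> TT"
  unfolding prolific_tree_def
proof (intro ballI subsetI)
  fix \<alpha> t u assume \<alpha>: "\<alpha> \<in> elts \<kappa>" and t: "t \<in> stl_level TT \<alpha>"
    and u: "u \<in> {t(\<alpha> \<mapsto> i) | i. i \<in> elts omega \<union> elts \<alpha>}"
  then obtain i where "u = t(\<alpha> \<mapsto> i)" "i \<in> elts omega \<union> elts \<alpha> \<union> elts \<sigma>" by blast
  then show "u \<in> stl_level TT (osucc \<alpha>)"
    using succ_in_lev[OF \<alpha>, of t i] t unfolding stl_level_TT[OF \<alpha>] stl_level_TT[OF osucc_below[OF \<alpha>]] by simp
qed

lemma splitting_TT: "splitting_tree \<sigma> TT"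
  unfolding splitting_tree_def
proof
  fix t assume "t \<in> TT"
  then obtain \<alpha> where \<alpha>: "\<alpha> \<in> elts \<kappa>" "dom t = elts \<alpha>" "t \<in> lev \<alpha>" using TT_cases by blast
  let ?S = "{s \<in> TT. map_less t s \<and> (\<nexists>u. u \<in> TT \<and> map_less t u \<and> map_less u s)}"
  have "t(\<alpha> \<mapsto> i) \<in> ?S" if i: "i \<in> elts \<sigma>" for i
  proof -
    have d: "dom (t(\<alpha> \<mapsto> i)) = insert \<alpha> (elts \<alpha>)" using \<alpha>(2) by simp
    have "t(\<alpha> \<mapsto> i) \<in> lev (osucc \<alpha>)" using succ_in_lev[OF \<alpha>(1,3)] i by blast
    then have "t(\<alpha> \<mapsto> i) \<in> TT" by (rule lev_TT[OF osucc_below[OF \<alpha>(1)]])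
    moreover have "map_less t (t(\<alpha> \<mapsto> i))"
      unfolding map_less_def using succ_extends[OF \<alpha>(1,2)] \<alpha>(2) d mem_not_refl by (metis insertI1)
    moreover have False if u: "u \<in> TT" "map_less t u" "map_less u (t(\<alpha> \<mapsto> i))" for u
    proof -
      obtain \<beta> where \<beta>: "dom u = elts \<beta>" "\<beta> \<in> elts \<kappa>" using TT_cases[OF u(1)] by blast
      have le: "t \<subseteq>\<^sub>m u" "u \<subseteq>\<^sub>m t(\<alpha> \<mapsto> i)" and neq: "t \<noteq> u" "u \<noteq> t(\<alpha> \<mapsto> i)" using u unfolding map_less_def by auto
      have sub: "elts \<alpha> \<subseteq> elts \<beta>" "elts \<beta> \<subseteq> insert \<alpha> (elts \<alpha>)"
        using map_le_implies_dom_le[OF le(1)] map_le_implies_dom_le[OF le(2)] \<alpha>(2) \<beta>(1) d by simp_all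
      then consider "elts \<beta> = elts \<alpha>" | "elts \<beta> = insert \<alpha> (elts \<alpha>)" by blast
      then show False
      proof cases
        case 1
        then show False using map_le_dom_eq[OF le(1)] neq(1) \<alpha>(2) \<beta>(1) by simp
      next
        case 2
        then show False using map_le_dom_eq[OF le(2)] neq(2) d \<beta>(1) by simp
      qed
    qed
    ultimately show ?thesis by blast
  qed
  then have "(\<lambda>i. t(\<alpha> \<mapsto> i)) ` elts \<sigma> \<subseteq> ?S" by blast
  moreover have "inj_on (\<lambda>i. t(\<alpha> \<mapsto> i)) (elts \<sigma>)"
    by (rule inj_onI) (metis fun_upd_same option.inject)
  ultimately show "|elts \<sigma>| \<le>o |?S|" using card_of_ordLeq[of "elts \<sigma>" ?S] by blast
qed

text \<open>If the supremum \<alpha> of the lengths is attained, the union is a member of the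
  sequence. Otherwise, unless the sequence is empty, \<alpha> is a limit of cofinality below \<chi>,
  where every branch belongs to the tree.\<close>

lemma chi_complete_TT: "chi_complete \<chi> TT"
  unfolding chi_complete_def
proof (intro ballI allI impI)
  fix \<xi> and f :: "'k hset \<Rightarrow> 'k hfun"
  assume \<xi>: "\<xi> \<in> elts \<chi>"
    and f: "(\<forall>i\<in>elts \<xi>. f i \<in> TT) \<and> (\<forall>j\<in>elts \<xi>. \<forall>i\<in>elts j. map_less (f i) (f j))"
  have \<xi>\<kappa>: "\<xi> \<in> elts \<kappa>" using \<xi> by (rule chi_subset)
  have le: "f i \<subseteq>\<^sub>m f j" if "j \<in> elts \<xi>" "i \<in> elts j" for i j
    using f that unfolding map_less_def by blast
  have chain: "g \<subseteq>\<^sub>m h \<or> h \<subseteq>\<^sub>m g" if gh: "g \<in> f ` elts \<xi>" "h \<in> f ` elts \<xi>" for g h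
  proof -
    obtain i j where ij: "i \<in> elts \<xi>" "j \<in> elts \<xi>" "g = f i" "h = f j" using gh by blast
    have "i \<in> elts j \<or> i = j \<or> j \<in> elts i" using below_linear below_trans[OF \<xi>\<kappa>] ij by blast
    then show ?thesis using le ij map_le_refl by blast
  qed
  let ?t = "map_Union (f ` elts \<xi>)"
  have t_le: "f i \<subseteq>\<^sub>m ?t" if "i \<in> elts \<xi>" for i
    by (rule le_map_Union[OF chain]) (use that in auto)
  have "\<forall>i\<in>elts \<xi>. \<exists>\<alpha>. \<alpha> \<in> elts \<kappa> \<and> dom (f i) = elts \<alpha> \<and> f i \<in> lev \<alpha>" using f TT_cases by blast
  then obtain h where h: "\<forall>i\<in>elts \<xi>. h i \<in> elts \<kappa> \<and> dom (f i) = elts (h i) \<and> f i \<in> lev (h i)" by metis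
  then have "h ` elts \<xi> \<subseteq> elts \<kappa>" by blast
  then obtain \<theta> where \<theta>: "\<theta> \<in> elts \<kappa>" "h ` elts \<xi> \<subseteq> elts \<theta>"
    by (rule small_bounded[OF small_image[OF small_elts[OF \<xi>\<kappa>]]])
  define \<alpha> where "\<alpha> = osup (h ` elts \<xi>)"
  have \<alpha>: "elts \<alpha> = \<Union> (elts ` h ` elts \<xi>)" "Ord \<alpha>"
    unfolding \<alpha>_def using elts_osup[OF Ord_below[OF \<theta>(1)] \<theta>(2)] Ord_osup[OF Ord_below[OF \<theta>(1)] \<theta>(2)] by blast+
  have "elts \<alpha> \<subseteq> elts \<theta>" unfolding \<alpha>(1) using \<theta>(2) Ord_mem_subset[OF Ord_below[OF \<theta>(1)]] by blast
  then have \<alpha>\<kappa>: "\<alpha> \<in> elts \<kappa>" using mem_of_subset_of_mem[OF \<alpha>(2) _ \<theta>(1)] by blast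
  have domt: "dom ?t = elts \<alpha>" unfolding dom_map_Union \<alpha>(1) using h by simp
  have "?t \<in> TT"
  proof (cases "\<exists>i\<in>elts \<xi>. h i = \<alpha>")
    case True
    then obtain i where i: "i \<in> elts \<xi>" "h i = \<alpha>" by blast
    then have "dom (f i) = dom ?t" using h domt by simp
    then have "f i = ?t" using map_le_dom_eq[OF t_le[OF i(1)]] by blast
    then show ?thesis using f i(1) by metis
  next
    case False
    have h\<alpha>: "h i \<in> elts \<alpha>" if "i \<in> elts \<xi>" for i
    proof -
      have "elts (h i) \<subseteq> elts \<alpha>" unfolding \<alpha>(1) using that by blast
      then show ?thesis using below_subset_iff[OF _ \<alpha>\<kappa>] h that False by blast
    qed
    have unb: "\<exists>i\<in>elts \<xi>. \<zeta> \<in> elts (h i)" if "\<zeta> \<in> elts \<alpha>" for \<zeta> using that unfolding \<alpha>(1) by blast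
    have restr: "?t |` elts \<zeta> \<in> lev \<zeta>" if \<zeta>: "\<zeta> \<in> elts \<alpha>" for \<zeta>
    proof -
      obtain i where i: "i \<in> elts \<xi>" "\<zeta> \<in> elts (h i)" using unb[OF \<zeta>] by blast
      have hi: "h i \<in> elts \<kappa>" "dom (f i) = elts (h i)" "f i \<in> lev (h i)" using h i(1) by blast+
      have "f i |` elts \<zeta> \<subseteq>\<^sub>m ?t" using restrict_map_le t_le[OF i(1)] by (rule map_le_trans)
      then have "f i |` elts \<zeta> = ?t |` elts \<zeta>"
        by (rule map_le_eq_restrict) (rule dom_restrict_below[OF hi(2,1) i(2)])
      then show ?thesis using lev_restrict[OF hi(1,3) i(2)] by simp
    qed
    show ?thesis
    \<comment> \<open>For \<alpha> = 0 no length can be below \<alpha>, so only the empty sequence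
      is left; its union is the root.\<close>
    proof (cases "\<alpha> = ozero")
      case True
      then have "?t \<in> lev ozero" using domt lev_zero by simp
      then show ?thesis by (rule lev_TT[OF zero_below])
    next
      case nz: False
      have "\<alpha> \<in> acc_pts (elts \<kappa>)" unfolding acc_kappa_iff using \<alpha>\<kappa> nz unb h\<alpha> by blast
      moreover have "cofinal_length \<xi> \<alpha>"
        unfolding cofinal_length_def using h\<alpha> unb by (intro exI[of _ h]) blast
      then have "cofin \<alpha> \<in> elts \<chi>" using cofin_in_chi_iff[OF \<alpha>\<kappa>] \<xi> by blast
      ultimately have "?t \<in> lev \<alpha>" using lev_limit domt restr by simp
      then show ?thesis by (rule lev_TT[OF \<alpha>\<kappa>])
    qed
  qed
  moreover have "Map.graph ?t = (\<Union>i\<in>elts \<xi>. Map.graph (f i))"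
  proof (intro equalityI subsetI)
    fix p assume "p \<in> Map.graph ?t"
    then obtain i y where p: "p = (i, y)" "?t i = Some y" unfolding graph_def by blast
    then obtain j where j: "j \<in> elts \<xi>" "f j i = Some y" using map_Union_SomeD[OF p(2)] by blast
    have "p \<in> Map.graph (f j)" unfolding p(1) using j(2) by (rule in_graphI)
    then show "p \<in> (\<Union>i\<in>elts \<xi>. Map.graph (f i))" using j(1) by blast
  next
    fix p assume "p \<in> (\<Union>i\<in>elts \<xi>. Map.graph (f i))"
    then obtain i where i: "i \<in> elts \<xi>" "p \<in> Map.graph (f i)" by blast
    have "Map.graph (f i) \<subseteq> Map.graph ?t" using t_le[OF i(1)] unfolding map_le_iff_graph .
    then show "p \<in> Map.graph ?t" using i(2) by blast
  qed
  ultimately show "\<exists>t\<in>TT. Map.graph t = (\<Union>i\<in>elts \<xi>. Map.graph (f i))" by blast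
qed

text \<open>Nodes are vectors with a single coordinate above the root, so the bound on antichains is
  the case \<tau> = 1, \<delta> = 0 of \<open>vector_antichain_bounded\<close>.\<close>

lemma souslin_TT: "souslin \<kappa> TT map_less"
proof (rule souslin_mapsI[OF level_closed_TT])
  show "\<exists>x\<in>TT. dom x = elts \<alpha>" if "\<alpha> \<in> elts \<kappa>" for \<alpha>
    using lev_nonempty[OF that] lev_TT[OF that] lev_dom[OF that] by blast
  show "small {x \<in> TT. dom x = elts \<alpha>}" if "\<alpha> \<in> elts \<kappa>" for \<alpha>
    unfolding level_nodes_TT[OF that] by (rule lev_small[OF that])
  show "ozero \<in> elts \<kappa>" by (rule zero_below)
  show "\<exists>y\<in>TT. \<exists>z\<in>TT. dom y = elts (osucc \<alpha>) \<and> dom z = elts (osucc \<alpha>) \<and> x \<subseteq>\<^sub>m y \<and> x \<subseteq>\<^sub>m z \<and> y \<noteq> z"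
    if x: "x \<in> TT" "\<alpha> \<in> elts \<kappa>" "dom x = elts \<alpha>" for x \<alpha>
  proof -
    have xl: "x \<in> lev \<alpha>" using TT_lev[OF x(1,3)] by blast
    have in_TT: "x(\<alpha> \<mapsto> i) \<in> TT" if "i \<in> elts omega" for i
      using lev_TT[OF osucc_below[OF x(2)] succ_in_lev[OF x(2) xl]] that by blast
    have "dom (x(\<alpha> \<mapsto> i)) = elts (osucc \<alpha>)" for i using x(3) by (simp add: elts_osucc[OF x(2)])
    moreover have "x \<subseteq>\<^sub>m x(\<alpha> \<mapsto> i)" for i by (rule succ_extends[OF x(2,3)])
    moreover have "x(\<alpha> \<mapsto> ozero) \<noteq> x(\<alpha> \<mapsto> osucc ozero)"
      using one_neq_zero by (metis fun_upd_same option.inject)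
    ultimately show ?thesis using in_TT[OF zero_in_omega] in_TT[OF one_in_omega] by blast
  qed
  show "\<exists>\<theta>\<in>elts \<kappa>. \<forall>a\<in>A. dom a \<subseteq> elts \<theta>" if A: "is_antichain TT map_less A" for A
  proof -
    define vec :: "'k hfun \<Rightarrow> 'k hset \<rightharpoonup> 'k hfun" where "vec t = [ozero \<mapsto> t]" for t
    have AT: "A \<subseteq> TT" and anti: "\<And>a b. a \<in> A \<Longrightarrow> b \<in> A \<Longrightarrow> \<not> map_less a b"
      using A unfolding is_antichain_def by blast+
    have vec_in: "vec t \<in> vecs (osucc ozero) (\<lambda>_. Map.empty) \<gamma> \<longleftrightarrow> t \<in> lev \<gamma>" for t \<gamma>
      unfolding vecs_def vec_def elts_one by (auto split: if_splits)
    have "\<exists>\<alpha>\<in>elts \<kappa>. \<forall>v\<in>vec ` A. \<exists>\<gamma>\<in>elts \<alpha>. v \<in> vecs (osucc ozero) (\<lambda>_. Map.empty) \<gamma>"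
    proof (rule vector_antichain_bounded[OF zero_below one_in_chi one_neq_zero])
      show "inj_on (\<lambda>_. Map.empty) (elts (osucc (ozero :: 'k hset)))" unfolding elts_one by simp
      show "(\<lambda>_. Map.empty) ` elts (osucc (ozero :: 'k hset)) \<subseteq> lev ozero" unfolding lev_zero by blast
      show "\<exists>\<gamma>\<in>elts \<kappa>. elts ozero \<subseteq> elts \<gamma> \<and> v \<in> vecs (osucc ozero) (\<lambda>_. Map.empty) \<gamma>"
        if v: "v \<in> vec ` A" for v
      proof -
        obtain a where a: "a \<in> A" "v = vec a" using v by blast
        then obtain \<gamma> where "\<gamma> \<in> elts \<kappa>" "a \<in> lev \<gamma>" using AT TT_cases by blast
        then show ?thesis using vec_in a(2) by auto
      qed
      show "v = w" if v: "v \<in> vec ` A" "w \<in> vec ` A"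
        and le: "\<And>i. i \<in> elts (osucc ozero) \<Longrightarrow> the (v i) \<subseteq>\<^sub>m the (w i)" for v w
      proof -
        obtain a b where ab: "a \<in> A" "b \<in> A" "v = vec a" "w = vec b" using v by blast
        have "a \<subseteq>\<^sub>m b" using le[of ozero] ab unfolding elts_one vec_def by simp
        then have "a = b" using anti[OF ab(1,2)] unfolding map_less_def by blast
        then show ?thesis using ab by simp
      qed
    qed
    then obtain \<alpha> where \<alpha>: "\<alpha> \<in> elts \<kappa>" "\<forall>a\<in>A. \<exists>\<gamma>\<in>elts \<alpha>. a \<in> lev \<gamma>" using vec_in by auto
    have "dom a \<subseteq> elts \<alpha>" if a: "a \<in> A" for a
    proof -
      obtain \<gamma> where \<gamma>: "\<gamma> \<in> elts \<alpha>" "a \<in> lev \<gamma>" using \<alpha>(2) a by blast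
      then have "dom a = elts \<gamma>" using lev_dom below_trans[OF \<alpha>(1)] by blast
      then show ?thesis using Ord_mem_subset[OF Ord_below[OF \<alpha>(1)] \<gamma>(1)] by simp
    qed
    then show ?thesis using \<alpha>(1) by blast
  qed
qed

section \<open>Derived trees\<close>

lemma dom_coord: "\<forall>y\<in>ran x. dom y = elts \<tau> \<Longrightarrow> i \<in> elts \<tau> \<Longrightarrow> dom (coord x i) = dom x"
  by (force simp: coord_def dom_def ran_def bind_eq_Some_conv)

lemma coord_restrict: "coord (x |` S) i = coord x i |` S"
  by (auto simp: coord_def restrict_map_def)

text \<open>The index set must be nonempty, since the inclusion of domains can only be read off from
  some coordinate. Outside \<open>elts \<tau>\<close> the values of both maps are undefined and so
  agree.\<close>

lemma coord_le_imp_le: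
  assumes "\<forall>y\<in>ran x. dom y = elts \<tau>" "\<forall>y\<in>ran x'. dom y = elts \<tau>" "\<tau> \<noteq> ozero"
    "\<And>i. i \<in> elts \<tau> \<Longrightarrow> coord x i \<subseteq>\<^sub>m coord x' i"
  shows "x \<subseteq>\<^sub>m x'"
  unfolding map_le_def
proof
  fix \<epsilon> assume "\<epsilon> \<in> dom x"
  then obtain y where y: "x \<epsilon> = Some y" by blast
  obtain i\<^sub>0 where i\<^sub>0: "i\<^sub>0 \<in> elts \<tau>" using assms(3) elts_empty_iff by blast
  have "\<epsilon> \<in> dom (coord x i\<^sub>0)" using dom_coord[OF assms(1) i\<^sub>0] y by blast
  then have "\<epsilon> \<in> dom (coord x' i\<^sub>0)" using map_le_implies_dom_le[OF assms(4)[OF i\<^sub>0]] by blast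
  then have "\<epsilon> \<in> dom x'" using dom_coord[OF assms(2) i\<^sub>0] by blast
  then obtain y' where y': "x' \<epsilon> = Some y'" by blast
  have dy: "dom y = elts \<tau>" "dom y' = elts \<tau>"
    by (rule bspec[OF assms(1) ranI[of x, OF y]], rule bspec[OF assms(2) ranI[of x', OF y']])
  have "y i = y' i" for i
  proof (cases "i \<in> elts \<tau>")
    case True
    have "\<epsilon> \<in> dom (coord x i)" using dom_coord[OF assms(1) True] y by blast
    then have "coord x i \<epsilon> = coord x' i \<epsilon>" using assms(4)[OF True] unfolding map_le_def by blast
    then show ?thesis using y y' unfolding coord_def by simp
  next
    case False
    then have "i \<notin> dom y" "i \<notin> dom y'" using dy by simp_all
    then show ?thesis by (simp add: domIff)
  qed
  then have "y = y'" by (rule ext)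
  then show "x \<epsilon> = x' \<epsilon>" using y y' by simp
qed

context
  fixes \<delta> \<tau> :: "'k hset" and s :: "'k hset \<Rightarrow> 'k hfun"
  assumes \<delta>: "\<delta> \<in> elts \<kappa>" and \<tau>: "\<tau> \<in> elts \<chi>" "\<tau> \<noteq> ozero"
    and s: "inj_on s (elts \<tau>)" "s ` elts \<tau> \<subseteq> lev \<delta>"
begin

abbreviation DT :: "('k hset \<rightharpoonup> 'k hfun) set" where
  "DT \<equiv> derived_tree \<kappa> TT \<tau> s"

lemma s_lev: "i \<in> elts \<tau> \<Longrightarrow> s i \<in> lev \<delta>"
  using s(2) by blast

lemma s_dom: "i \<in> elts \<tau> \<Longrightarrow> dom (s i) = elts \<delta>"
  using lev_dom[OF \<delta> s_lev] .

text \<open>If the union of \<open>coord x i\<close> and \<open>s i\<close> is a node t, both are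
  restrictions of t; hence they are comparable, and \<open>coord x i\<close> is itself a node. The
  length of x is below \<kappa> because there is at least one coordinate.\<close>

lemma DT_D:
  assumes "x \<in> DT"
  shows "\<exists>\<alpha>\<in>elts \<kappa>. dom x = elts \<alpha> \<and> (\<forall>y\<in>ran x. dom y = elts \<tau> \<and> ran y \<subseteq> H_card \<kappa>) \<and>
    (\<forall>i\<in>elts \<tau>. coord x i \<in> lev \<alpha> \<and> (coord x i \<subseteq>\<^sub>m s i \<or> s i \<subseteq>\<^sub>m coord x i))"
proof -
  obtain \<alpha> where \<alpha>: "Ord \<alpha>" "dom x = elts \<alpha>" and y: "\<forall>y\<in>ran x. dom y = elts \<tau> \<and> ran y \<subseteq> H_card \<kappa>"
    and t: "\<forall>i\<in>elts \<tau>. \<exists>t\<in>TT. Map.graph t = Map.graph (coord x i) \<union> Map.graph (s i)"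
    using assms unfolding derived_tree_def by blast
  have dc: "dom (coord x i) = elts \<alpha>" if "i \<in> elts \<tau>" for i
    using dom_coord[OF _ that, of x] y \<alpha>(2) by simp
  have main: "\<alpha> \<in> elts \<kappa> \<and> coord x i \<in> lev \<alpha> \<and> (coord x i \<subseteq>\<^sub>m s i \<or> s i \<subseteq>\<^sub>m coord x i)"
    if i: "i \<in> elts \<tau>" for i
  proof -
    obtain t where tT: "t \<in> TT" and g: "Map.graph t = Map.graph (coord x i) \<union> Map.graph (s i)"
      using t i by blast
    obtain \<beta> where \<beta>: "\<beta> \<in> elts \<kappa>" "dom t = elts \<beta>" "t \<in> lev \<beta>" using TT_cases[OF tT] by blast
    have le: "coord x i \<subseteq>\<^sub>m t" "s i \<subseteq>\<^sub>m t" unfolding map_le_iff_graph g by blast+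
    have \<alpha>\<beta>: "elts \<alpha> \<subseteq> elts \<beta>" using map_le_implies_dom_le[OF le(1)] dc[OF i] \<beta>(2) by simp
    then have \<alpha>\<kappa>: "\<alpha> \<in> elts \<kappa>" using mem_of_subset_of_mem[OF \<alpha>(1) _ \<beta>(1)] by blast
    have "coord x i = t |` elts \<alpha>" by (rule map_le_eq_restrict[OF le(1) dc[OF i]])
    then have "coord x i \<in> lev \<alpha>" using lev_restrict_le[OF \<beta>(1) \<alpha>\<kappa> \<alpha>\<beta> \<beta>(3)] by simp
    moreover have "elts \<alpha> \<subseteq> elts \<delta> \<or> elts \<delta> \<subseteq> elts \<alpha>"
      using below_not_mem_iff[OF \<alpha>\<kappa> \<delta>] below_subset_iff[OF \<alpha>\<kappa> \<delta>] by blast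
    then have "coord x i \<subseteq>\<^sub>m s i \<or> s i \<subseteq>\<^sub>m coord x i"
      using map_le_of_common[OF le] map_le_of_common[OF le(2,1)] dc[OF i] s_dom[OF i] by auto
    ultimately show ?thesis using \<alpha>\<kappa> by blast
  qed
  obtain i\<^sub>0 where "i\<^sub>0 \<in> elts \<tau>" using \<tau>(2) elts_empty_iff by blast
  then have \<alpha>\<kappa>: "\<alpha> \<in> elts \<kappa>" using main by blast
  have "\<forall>i\<in>elts \<tau>. coord x i \<in> lev \<alpha> \<and> (coord x i \<subseteq>\<^sub>m s i \<or> s i \<subseteq>\<^sub>m coord x i)" using main by blast
  then show ?thesis using \<alpha>(2) y by (intro bexI[OF _ \<alpha>\<kappa>] conjI)
qed

lemma DT_dom: "x \<in> DT \<Longrightarrow> \<exists>\<alpha>\<in>elts \<kappa>. dom x = elts \<alpha>"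
  by (drule DT_D) (elim bexE conjE, rule bexI)

lemma DT_ran:
  assumes "x \<in> DT" shows "\<forall>y\<in>ran x. dom y = elts \<tau>"
proof
  fix y assume "y \<in> ran x"
  moreover have "\<forall>y\<in>ran x. dom y = elts \<tau> \<and> ran y \<subseteq> H_card \<kappa>"
    using DT_D[OF assms] by (elim bexE conjE)
  ultimately show "dom y = elts \<tau>" by simp
qed

text \<open>Of two comparable nodes the longer one is their union, so comparability suffices for
  membership in the derived tree.\<close>

lemma DT_I:
  assumes "\<alpha> \<in> elts \<kappa>" "dom x = elts \<alpha>" "\<forall>y\<in>ran x. dom y = elts \<tau> \<and> ran y \<subseteq> H_card \<kappa>"
    and c: "\<And>i. i \<in> elts \<tau> \<Longrightarrow> coord x i \<in> lev \<alpha> \<and> (coord x i \<subseteq>\<^sub>m s i \<or> s i \<subseteq>\<^sub>m coord x i)"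
  shows "x \<in> DT"
proof -
  have "\<exists>t\<in>TT. Map.graph t = Map.graph (coord x i) \<union> Map.graph (s i)" if i: "i \<in> elts \<tau>" for i
  proof -
    have T: "coord x i \<in> TT" "s i \<in> TT" using c[OF i] lev_TT[OF assms(1)] lev_TT[OF \<delta> s_lev[OF i]] by blast+
    have "Map.graph (coord x i) \<subseteq> Map.graph (s i) \<or> Map.graph (s i) \<subseteq> Map.graph (coord x i)"
      using c[OF i] unfolding map_le_iff_graph by blast
    then have "Map.graph (s i) = Map.graph (coord x i) \<union> Map.graph (s i) \<or>
        Map.graph (coord x i) = Map.graph (coord x i) \<union> Map.graph (s i)" by blast
    then show ?thesis using T by blast
  qed
  then show ?thesis unfolding derived_tree_def using assms(2,3) Ord_below[OF assms(1)] by blast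
qed

text \<open>Transposition: a family of nodes of length \<alpha>, indexed by \<tau>, becomes one
  function on \<alpha> whose values are functions on \<tau>. Its coordinates are the given
  nodes.\<close>

definition vec_node :: "'k hset \<Rightarrow> ('k hset \<Rightarrow> 'k hfun) \<Rightarrow> 'k hset \<rightharpoonup> 'k hfun" where
  "vec_node \<alpha> w = (\<lambda>\<epsilon>. if \<epsilon> \<in> elts \<alpha> then Some (\<lambda>i. if i \<in> elts \<tau> then w i \<epsilon> else None) else None)"

lemma dom_mk: "dom (vec_node \<alpha> w) = elts \<alpha>"
  unfolding vec_node_def by (auto split: if_splits)

lemma coord_mk: "i \<in> elts \<tau> \<Longrightarrow> dom (w i) = elts \<alpha> \<Longrightarrow> coord (vec_node \<alpha> w) i = w i"
proof
  fix \<epsilon> assume i: "i \<in> elts \<tau>" "dom (w i) = elts \<alpha>"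
  then have "\<epsilon> \<notin> elts \<alpha> \<Longrightarrow> w i \<epsilon> = None" by (metis domIff)
  then show "coord (vec_node \<alpha> w) i \<epsilon> = w i \<epsilon>" unfolding vec_node_def coord_def using i(1) by simp
qed

lemma mk_in_DT:
  assumes \<alpha>: "\<alpha> \<in> elts \<kappa>"
    and w: "\<And>i. i \<in> elts \<tau> \<Longrightarrow> w i \<in> lev \<alpha> \<and> (w i \<subseteq>\<^sub>m s i \<or> s i \<subseteq>\<^sub>m w i)"
  shows "vec_node \<alpha> w \<in> DT"
proof (rule DT_I[OF \<alpha> dom_mk])
  have dw: "dom (w i) = elts \<alpha>" and rw: "ran (w i) \<subseteq> H_card \<kappa>" if "i \<in> elts \<tau>" for i
    using lev_dom[OF \<alpha>] lev_ran[OF \<alpha>] w[OF that] kappa_subset_H by blast+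
  show "coord (vec_node \<alpha> w) i \<in> lev \<alpha> \<and> (coord (vec_node \<alpha> w) i \<subseteq>\<^sub>m s i \<or> s i \<subseteq>\<^sub>m coord (vec_node \<alpha> w) i)"
    if "i \<in> elts \<tau>" for i
    using w[OF that] coord_mk[of i w, OF that dw[OF that]] by simp
  show "\<forall>y\<in>ran (vec_node \<alpha> w). dom y = elts \<tau> \<and> ran y \<subseteq> H_card \<kappa>"
  proof
    fix y assume "y \<in> ran (vec_node \<alpha> w)"
    then obtain \<epsilon> where \<epsilon>: "vec_node \<alpha> w \<epsilon> = Some y" unfolding ran_def by blast
    then have \<epsilon>\<alpha>: "\<epsilon> \<in> elts \<alpha>" using dom_mk by blast
    then have y: "y = (\<lambda>i. if i \<in> elts \<tau> then w i \<epsilon> else None)" using \<epsilon> unfolding vec_node_def by simp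
    have "w i \<epsilon> \<noteq> None" if "i \<in> elts \<tau>" for i using dw[OF that] \<epsilon>\<alpha> by blast
    then have "dom y = elts \<tau>" unfolding y dom_def by auto
    moreover have "ran y \<subseteq> H_card \<kappa>"
    proof
      fix a assume "a \<in> ran y"
      then obtain i where i: "y i = Some a" unfolding ran_def by blast
      then have "i \<in> elts \<tau>" "w i \<epsilon> = Some a" unfolding y by (auto split: if_splits)
      then show "a \<in> H_card \<kappa>" using rw ranI[of "w i"] by blast
    qed
    ultimately show "dom y = elts \<tau> \<and> ran y \<subseteq> H_card \<kappa>" by blast
  qed
qed

lemma DT_below: "\<epsilon> \<in> dom x \<Longrightarrow> x \<in> DT \<Longrightarrow> (\<And>i. i \<in> elts \<tau> \<Longrightarrow> coord x i \<epsilon> = w i \<epsilon>) \<Longrightarrow>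
    \<epsilon> \<in> elts \<alpha> \<Longrightarrow> x \<epsilon> = vec_node \<alpha> w \<epsilon>"
proof -
  assume a: "\<epsilon> \<in> dom x" "x \<in> DT" "\<And>i. i \<in> elts \<tau> \<Longrightarrow> coord x i \<epsilon> = w i \<epsilon>" "\<epsilon> \<in> elts \<alpha>"
  then obtain y where y: "x \<epsilon> = Some y" by blast
  have dy: "dom y = elts \<tau>" using DT_ran[OF a(2)] ranI[of x, OF y] by (rule bspec)
  have "y i = (if i \<in> elts \<tau> then w i \<epsilon> else None)" for i
  proof (cases "i \<in> elts \<tau>")
    case True
    then show ?thesis using a(3)[OF True] y unfolding coord_def by simp
  next
    case False
    then have "i \<notin> dom y" using dy by simp
    then show ?thesis using False by (simp add: domIff)
  qed
  then have "y = (\<lambda>i. if i \<in> elts \<tau> then w i \<epsilon> else None)" by (rule ext)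
  then show "x \<epsilon> = vec_node \<alpha> w \<epsilon>" using y a(4) unfolding vec_node_def by simp
qed

lemma level_closed_DT: "level_closed DT"
  unfolding level_closed_def
proof (intro conjI ballI)
  fix x assume x: "x \<in> DT"
  show "\<exists>\<alpha>\<in>elts \<kappa>. dom x = elts \<alpha>" by (rule DT_dom[OF x])
  fix \<beta> assume \<beta>: "\<beta> \<in> elts \<kappa>"
  obtain \<alpha> where \<alpha>: "\<alpha> \<in> elts \<kappa>" "dom x = elts \<alpha>"
    and y: "\<forall>y\<in>ran x. dom y = elts \<tau> \<and> ran y \<subseteq> H_card \<kappa>"
    and c: "\<forall>i\<in>elts \<tau>. coord x i \<in> lev \<alpha> \<and> (coord x i \<subseteq>\<^sub>m s i \<or> s i \<subseteq>\<^sub>m coord x i)"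
    using DT_D[OF x] by (elim bexE conjE)
  show "x |` elts \<beta> \<in> DT"
  proof (cases "elts \<alpha> \<subseteq> elts \<beta>")
    case True
    then show ?thesis using restrict_map_superset[of x "elts \<beta>"] \<alpha>(2) x by simp
  next
    case False
    then have \<beta>\<alpha>: "\<beta> \<in> elts \<alpha>" using below_not_mem_iff[OF \<beta> \<alpha>(1)] by blast
    show ?thesis
    proof (rule DT_I[OF \<beta> dom_restrict_below[OF \<alpha>(2,1) \<beta>\<alpha>]])
      have "ran (x |` elts \<beta>) \<subseteq> ran x" by (auto simp: ran_def restrict_map_def split: if_splits)
      then show "\<forall>y\<in>ran (x |` elts \<beta>). dom y = elts \<tau> \<and> ran y \<subseteq> H_card \<kappa>"
        using y by (meson subsetD)
      fix i assume i: "i \<in> elts \<tau>"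
      let ?c = "coord x i |` elts \<beta>"
      have ci: "coord x i \<in> lev \<alpha>" "coord x i \<subseteq>\<^sub>m s i \<or> s i \<subseteq>\<^sub>m coord x i" using c i by blast+
      have cl: "?c \<in> lev \<beta>" by (rule lev_restrict[OF \<alpha>(1) ci(1) \<beta>\<alpha>])
      have dc: "dom ?c = elts \<beta>" by (rule lev_dom[OF \<beta> cl])
      have "elts \<beta> \<subseteq> elts \<delta> \<or> elts \<delta> \<subseteq> elts \<beta>"
        using below_not_mem_iff[OF \<beta> \<delta>] below_subset_iff[OF \<beta> \<delta>] by blast
      then have "?c \<subseteq>\<^sub>m s i \<or> s i \<subseteq>\<^sub>m ?c"
        using ci(2) map_le_trans[OF restrict_map_le, of "coord x i" "s i" "elts \<beta>"]
          map_le_of_common[OF restrict_map_le, of "s i" "coord x i" "elts \<beta>"]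
          map_le_of_common[OF _ restrict_map_le, of "s i" "coord x i" "elts \<beta>"] dc s_dom[OF i]
        by metis
      then show "coord (x |` elts \<beta>) i \<in> lev \<beta> \<and>
          (coord (x |` elts \<beta>) i \<subseteq>\<^sub>m s i \<or> s i \<subseteq>\<^sub>m coord (x |` elts \<beta>) i)"
        unfolding coord_restrict using cl by blast
    qed
  qed
qed

lemma DT_level:
  assumes "x \<in> DT" "dom x = elts \<alpha>"
  shows "\<alpha> \<in> elts \<kappa>" "\<And>i. i \<in> elts \<tau> \<Longrightarrow> coord x i \<in> lev \<alpha>"
    "\<And>i. i \<in> elts \<tau> \<Longrightarrow> elts \<delta> \<subseteq> elts \<alpha> \<Longrightarrow> s i \<subseteq>\<^sub>m coord x i" "\<forall>y\<in>ran x. dom y = elts \<tau>"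
proof -
  obtain \<beta> where \<beta>: "\<beta> \<in> elts \<kappa>" "dom x = elts \<beta>" "\<forall>y\<in>ran x. dom y = elts \<tau> \<and> ran y \<subseteq> H_card \<kappa>"
    "\<forall>i\<in>elts \<tau>. coord x i \<in> lev \<beta> \<and> (coord x i \<subseteq>\<^sub>m s i \<or> s i \<subseteq>\<^sub>m coord x i)"
    using DT_D[OF assms(1)] by (elim bexE conjE)
  have eq: "\<beta> = \<alpha>" using \<beta>(2) assms(2) by (simp add: elts_inject)
  show \<alpha>\<kappa>: "\<alpha> \<in> elts \<kappa>" using \<beta>(1) eq by simp
  show cl: "coord x i \<in> lev \<alpha>" if "i \<in> elts \<tau>" for i using \<beta>(4) that eq by blast
  show "\<forall>y\<in>ran x. dom y = elts \<tau>" by (rule DT_ran[OF assms(1)])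
  show "s i \<subseteq>\<^sub>m coord x i" if i: "i \<in> elts \<tau>" and \<delta>\<alpha>: "elts \<delta> \<subseteq> elts \<alpha>" for i
  proof -
    consider "coord x i \<subseteq>\<^sub>m s i" | "s i \<subseteq>\<^sub>m coord x i" using \<beta>(4) i by blast
    then show ?thesis
    proof cases
      \<comment> \<open>From level \<delta> on, \<open>coord x i\<close> can be below
        \<open>s i\<close> only by being equal to it.\<close>
      case 1
      then have "elts \<alpha> \<subseteq> elts \<delta>"
        using map_le_implies_dom_le[OF 1] s_dom[OF i] lev_dom[OF \<alpha>\<kappa> cl[OF i]] by simp
      then have "dom (coord x i) = dom (s i)" using \<delta>\<alpha> s_dom[OF i] lev_dom[OF \<alpha>\<kappa> cl[OF i]] by simp
      then have "coord x i = s i" by (rule map_le_dom_eq[OF 1])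
      then show ?thesis by simp
    qed
  qed
qed

text \<open>Transposition in the other direction, in the format of \<open>vecs\<close>, so that the
  bound on antichains of vectors becomes applicable.\<close>

definition vec :: "('k hset \<rightharpoonup> 'k hfun) \<Rightarrow> 'k hset \<rightharpoonup> 'k hfun" where
  "vec x = (\<lambda>i. if i \<in> elts \<tau> then Some (coord x i) else None)"

lemma dom_vec: "dom (vec x) = elts \<tau>"
  unfolding vec_def by (auto split: if_splits)

lemma the_vec: "i \<in> elts \<tau> \<Longrightarrow> the (vec x i) = coord x i"
  unfolding vec_def by simp

lemma DT_le:
  assumes "x \<in> DT" "x' \<in> DT" "\<And>i. i \<in> elts \<tau> \<Longrightarrow> the (vec x i) \<subseteq>\<^sub>m the (vec x' i)"
  shows "x \<subseteq>\<^sub>m x'"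
proof (rule coord_le_imp_le[OF _ _ \<tau>(2)])
  show "\<forall>y\<in>ran x. dom y = elts \<tau>" "\<forall>y\<in>ran x'. dom y = elts \<tau>"
    by (rule DT_ran[OF assms(1)], rule DT_ran[OF assms(2)])
  show "coord x i \<subseteq>\<^sub>m coord x' i" if "i \<in> elts \<tau>" for i using assms(3)[OF that] the_vec[OF that] by simp
qed

lemma souslin_DT: "souslin \<kappa> DT map_less"
proof (rule souslin_mapsI[OF level_closed_DT _ _ \<delta>])
  show "\<exists>x\<in>DT. dom x = elts \<alpha>" if \<alpha>: "\<alpha> \<in> elts \<kappa>" for \<alpha>
  proof -
    \<comment> \<open>From \<delta> on, \<open>s i\<close> is extended; below \<delta> its
      restriction is the only node that fits.\<close>
    have "\<exists>t. t \<in> lev \<alpha> \<and> (t \<subseteq>\<^sub>m s i \<or> s i \<subseteq>\<^sub>m t)" if i: "i \<in> elts \<tau>" for i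
    proof (cases "elts \<delta> \<subseteq> elts \<alpha>")
      case True
      then show ?thesis using lev_extend_le[OF \<alpha> \<delta> True s_lev[OF i]] by blast
    next
      case False
      then have "\<alpha> \<in> elts \<delta>" using below_not_mem_iff[OF \<alpha> \<delta>] by blast
      then have "s i |` elts \<alpha> \<in> lev \<alpha>" by (rule lev_restrict[OF \<delta> s_lev[OF i]])
      then show ?thesis using restrict_map_le by blast
    qed
    then obtain w where "\<And>i. i \<in> elts \<tau> \<Longrightarrow> w i \<in> lev \<alpha> \<and> (w i \<subseteq>\<^sub>m s i \<or> s i \<subseteq>\<^sub>m w i)" by metis
    then have "vec_node \<alpha> w \<in> DT" by (rule mk_in_DT[OF \<alpha>])
    then show ?thesis using dom_mk by blast
  qed
  show "small {x \<in> DT. dom x = elts \<alpha>}" if \<alpha>: "\<alpha> \<in> elts \<kappa>" for \<alpha>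
  proof (rule small_inj)
    show "small (seqs (lev \<alpha>))" by (rule small_seqs[OF lev_small[OF \<alpha>]])
    show "inj_on vec {x \<in> DT. dom x = elts \<alpha>}"
    proof (rule inj_onI)
      fix x x' assume x: "x \<in> {x \<in> DT. dom x = elts \<alpha>}" "x' \<in> {x \<in> DT. dom x = elts \<alpha>}" "vec x = vec x'"
      then have "x \<subseteq>\<^sub>m x'" by (intro DT_le) auto
      then show "x = x'" by (rule map_le_dom_eq) (use x in simp)
    qed
    show "vec ` {x \<in> DT. dom x = elts \<alpha>} \<subseteq> seqs (lev \<alpha>)"
    proof (rule image_subsetI)
      fix x assume x: "x \<in> {x \<in> DT. dom x = elts \<alpha>}"
      have "ran (vec x) \<subseteq> lev \<alpha>"
      proof
        fix a assume "a \<in> ran (vec x)"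
        then obtain i where i: "vec x i = Some a" unfolding ran_def by blast
        then have "i \<in> elts \<tau>" "a = coord x i" unfolding vec_def by (auto split: if_splits)
        then show "a \<in> lev \<alpha>" using DT_level(2)[of x \<alpha> i] x by simp
      qed
      then show "vec x \<in> seqs (lev \<alpha>)" unfolding seqs_def using \<tau>(1) dom_vec by blast
    qed
  qed
  show "\<exists>y\<in>DT. \<exists>z\<in>DT. dom y = elts (osucc \<alpha>) \<and> dom z = elts (osucc \<alpha>) \<and> x \<subseteq>\<^sub>m y \<and> x \<subseteq>\<^sub>m z \<and> y \<noteq> z"
    if x: "x \<in> DT" "\<alpha> \<in> elts \<kappa>" "dom x = elts \<alpha>" "elts \<delta> \<subseteq> elts \<alpha>" for x \<alpha>
  proof -
    \<comment> \<open>All coordinates are prolonged by the same value c; the values 0 and 1 give two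
      different successors of x.\<close>
    define w where "w c i = (coord x i)(\<alpha> \<mapsto> c)" for c i
    let ?y = "\<lambda>c. vec_node (osucc \<alpha>) (w c)"
    have cl: "coord x i \<in> lev \<alpha>" "s i \<subseteq>\<^sub>m coord x i" if "i \<in> elts \<tau>" for i
      using DT_level(2,3)[OF x(1,3) that] x(4) by blast+
    have yDT: "?y c \<in> DT" if c: "c \<in> elts omega" for c
    proof (rule mk_in_DT[OF osucc_below[OF x(2)]])
      fix i assume i: "i \<in> elts \<tau>"
      have "w c i \<in> lev (osucc \<alpha>)" unfolding w_def using succ_in_lev[OF x(2) cl(1)[OF i]] c by blast
      moreover have "s i \<subseteq>\<^sub>m w c i"
        unfolding w_def using cl(2)[OF i] succ_extends[OF x(2) lev_dom[OF x(2) cl(1)[OF i]]] by (rule map_le_trans)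
      ultimately show "w c i \<in> lev (osucc \<alpha>) \<and> (w c i \<subseteq>\<^sub>m s i \<or> s i \<subseteq>\<^sub>m w c i)" by blast
    qed
    have "x \<subseteq>\<^sub>m ?y c" for c
      unfolding map_le_def
    proof
      fix \<epsilon> assume \<epsilon>: "\<epsilon> \<in> dom x"
      then have "\<epsilon> \<noteq> \<alpha>" using x(3) mem_not_refl by metis
      then have "coord x i \<epsilon> = w c i \<epsilon>" for i unfolding w_def by simp
      moreover have "\<epsilon> \<in> elts (osucc \<alpha>)" using \<epsilon> x(3) elts_osucc[OF x(2)] by simp
      ultimately show "x \<epsilon> = ?y c \<epsilon>" by (intro DT_below[OF \<epsilon> x(1)])
    qed
    moreover have "?y ozero \<noteq> ?y (osucc ozero)"
    proof
      assume "?y ozero = ?y (osucc ozero)"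
      moreover obtain i where i: "i \<in> elts \<tau>" using \<tau>(2) elts_empty_iff by blast
      moreover have "dom (w c i) = elts (osucc \<alpha>)" for c
        unfolding w_def using lev_dom[OF x(2) cl(1)[OF i]] by (simp add: elts_osucc[OF x(2)])
      then have "coord (?y c) i = w c i" for c by (rule coord_mk[OF i])
      ultimately have "w ozero i = w (osucc ozero) i" by metis
      then show False using one_neq_zero unfolding w_def by (metis fun_upd_same option.inject)
    qed
    ultimately show ?thesis using yDT[OF zero_in_omega] yDT[OF one_in_omega] dom_mk by blast
  qed
  show "\<exists>\<theta>\<in>elts \<kappa>. \<forall>a\<in>A. dom a \<subseteq> elts \<theta>" if A: "is_antichain DT map_less A" for A
  proof -
    have AT: "A \<subseteq> DT" and anti: "\<And>a b. a \<in> A \<Longrightarrow> b \<in> A \<Longrightarrow> \<not> map_less a b"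
      using A unfolding is_antichain_def by blast+
    \<comment> \<open>Only elements of length at least \<delta> have all their coordinates above s;
      the shorter ones are bounded by \<delta>.\<close>
    define A' where "A' = {a \<in> A. elts \<delta> \<subseteq> dom a}"
    have "\<exists>\<alpha>\<in>elts \<kappa>. \<forall>v\<in>vec ` A'. \<exists>\<gamma>\<in>elts \<alpha>. v \<in> vecs \<tau> s \<gamma>"
    proof (rule vector_antichain_bounded[OF \<delta> \<tau> s])
      show "\<exists>\<gamma>\<in>elts \<kappa>. elts \<delta> \<subseteq> elts \<gamma> \<and> v \<in> vecs \<tau> s \<gamma>" if v: "v \<in> vec ` A'" for v
      proof -
        obtain a where a: "a \<in> A" "elts \<delta> \<subseteq> dom a" "v = vec a" using v unfolding A'_def by blast
        then have aD: "a \<in> DT" using AT by blast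
        then obtain \<gamma> where \<gamma>: "\<gamma> \<in> elts \<kappa>" "dom a = elts \<gamma>" using DT_dom by blast
        have "vec a \<in> vecs \<tau> s \<gamma>"
          unfolding vecs_def using dom_vec the_vec DT_level(2,3)[OF aD \<gamma>(2)] a(2) \<gamma>(2) by simp
        then show ?thesis using \<gamma> a by auto
      qed
      show "v = w" if v: "v \<in> vec ` A'" "w \<in> vec ` A'"
        and le: "\<And>i. i \<in> elts \<tau> \<Longrightarrow> the (v i) \<subseteq>\<^sub>m the (w i)" for v w
      proof -
        obtain a b where ab: "a \<in> A" "b \<in> A" "v = vec a" "w = vec b" using v unfolding A'_def by blast
        have "a \<subseteq>\<^sub>m b" by (rule DT_le) (use ab AT le in auto)
        then have "a = b" using anti[OF ab(1,2)] unfolding map_less_def by blast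
        then show ?thesis using ab by simp
      qed
    qed
    then obtain \<alpha> where \<alpha>: "\<alpha> \<in> elts \<kappa>" "\<forall>v\<in>vec ` A'. \<exists>\<gamma>\<in>elts \<alpha>. v \<in> vecs \<tau> s \<gamma>" by blast
    obtain \<theta> where \<theta>: "\<theta> \<in> elts \<kappa>" "\<alpha> \<in> elts \<theta>" "\<delta> \<in> elts \<theta>" by (rule common_bound[OF \<alpha>(1) \<delta>])
    note \<theta>sub = Ord_mem_subset[OF Ord_below[OF \<theta>(1)]]
    have "dom a \<subseteq> elts \<theta>" if a: "a \<in> A" for a
    proof -
      have aD: "a \<in> DT" using a AT by blast
      obtain \<beta> where \<beta>: "\<beta> \<in> elts \<kappa>" "dom a = elts \<beta>" using DT_dom[OF aD] by blast
      show ?thesis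
      proof (cases "elts \<delta> \<subseteq> dom a")
        case True
        then have "vec a \<in> vec ` A'" using a unfolding A'_def by blast
        then obtain \<gamma> where \<gamma>: "\<gamma> \<in> elts \<alpha>" "vec a \<in> vecs \<tau> s \<gamma>" using \<alpha>(2) by blast
        obtain i where i: "i \<in> elts \<tau>" using \<tau>(2) elts_empty_iff by blast
        have "coord a i \<in> lev \<gamma>" using \<gamma>(2) i the_vec[OF i] unfolding vecs_def by auto
        then have "dom (coord a i) = elts \<gamma>" by (rule lev_dom[OF below_trans[OF \<alpha>(1) \<gamma>(1)]])
        moreover have "dom (coord a i) = elts \<beta>" by (rule lev_dom[OF \<beta>(1) DT_level(2)[OF aD \<beta>(2) i]])
        ultimately have "dom a = elts \<gamma>" using \<beta>(2) by simp
        also have "\<dots> \<subseteq> elts \<alpha>" by (rule Ord_mem_subset[OF Ord_below[OF \<alpha>(1)] \<gamma>(1)])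
        also have "\<dots> \<subseteq> elts \<theta>" by (rule \<theta>sub[OF \<theta>(2)])
        finally show ?thesis .
      next
        case False
        then have "\<beta> \<in> elts \<delta>" using below_not_mem_iff[OF \<beta>(1) \<delta>] \<beta>(2) by blast
        then have "elts \<beta> \<subseteq> elts \<delta>" by (rule Ord_mem_subset[OF Ord_below[OF \<delta>]])
        then show ?thesis using \<theta>sub[OF \<theta>(3)] \<beta>(2) by blast
      qed
    qed
    then show ?thesis using \<theta>(1) by blast
  qed
qed

end

lemma chi_free_TT: "chi_free \<kappa> \<chi> TT"
  unfolding chi_free_def
proof (intro conjI ballI allI impI)
  fix \<delta> \<tau> s assume \<delta>: "\<delta> \<in> elts \<kappa>" and \<tau>: "\<tau> \<in> elts \<chi>"
    and s: "\<tau> \<noteq> ozero \<and> inj_on s (elts \<tau>) \<and> s ` elts \<tau> \<subseteq> stl_level TT \<delta>"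
  then show "souslin \<kappa> (derived_tree \<kappa> TT \<tau> s) map_less"
    using souslin_DT[OF \<delta> \<tau>] unfolding stl_level_TT[OF \<delta>] by blast
qed (rule souslin_TT)

end

theorem theorem6p27:
  fixes \<kappa> \<chi> \<sigma> :: "'k hset"
  assumes "regular_card \<kappa>" and "uncountable (elts \<kappa>)"
    and "\<chi> \<in> elts \<kappa>" and "regular_card \<chi>" and "less_closed \<chi> \<kappa>"
    and "\<sigma> \<in> elts \<kappa>"
    and "P_bullet \<kappa> \<kappa> (sqsub \<chi>) \<kappa> {E_ge \<kappa> \<chi>} (osucc (osucc ozero))"
  shows "\<exists>T. streamlined_souslin \<kappa> T \<and> normal_tree T \<and> prolific_tree \<kappa> T \<and> splitting_tree \<sigma> T \<and>
    chi_complete \<chi> T \<and> chi_free \<kappa> \<chi> T"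
proof -
  from assms(7)[unfolded P_bullet_def] obtain \<C> B where
    B: "disjoint_family_on B (elts \<kappa>)" "(\<Union>\<iota>\<in>elts \<kappa>. B \<iota>) = elts \<kappa>"
    and C: "\<forall>\<alpha>\<in>acc_pts (elts \<kappa>).
        \<C> \<alpha> \<subseteq> {C \<in> club_funs \<kappa>. sup_dom C = \<alpha>} \<and> \<C> \<alpha> \<noteq> {} \<and> |\<C> \<alpha>| <o |elts \<kappa>| \<and>
        (\<forall>C\<in>\<C> \<alpha>. \<forall>\<alpha>'\<in>acc_pts (dom C). \<exists>D\<in>\<C> \<alpha>'. sqsub \<chi> D C)"
    and G: "\<forall>\<Omega> p \<iota>.
        (\<forall>i\<in>elts \<kappa>. \<Omega> i \<subseteq> H_card \<kappa> \<and> p i \<in> H_plus \<kappa> \<and> \<iota> i \<in> elts \<kappa>) \<longrightarrow>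
        (\<forall>S\<in>{E_ge \<kappa> \<chi>}. \<forall>n\<in>elts omega.
          stationary_in
            {\<alpha> \<in> S. |\<C> \<alpha>| <o |elts (osucc (osucc (ozero :: 'k hset)))| \<and>
              (\<forall>C\<in>\<C> \<alpha>. \<forall>i\<in>elts \<alpha> \<inter> elts \<kappa>.
                osup {\<gamma> \<in> dom C. succ_set n (dom C - elts \<gamma>) \<subseteq> guess \<kappa> (B (\<iota> i)) (\<Omega> i) (p i) C}
                  = \<alpha>)}
            \<kappa>)"
    by (elim exE conjE)
  interpret proxy \<kappa> \<chi> \<sigma> \<C> B
  proof
    show "infinite (elts \<chi>)" using assms(4) unfolding regular_card_def by blast
  qed (use assms(1-3,5,6) B C G in simp_all)
  show ?thesis
    using streamlined_TT souslin_TT normal_TT prolific_TT splitting_TT chi_complete_TT chi_free_TT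
    unfolding streamlined_souslin_def by blast
qed

end
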